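(* Let $(V=\mathbb C^n,J,g)$ be the standard pseudo-Hermitian vector space of complex signature $(p,q)$, $p+q=n$. Let $W\subset V$ be a complex isotropic subspace, and $f:V\to\mathbb C$ a holomorphic cubic polynomial which identifies with an element of $S^{0,3}W$ under the canonical identification $S^{3,0}V^*\cong S^{0,3}V$. Then $V_f:=(V,J,g,\nabla:=D+S_f)$, where $S_f:=\partial^3f+\overline{\partial^3f}\in S^3V^*$, is a flat special Kähler manifold with constant cubic form and with complete connections $D$ and $\nabla$. Moreover, any flat special Kähler manifold with constant cubic form is locally equivalent to an open subset of some space $V_f$ of this kind.
   Context: A (possibly indefinite) Kähler manifold is a (possibly indefinite) Riemannian manifold $(M,g)$ with a complex structure $J$, $DJ=0$ for the Levi-Civita connection $D$ of $g$, with $g$ Hermitian with respect to $J$; $\omega=g(J\cdot,\cdot)$. A special Kähler manifold $(M,g,J,\nabla)$ is a Kähler manifold with a torsionfree flat connection $\nabla$ such that $\nabla\omega=0$ and $(\nabla_XJ)Y=(\nabla_YJ)X$ for all vector fields $X,Y$; it is flat if $D$ is flat. It has constant cubic form if $DS=0$, where $S=\nabla-D$. Equivalences are diffeomorphisms preserving $g,J,\nabla$. Complete means geodesically complete. On $V$, $D$ is the canonical flat connection. A complex isotropic subspace is a $J$-invariant subspace isotropic for $\omega$ (equivalently for $g$). $V^{\mathbb C}=V\otimes\mathbb C=V^{1,0}\oplus V^{0,1}$ is the decomposition into $\pm i$-eigenspaces of $J$. $S^{0,3}V=S^3V^{0,1}$; for $J$-invariant $W$, $W^{0,1}=(W\otimes\mathbb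 C)\cap V^{0,1}$ and $S^{0,3}W=S^3W^{0,1}$. $S^{3,0}V^*$ is the space of complex cubic forms on $V^{\mathbb C}$ vanishing whenever one argument is in $V^{0,1}$; it is identified with the homogeneous holomorphic cubic polynomials on $V$, and with $S^{0,3}V$ via $v\mapsto\omega(v,\cdot)$ ($\omega$ extended complex bilinearly), which maps $V^{0,1}$ isomorphically onto the annihilator of $V^{0,1}$ in $(V^{\mathbb C})^*$. $\partial^3f(X,Y,Z)=X^{1,0}Y^{1,0}Z^{1,0}f$ for constant vector fields, with $X^{1,0}=\frac12(X-iJX)$. A cubic form $C\in S^3V^*$ is regarded as a map $X\mapsto C_X\in\mathfrak{sp}(V)$ by $\omega(C_XY,Z)=C(X,Y,Z)$, so that $D+S_f$ is a connection. *)

theory Defs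
  imports "HOL-Analysis.Analysis"
begin

section \<open>Smooth maps\<close>

primrec diff_on :: "nat \<Rightarrow> 'a::euclidean_space set \<Rightarrow> ('a \<Rightarrow> 'b::euclidean_space) \<Rightarrow> bool" where
  "diff_on 0 S f \<longleftrightarrow> continuous_on S f"
| "diff_on (Suc k) S f \<longleftrightarrow>
     (\<forall>x\<in>S. f differentiable (at x)) \<and>
     (\<forall>v. diff_on k S (\<lambda>x. frechet_derivative f (at x) v))"

text \<open>All sets \<open>S\<close> to which the following notions are applied are open.\<close>

definition smooth_on :: "'a::euclidean_space set \<Rightarrow> ('a \<Rightarrow> 'b::euclidean_space) \<Rightarrow> bool" where
  "smooth_on S f \<longleftrightarrow> (\<forall>k. diff_on k S f)"

definition diffeo_on :: "'a::euclidean_space set \<Rightarrow> ('a \<Rightarrow> 'b::euclidean_space) \<Rightarrow> bool" where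
  "diffeo_on S h \<longleftrightarrow> smooth_on S h \<and> inj_on h S \<and> open (h ` S) \<and> smooth_on (h ` S) (inv_into S h)"

abbreviation differential :: "('a::euclidean_space \<Rightarrow> 'b::euclidean_space) \<Rightarrow> 'a \<Rightarrow> 'a \<Rightarrow> 'b" where
  "differential h x \<equiv> frechet_derivative h (at x)"


section \<open>Manifolds with a metric, an almost complex structure and a connection\<close>

type_synonym ('a, 'e) chart = "'a set \<times> ('a \<Rightarrow> 'e)"

text \<open>
  Tensor fields and connections are given by their components in each chart, as functions of the
  coordinate vector: in a chart \<open>(U, \<phi>)\<close>, only the values at points of \<open>\<phi> ` U\<close> are relevant.
  The components of a connection are its Christoffel symbols,
  \<open>\<Gamma> x u v = \<nabla>\<^sub>u v\<close> for constant coordinate fields \<open>u\<close>, \<open>v\<close>.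
\<close>

type_synonym ('a, 'e) metric_field = "('a, 'e) chart \<Rightarrow> 'e \<Rightarrow> 'e \<Rightarrow> 'e \<Rightarrow> real"
type_synonym ('a, 'e) endo_field = "('a, 'e) chart \<Rightarrow> 'e \<Rightarrow> 'e \<Rightarrow> 'e"
type_synonym ('a, 'e) connection = "('a, 'e) chart \<Rightarrow> 'e \<Rightarrow> 'e \<Rightarrow> 'e \<Rightarrow> 'e"

record ('a, 'e) geometry =
  mtop :: "'a topology"
  atlas :: "('a, 'e) chart set"
  metr :: "('a, 'e) metric_field"
  cplx :: "('a, 'e) endo_field"
  conn :: "('a, 'e) connection"

definition chart_image :: "('a, 'e) chart \<Rightarrow> 'e set" where
  "chart_image c = snd c ` fst c"

text \<open>
  The coordinate expression of a map \<open>F\<close> with respect to the charts \<open>c\<close> and \<open>c'\<close>, for \<open>F\<close> defined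
  on \<open>U\<close>, and its domain; \<open>F = id\<close> gives the change of coordinates.
\<close>

definition coord_rep ::
  "('a, 'e) chart \<Rightarrow> ('b, 'e) chart \<Rightarrow> ('a \<Rightarrow> 'b) \<Rightarrow> 'e \<Rightarrow> 'e" where
  "coord_rep c c' F = snd c' \<circ> F \<circ> inv_into (fst c) (snd c)"

definition coord_dom ::
  "('a, 'e) chart \<Rightarrow> ('b, 'e) chart \<Rightarrow> 'a set \<Rightarrow> ('a \<Rightarrow> 'b) \<Rightarrow> 'e set" where
  "coord_dom c c' U F = snd c ` {p \<in> U \<inter> fst c. F p \<in> fst c'}"

definition smooth_manifold :: "('a, 'e::euclidean_space, 'z) geometry_scheme \<Rightarrow> bool" where
  "smooth_manifold M \<longleftrightarrow>
     Hausdorff_space (mtop M) \<and> second_countable (mtop M) \<and>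
     (\<forall>c\<in>atlas M. openin (mtop M) (fst c) \<and> open (chart_image c) \<and>
        homeomorphic_map (subtopology (mtop M) (fst c)) (top_of_set (chart_image c)) (snd c)) \<and>
     topspace (mtop M) = (\<Union>c\<in>atlas M. fst c) \<and>
     (\<forall>c\<in>atlas M. \<forall>c'\<in>atlas M.
        diffeo_on (coord_dom c c' (topspace (mtop M)) id) (coord_rep c c' id))"

definition preserves_metric ::
  "'e::euclidean_space set \<Rightarrow> ('e \<Rightarrow> 'e) \<Rightarrow> ('e \<Rightarrow> 'e \<Rightarrow> 'e \<Rightarrow> real) \<Rightarrow> ('e \<Rightarrow> 'e \<Rightarrow> 'e \<Rightarrow> real) \<Rightarrow> bool" where
  "preserves_metric S h g g' \<longleftrightarrow>
     (\<forall>x\<in>S. \<forall>u v. g' (h x) (differential h x u) (differential h x v) = g x u v)"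

definition preserves_endo ::
  "'e::euclidean_space set \<Rightarrow> ('e \<Rightarrow> 'e) \<Rightarrow> ('e \<Rightarrow> 'e \<Rightarrow> 'e) \<Rightarrow> ('e \<Rightarrow> 'e \<Rightarrow> 'e) \<Rightarrow> bool" where
  "preserves_endo S h J J' \<longleftrightarrow>
     (\<forall>x\<in>S. \<forall>u. J' (h x) (differential h x u) = differential h x (J x u))"

text \<open>
  The transformation law of Christoffel symbols, i.e. \<open>h\<^sub>*(\<nabla>\<^sub>X Y) = \<nabla>'\<^sub>X\<^sub>' Y'\<close> with \<open>X' = h\<^sub>*X\<close>
  and \<open>Y' = h\<^sub>*Y\<close>.
\<close>

definition preserves_connection ::
  "'e::euclidean_space set \<Rightarrow> ('e \<Rightarrow> 'e) \<Rightarrow> ('e \<Rightarrow> 'e \<Rightarrow> 'e \<Rightarrow> 'e) \<Rightarrow> ('e \<Rightarrow> 'e \<Rightarrow> 'e \<Rightarrow> 'e) \<Rightarrow> bool" where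
  "preserves_connection S h \<Gamma> \<Gamma>' \<longleftrightarrow>
     (\<forall>x\<in>S. \<forall>u v.
        differential h x (\<Gamma> x u v) =
        differential (\<lambda>y. differential h y v) x u
          + \<Gamma>' (h x) (differential h x u) (differential h x v))"

definition pseudo_metric :: "('a, 'e::euclidean_space, 'z) geometry_scheme \<Rightarrow> bool" where
  "pseudo_metric M \<longleftrightarrow>
     (\<forall>c\<in>atlas M.
        (\<forall>u v. smooth_on (chart_image c) (\<lambda>x. metr M c x u v)) \<and>
        (\<forall>x\<in>chart_image c. bilinear (metr M c x) \<and>
           (\<forall>u v. metr M c x u v = metr M c x v u) \<and>
           (\<forall>u. (\<forall>v. metr M c x u v = 0) \<longrightarrow> u = 0))) \<and>
     (\<forall>c\<in>atlas M. \<forall>c'\<in>atlas M.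
        preserves_metric (coord_dom c c' (topspace (mtop M)) id) (coord_rep c c' id)
          (metr M c) (metr M c'))"

text \<open>
  An almost complex structure is a complex structure if it is given by multiplication with
  the imaginary unit in suitable local coordinates around each point.
\<close>

definition complex_structure :: "('a, complex ^ 'n, 'z) geometry_scheme \<Rightarrow> bool" where
  "complex_structure M \<longleftrightarrow>
     (\<forall>c\<in>atlas M.
        (\<forall>u. smooth_on (chart_image c) (\<lambda>x. cplx M c x u)) \<and>
        (\<forall>x\<in>chart_image c. linear (cplx M c x) \<and> (\<forall>u. cplx M c x (cplx M c x u) = - u)) \<and>
        (\<forall>x\<in>chart_image c. \<exists>S h. open S \<and> x \<in> S \<and> S \<subseteq> chart_image c \<and> diffeo_on S h \<and>
           preserves_endo S h (cplx M c) (\<lambda>_ u. \<i> *s u))) \<and>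
     (\<forall>c\<in>atlas M. \<forall>c'\<in>atlas M.
        preserves_endo (coord_dom c c' (topspace (mtop M)) id) (coord_rep c c' id)
          (cplx M c) (cplx M c'))"

definition is_connection ::
  "('a, 'e::euclidean_space, 'z) geometry_scheme \<Rightarrow> ('a, 'e) connection \<Rightarrow> bool" where
  "is_connection M \<Gamma> \<longleftrightarrow>
     (\<forall>c\<in>atlas M.
        (\<forall>u v. smooth_on (chart_image c) (\<lambda>x. \<Gamma> c x u v)) \<and>
        (\<forall>x\<in>chart_image c. bilinear (\<Gamma> c x))) \<and>
     (\<forall>c\<in>atlas M. \<forall>c'\<in>atlas M.
        preserves_connection (coord_dom c c' (topspace (mtop M)) id) (coord_rep c c' id)
          (\<Gamma> c) (\<Gamma> c'))"


section \<open>Covariant calculus\<close>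

text \<open>
  Everything below is local, so it is expressed through vector fields on chart domains.
\<close>

definition lie :: "('e::euclidean_space \<Rightarrow> 'e) \<Rightarrow> ('e \<Rightarrow> 'e) \<Rightarrow> 'e \<Rightarrow> 'e" where
  "lie X Y x = differential Y x (X x) - differential X x (Y x)"

definition cov ::
  "('e::euclidean_space \<Rightarrow> 'e \<Rightarrow> 'e \<Rightarrow> 'e) \<Rightarrow> ('e \<Rightarrow> 'e) \<Rightarrow> ('e \<Rightarrow> 'e) \<Rightarrow> 'e \<Rightarrow> 'e" where
  "cov \<Gamma> X Y x = differential Y x (X x) + \<Gamma> x (X x) (Y x)"

text \<open>\<open>(\<nabla>\<^sub>X b)(Y, Z)\<close>, \<open>(\<nabla>\<^sub>X A) Y\<close> and \<open>(\<nabla>\<^sub>X S)(Y, Z)\<close> for a bilinear form, an endomorphism field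
  and a tensor field of type (1,2).\<close>

definition cov_form ::
  "('e::euclidean_space \<Rightarrow> 'e \<Rightarrow> 'e \<Rightarrow> 'e) \<Rightarrow> ('e \<Rightarrow> 'e) \<Rightarrow> ('e \<Rightarrow> 'e \<Rightarrow> 'e \<Rightarrow> real) \<Rightarrow>
    ('e \<Rightarrow> 'e) \<Rightarrow> ('e \<Rightarrow> 'e) \<Rightarrow> 'e \<Rightarrow> real" where
  "cov_form \<Gamma> X b Y Z x =
     differential (\<lambda>y. b y (Y y) (Z y)) x (X x) - b x (cov \<Gamma> X Y x) (Z x) - b x (Y x) (cov \<Gamma> X Z x)"

definition cov_endo ::
  "('e::euclidean_space \<Rightarrow> 'e \<Rightarrow> 'e \<Rightarrow> 'e) \<Rightarrow> ('e \<Rightarrow> 'e) \<Rightarrow> ('e \<Rightarrow> 'e \<Rightarrow> 'e) \<Rightarrow>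
    ('e \<Rightarrow> 'e) \<Rightarrow> 'e \<Rightarrow> 'e" where
  "cov_endo \<Gamma> X A Y x = cov \<Gamma> X (\<lambda>y. A y (Y y)) x - A x (cov \<Gamma> X Y x)"

definition cov_tensor12 ::
  "('e::euclidean_space \<Rightarrow> 'e \<Rightarrow> 'e \<Rightarrow> 'e) \<Rightarrow> ('e \<Rightarrow> 'e) \<Rightarrow> ('e \<Rightarrow> 'e \<Rightarrow> 'e \<Rightarrow> 'e) \<Rightarrow>
    ('e \<Rightarrow> 'e) \<Rightarrow> ('e \<Rightarrow> 'e) \<Rightarrow> 'e \<Rightarrow> 'e" where
  "cov_tensor12 \<Gamma> X S Y Z x =
     cov \<Gamma> X (\<lambda>y. S y (Y y) (Z y)) x - S x (cov \<Gamma> X Y x) (Z x) - S x (Y x) (cov \<Gamma> X Z x)"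

definition curvature ::
  "('e::euclidean_space \<Rightarrow> 'e \<Rightarrow> 'e \<Rightarrow> 'e) \<Rightarrow> ('e \<Rightarrow> 'e) \<Rightarrow> ('e \<Rightarrow> 'e) \<Rightarrow> ('e \<Rightarrow> 'e) \<Rightarrow> 'e \<Rightarrow> 'e" where
  "curvature \<Gamma> X Y Z x =
     cov \<Gamma> X (cov \<Gamma> Y Z) x - cov \<Gamma> Y (cov \<Gamma> X Z) x - cov \<Gamma> (lie X Y) Z x"

definition torsion_free ::
  "('a, 'e::euclidean_space, 'z) geometry_scheme \<Rightarrow> ('a, 'e) connection \<Rightarrow> bool" where
  "torsion_free M \<Gamma> \<longleftrightarrow>
     (\<forall>c\<in>atlas M. \<forall>X Y. smooth_on (chart_image c) X \<longrightarrow> smooth_on (chart_image c) Y \<longrightarrow>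
        (\<forall>x\<in>chart_image c. cov (\<Gamma> c) X Y x - cov (\<Gamma> c) Y X x = lie X Y x))"

definition flat_connection ::
  "('a, 'e::euclidean_space, 'z) geometry_scheme \<Rightarrow> ('a, 'e) connection \<Rightarrow> bool" where
  "flat_connection M \<Gamma> \<longleftrightarrow>
     (\<forall>c\<in>atlas M. \<forall>X Y Z.
        smooth_on (chart_image c) X \<longrightarrow> smooth_on (chart_image c) Y \<longrightarrow> smooth_on (chart_image c) Z \<longrightarrow>
        (\<forall>x\<in>chart_image c. curvature (\<Gamma> c) X Y Z x = 0))"

definition parallel_form ::
  "('a, 'e::euclidean_space, 'z) geometry_scheme \<Rightarrow> ('a, 'e) connection \<Rightarrow>
    ('a, 'e) metric_field \<Rightarrow> bool" where
  "parallel_form M \<Gamma> b \<longleftrightarrow>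
     (\<forall>c\<in>atlas M. \<forall>X Y Z.
        smooth_on (chart_image c) X \<longrightarrow> smooth_on (chart_image c) Y \<longrightarrow> smooth_on (chart_image c) Z \<longrightarrow>
        (\<forall>x\<in>chart_image c. cov_form (\<Gamma> c) X (b c) Y Z x = 0))"

definition parallel_endo ::
  "('a, 'e::euclidean_space, 'z) geometry_scheme \<Rightarrow> ('a, 'e) connection \<Rightarrow>
    ('a, 'e) endo_field \<Rightarrow> bool" where
  "parallel_endo M \<Gamma> A \<longleftrightarrow>
     (\<forall>c\<in>atlas M. \<forall>X Y. smooth_on (chart_image c) X \<longrightarrow> smooth_on (chart_image c) Y \<longrightarrow>
        (\<forall>x\<in>chart_image c. cov_endo (\<Gamma> c) X (A c) Y x = 0))"

definition parallel_tensor12 ::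
  "('a, 'e::euclidean_space, 'z) geometry_scheme \<Rightarrow> ('a, 'e) connection \<Rightarrow>
    (('a, 'e) chart \<Rightarrow> 'e \<Rightarrow> 'e \<Rightarrow> 'e \<Rightarrow> 'e) \<Rightarrow> bool" where
  "parallel_tensor12 M \<Gamma> S \<longleftrightarrow>
     (\<forall>c\<in>atlas M. \<forall>X Y Z.
        smooth_on (chart_image c) X \<longrightarrow> smooth_on (chart_image c) Y \<longrightarrow> smooth_on (chart_image c) Z \<longrightarrow>
        (\<forall>x\<in>chart_image c. cov_tensor12 (\<Gamma> c) X (S c) Y Z x = 0))"


section \<open>Special Kaehler manifolds\<close>

text \<open>
  The Levi-Civita connection \<open>D\<close> is determined by the metric; it is carried along as an explicit
  argument because its components are unspecified outside the chart images.
\<close>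

definition levi_civita ::
  "('a, 'e::euclidean_space, 'z) geometry_scheme \<Rightarrow> ('a, 'e) connection \<Rightarrow> bool" where
  "levi_civita M D \<longleftrightarrow> is_connection M D \<and> torsion_free M D \<and> parallel_form M D (metr M)"

definition kaehler_form :: "('a, 'e, 'z) geometry_scheme \<Rightarrow> ('a, 'e) metric_field" where
  "kaehler_form M c x u v = metr M c x (cplx M c x u) v"

definition kaehler_manifold ::
  "('a, complex ^ 'n, 'z) geometry_scheme \<Rightarrow> ('a, complex ^ 'n) connection \<Rightarrow> bool" where
  "kaehler_manifold M D \<longleftrightarrow>
     smooth_manifold M \<and> pseudo_metric M \<and> complex_structure M \<and> levi_civita M D \<and>
     parallel_endo M D (cplx M) \<and>
     (\<forall>c\<in>atlas M. \<forall>x\<in>chart_image c. \<forall>u v.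
        metr M c x (cplx M c x u) (cplx M c x v) = metr M c x u v)"

definition special_kaehler_manifold ::
  "('a, complex ^ 'n, 'z) geometry_scheme \<Rightarrow> ('a, complex ^ 'n) connection \<Rightarrow> bool" where
  "special_kaehler_manifold M D \<longleftrightarrow>
     kaehler_manifold M D \<and> is_connection M (conn M) \<and>
     torsion_free M (conn M) \<and> flat_connection M (conn M) \<and>
     parallel_form M (conn M) (kaehler_form M) \<and>
     (\<forall>c\<in>atlas M. \<forall>X Y. smooth_on (chart_image c) X \<longrightarrow> smooth_on (chart_image c) Y \<longrightarrow>
        (\<forall>x\<in>chart_image c.
           cov_endo (conn M c) X (cplx M c) Y x = cov_endo (conn M c) Y (cplx M c) X x))"

definition flat_special_kaehler_manifold ::
  "('a, complex ^ 'n, 'z) geometry_scheme \<Rightarrow> ('a, complex ^ 'n) connection \<Rightarrow> bool" where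
  "flat_special_kaehler_manifold M D \<longleftrightarrow> special_kaehler_manifold M D \<and> flat_connection M D"

definition constant_cubic_form ::
  "('a, 'e::euclidean_space, 'z) geometry_scheme \<Rightarrow> ('a, 'e) connection \<Rightarrow> bool" where
  "constant_cubic_form M D \<longleftrightarrow>
     parallel_tensor12 M D (\<lambda>c x u v. conn M c x u v - D c x u v)"


section \<open>Completeness and local equivalence\<close>

text \<open>In each chart, \<open>v\<close> is the coordinate velocity of the curve.\<close>

definition geodesic_on ::
  "('a, 'e::euclidean_space, 'z) geometry_scheme \<Rightarrow> ('a, 'e) connection \<Rightarrow> real set \<Rightarrow>
    (real \<Rightarrow> 'a) \<Rightarrow> bool" where
  "geodesic_on M \<Gamma> I \<gamma> \<longleftrightarrow>
     continuous_map (top_of_set I) (mtop M) \<gamma> \<and>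
     (\<forall>c\<in>atlas M. \<exists>v. \<forall>t\<in>I. \<gamma> t \<in> fst c \<longrightarrow>
        ((\<lambda>s. snd c (\<gamma> s)) has_vector_derivative v t) (at t) \<and>
        (v has_vector_derivative - \<Gamma> c (snd c (\<gamma> t)) (v t) (v t)) (at t))"

definition complete_connection ::
  "('a, 'e::euclidean_space, 'z) geometry_scheme \<Rightarrow> ('a, 'e) connection \<Rightarrow> bool" where
  "complete_connection M \<Gamma> \<longleftrightarrow>
     (\<forall>I \<gamma>. open I \<and> is_interval I \<and> I \<noteq> {} \<and> geodesic_on M \<Gamma> I \<gamma> \<longrightarrow>
        (\<exists>\<gamma>'. geodesic_on M \<Gamma> UNIV \<gamma>' \<and> (\<forall>t\<in>I. \<gamma>' t = \<gamma> t)))"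

definition equivalence ::
  "('a, 'e::euclidean_space, 'y) geometry_scheme \<Rightarrow> 'a set \<Rightarrow>
    ('b, 'e, 'z) geometry_scheme \<Rightarrow> 'b set \<Rightarrow> ('a \<Rightarrow> 'b) \<Rightarrow> bool" where
  "equivalence M U M' U' F \<longleftrightarrow>
     homeomorphic_map (subtopology (mtop M) U) (subtopology (mtop M') U') F \<and>
     (\<forall>c\<in>atlas M. \<forall>c'\<in>atlas M'.
        let S = coord_dom c c' U F; h = coord_rep c c' F in
          diffeo_on S h \<and>
          preserves_metric S h (metr M c) (metr M' c') \<and>
          preserves_endo S h (cplx M c) (cplx M' c') \<and>
          preserves_connection S h (conn M c) (conn M' c'))"

definition locally_equivalent_at ::
  "('a, 'e::euclidean_space, 'y) geometry_scheme \<Rightarrow> 'a \<Rightarrow> ('b, 'e, 'z) geometry_scheme \<Rightarrow> bool" where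
  "locally_equivalent_at M p M' \<longleftrightarrow>
     (\<exists>U U' F. openin (mtop M) U \<and> p \<in> U \<and> openin (mtop M') U' \<and> equivalence M U M' U' F)"


section \<open>The standard pseudo-Hermitian vector space and its complexification\<close>

text \<open>
  \<open>P\<close> is the set of the positive coordinate directions, so the complex signature is
  \<open>(card P, card (- P))\<close>.
\<close>

definition std_metric :: "'n set \<Rightarrow> complex ^ 'n \<Rightarrow> complex ^ 'n \<Rightarrow> real" where
  "std_metric P u v = Re (\<Sum>i\<in>UNIV. (if i \<in> P then 1 else - 1) * u $ i * cnj (v $ i))"

definition std_omega :: "'n set \<Rightarrow> complex ^ 'n \<Rightarrow> complex ^ 'n \<Rightarrow> real" where
  "std_omega P u v = std_metric P (\<i> *s u) v"

definition complex_isotropic :: "'n::finite set \<Rightarrow> (complex ^ 'n) set \<Rightarrow> bool" where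
  "complex_isotropic P W \<longleftrightarrow>
     subspace W \<and> (\<forall>w\<in>W. \<i> *s w \<in> W) \<and> (\<forall>u\<in>W. \<forall>v\<in>W. std_omega P u v = 0)"

text \<open>
  The pair \<open>(A, B)\<close> stands for \<open>A \<otimes> 1 + B \<otimes> \<i>\<close>; the second factor is unrelated to
  the complex structure \<open>J = (*s) \<i>\<close>.
\<close>

type_synonym 'n cvec = "(complex ^ 'n) \<times> (complex ^ 'n)"
type_synonym 'n cform3 = "'n cvec \<Rightarrow> 'n cvec \<Rightarrow> 'n cvec \<Rightarrow> complex"

definition cscale :: "complex \<Rightarrow> 'n::finite cvec \<Rightarrow> 'n cvec" where
  "cscale z X = (Re z *\<^sub>R fst X - Im z *\<^sub>R snd X, Re z *\<^sub>R snd X + Im z *\<^sub>R fst X)"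

definition J_C :: "'n::finite cvec \<Rightarrow> 'n cvec" where
  "J_C X = (\<i> *s fst X, \<i> *s snd X)"

definition omega_C :: "'n::finite set \<Rightarrow> 'n cvec \<Rightarrow> 'n cvec \<Rightarrow> complex" where
  "omega_C P X Y =
     Complex (std_omega P (fst X) (fst Y) - std_omega P (snd X) (snd Y))
             (std_omega P (fst X) (snd Y) + std_omega P (snd X) (fst Y))"

definition V01 :: "'n::finite cvec set" where
  "V01 = {X. J_C X = cscale (- \<i>) X}"

definition sub01 :: "(complex ^ 'n::finite) set \<Rightarrow> 'n cvec set" where
  "sub01 W = (W \<times> W) \<inter> V01"

definition forms30 :: "'n::finite cform3 set" where
  "forms30 = {F.
     (\<forall>X X' Y Z. F (X + X') Y Z = F X Y Z + F X' Y Z) \<and>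
     (\<forall>z X Y Z. F (cscale z X) Y Z = z * F X Y Z) \<and>
     (\<forall>X Y Z. F X Y Z = F Y X Z \<and> F X Y Z = F X Z Y) \<and>
     (\<forall>X\<in>V01. \<forall>Y Z. F X Y Z = 0)}"

text \<open>
  The symmetric product of three linear functionals, up to the factor 1/6, which does not affect
  linear spans.
\<close>

definition sym_prod ::
  "('n cvec \<Rightarrow> complex) \<Rightarrow> ('n cvec \<Rightarrow> complex) \<Rightarrow> ('n cvec \<Rightarrow> complex) \<Rightarrow> 'n cform3" where
  "sym_prod \<alpha> \<beta> \<gamma> X Y Z =
     \<alpha> X * \<beta> Y * \<gamma> Z + \<alpha> X * \<gamma> Y * \<beta> Z + \<beta> X * \<alpha> Y * \<gamma> Z +
     \<beta> X * \<gamma> Y * \<alpha> Z + \<gamma> X * \<alpha> Y * \<beta> Z + \<gamma> X * \<beta> Y * \<alpha> Z"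

text \<open>
  The image of \<open>S\<^sup>3 W\<^sup>0\<^sup>,\<^sup>1\<close> under the isomorphism of \<open>S\<^sup>3 V\<^sup>0\<^sup>,\<^sup>1\<close> with the forms of type (3,0) that is
  induced by \<open>v \<mapsto> \<omega>(v, \<cdot>)\<close>: the third symmetric power is spanned by the products \<open>u v w\<close>, and such
  a product is sent to the product of the three functionals \<open>\<omega>(u, \<cdot>)\<close>, \<open>\<omega>(v, \<cdot>)\<close>, \<open>\<omega>(w, \<cdot>)\<close>.
\<close>

definition S03_image :: "'n::finite set \<Rightarrow> (complex ^ 'n) set \<Rightarrow> 'n cform3 set" where
  "S03_image P W = {F. \<exists>(m::nat) c u v w.
     (\<forall>i<m. u i \<in> sub01 W \<and> v i \<in> sub01 W \<and> w i \<in> sub01 W) \<and>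
     F = (\<lambda>X Y Z. \<Sum>i<m. c i *
            sym_prod (omega_C P (u i)) (omega_C P (v i)) (omega_C P (w i)) X Y Z)}"

text \<open>
  A form of type (3,0) is identified with the homogeneous holomorphic cubic polynomial obtained by
  restricting it to the diagonal of \<open>V\<close>.
\<close>

definition cubic_poly_of_form :: "'n::finite cform3 \<Rightarrow> complex ^ 'n \<Rightarrow> complex" where
  "cubic_poly_of_form F v = F (v, 0) (v, 0) (v, 0)"

definition cubic_poly_in_S03 ::
  "'n::finite set \<Rightarrow> (complex ^ 'n) set \<Rightarrow> (complex ^ 'n \<Rightarrow> complex) \<Rightarrow> bool" where
  "cubic_poly_in_S03 P W f \<longleftrightarrow> (\<exists>F \<in> forms30 \<inter> S03_image P W. f = cubic_poly_of_form F)"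


section \<open>The spaces associated with a cubic polynomial\<close>

definition deriv10 ::
  "complex ^ 'n::finite \<Rightarrow> (complex ^ 'n \<Rightarrow> complex) \<Rightarrow> complex ^ 'n \<Rightarrow> complex" where
  "deriv10 X f p = (differential f p X - \<i> * differential f p (\<i> *s X)) / 2"

definition del3 ::
  "(complex ^ 'n::finite \<Rightarrow> complex) \<Rightarrow> complex ^ 'n \<Rightarrow> complex ^ 'n \<Rightarrow> complex ^ 'n \<Rightarrow>
    complex ^ 'n \<Rightarrow> complex" where
  "del3 f p X Y Z = deriv10 X (deriv10 Y (deriv10 Z f)) p"

definition S_form ::
  "(complex ^ 'n::finite \<Rightarrow> complex) \<Rightarrow> complex ^ 'n \<Rightarrow> complex ^ 'n \<Rightarrow> complex ^ 'n \<Rightarrow>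
    complex ^ 'n \<Rightarrow> real" where
  "S_form f p X Y Z = Re (del3 f p X Y Z + cnj (del3 f p X Y Z))"

definition S_tensor ::
  "'n::finite set \<Rightarrow> (complex ^ 'n \<Rightarrow> complex) \<Rightarrow> complex ^ 'n \<Rightarrow> complex ^ 'n \<Rightarrow>
    complex ^ 'n \<Rightarrow> complex ^ 'n" where
  "S_tensor P f p X Y = (THE U. \<forall>Z. std_omega P U Z = S_form f p X Y Z)"

definition D_std :: "('a, complex ^ 'n) connection" where
  "D_std c x u v = 0"

definition V_space ::
  "'n::finite set \<Rightarrow> (complex ^ 'n \<Rightarrow> complex) \<Rightarrow> (complex ^ 'n, complex ^ 'n) geometry" where
  "V_space P f =
     \<lparr> mtop = euclidean,
       atlas = {(UNIV, id)},
       metr = (\<lambda>c x. std_metric P),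
       cplx = (\<lambda>c x u. \<i> *s u),
       conn = (\<lambda>c x u v. D_std c x u v + S_tensor P f x u v) \<rparr>"

end

theory Submission
  imports Defs
begin

text \<open>
  Since \<open>D S = 0\<close>, flatness of \<open>D\<close> and of \<open>D + S\<close> amounts to \<open>[S\<^sub>X, S\<^sub>Y] = 0\<close>. The special condition gives
  \<open>S\<^sub>J\<^sub>X = - J S\<^sub>X = S\<^sub>X J\<close>, so replacing \<open>X\<close> by \<open>J X\<close> in \<open>S\<^sub>X S\<^sub>Y = S\<^sub>Y S\<^sub>X\<close> changes one sign and
  \<open>S\<^sub>X S\<^sub>Y = 0\<close>. As \<open>S\<^sub>X\<close> is \<open>\<omega>\<close>-skew, the span \<open>W\<close> of all \<open>S\<^sub>X Y\<close> is then complex isotropic, and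
  \<open>\<omega>(S\<^sub>X Y, Z)\<close> is the real part of a complex cubic form which factors through the functionals
  \<open>\<omega>(w, _)\<close>, \<open>w \<in> W\<close>. Conversely, for \<open>f\<close> in \<open>S\<^sup>0\<^sup>,\<^sup>3 W\<close> the relation \<open>S\<^sub>X S\<^sub>Y = 0\<close> gives flatness of
  \<open>D + S\<^sub>f\<close> and makes its geodesics quadratic curves. In \<open>D\<close>-flat coordinates \<open>g\<close>, \<open>J\<close> and \<open>S\<close> are
  constant; hence the isomorphism type of \<open>(T\<^sub>qM, g, J, S)\<close> is locally constant in \<open>q\<close>, and a single
  model serves a whole connected component.
\<close>

section \<open>Differential calculus\<close>

text \<open>The analysis rests on one computation, the radial integral of a vector-valued one-form.
  For the differential of a function it gives the symmetry of second derivatives, for an integrable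
  system it controls the iterates, and for the parallel coframe it produces the flat chart; each
  time closedness enters through the same error integral. Smoothness is expressed by derivatives in
  fixed directions, so tensor fields are differentiated with frozen arguments, and variable
  arguments are restored by expansion in a basis. The obstacle in the globalization is that
  \<open>P\<close>, \<open>W\<close> and \<open>f\<close> depend on a choice of unitary frame, so
  that models chosen separately at nearby points need not agree. What is propagated is therefore not
  a choice of data but the existence of an adapted frame for a given pair \<open>P\<close>,
  \<open>\<sigma>\<close>. This property does not depend on the chart, and one neighbourhood on
  which it is constant serves all pairs at once.\<close>

lemma linear_Basis_expansion:
  fixes A :: "'e::euclidean_space \<Rightarrow> 'f::real_vector"
  assumes "linear A"
  shows "A x = (\<Sum>i\<in>Basis. (x \<bullet> i) *\<^sub>R A i)"
proof -
  have "A x = A (\<Sum>i\<in>Basis. (x \<bullet> i) *\<^sub>R i)" by (simp add: euclidean_representation)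
  also have "\<dots> = (\<Sum>i\<in>Basis. (x \<bullet> i) *\<^sub>R A i)"
    by (simp add: linear_sum[OF assms] linear_scale[OF assms])
  finally show ?thesis .
qed

lemma linear_bilinear_left: "bilinear B \<Longrightarrow> linear (\<lambda>u. B u v)"
  and linear_bilinear_right: "bilinear B \<Longrightarrow> linear (B u)"
  by (auto simp: bilinear_def)

text \<open>The derivative is known only for one fixed vector \<open>w\<close> at a time. Uniqueness
  of derivatives transfers linearity: \<open>A y (v + w)\<close> can be differentiated as it stands
  or after splitting, with the same result.\<close>

lemma linear_field_derivative:
  fixes A :: "'a::real_normed_vector \<Rightarrow> 'e::euclidean_space \<Rightarrow> 'f::real_normed_vector"
  assumes S: "open S" "x \<in> S" and lin: "\<And>y. y \<in> S \<Longrightarrow> linear (A y)"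
    and dA: "\<And>w. ((\<lambda>y. A y w) has_derivative (\<lambda>u. A' u w)) (at x)"
  shows "linear (A' u)"
proof (rule linearI)
  show "A' u (v + w) = A' u v + A' u w" for v w
  proof -
    have "((\<lambda>y. A y (v + w)) has_derivative (\<lambda>u. A' u v + A' u w)) (at x)"
      by (rule has_derivative_transform_within_open[OF has_derivative_add[OF dA dA] S])
        (simp add: lin linear_add)
    from has_derivative_unique[OF dA this] show ?thesis by metis
  qed
  show "A' u (c *\<^sub>R v) = c *\<^sub>R A' u v" for c v
  proof -
    have "((\<lambda>y. A y (c *\<^sub>R v)) has_derivative (\<lambda>u. c *\<^sub>R A' u v)) (at x)"
      by (rule has_derivative_transform_within_open[OF has_derivative_scaleR_right[OF dA] S])
        (simp add: lin linear_scale)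
    from has_derivative_unique[OF dA this] show ?thesis by metis
  qed
qed

text \<open>The product rule for a field of linear maps that is differentiated only with its
  argument frozen, which is how \<open>smooth_on\<close> supplies derivatives. In a basis it becomes
  a finite sum of products of a scalar and a vector function.\<close>

lemma has_derivative_linear_field:
  fixes A :: "'a::real_normed_vector \<Rightarrow> 'e::euclidean_space \<Rightarrow> 'f::real_normed_vector"
  assumes S: "open S" "x \<in> S" and lin: "\<And>y. y \<in> S \<Longrightarrow> linear (A y)"
    and dA: "\<And>w. ((\<lambda>y. A y w) has_derivative (\<lambda>u. A' u w)) (at x)"
    and dY: "(Y has_derivative Y') (at x)"
  shows "((\<lambda>y. A y (Y y)) has_derivative (\<lambda>u. A' u (Y x) + A x (Y' u))) (at x)"
proof -
  have exp: "A y w = (\<Sum>i\<in>Basis. (w \<bullet> i) *\<^sub>R A y i)" if "y \<in> S" for y w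
    using linear_Basis_expansion[OF lin[OF that]] .
  have A': "A' u w = (\<Sum>i\<in>Basis. (w \<bullet> i) *\<^sub>R A' u i)" for u w
    using linear_Basis_expansion[OF linear_field_derivative[OF S lin dA]] .
  have "((\<lambda>y. \<Sum>i\<in>Basis. (Y y \<bullet> i) *\<^sub>R A y i) has_derivative
      (\<lambda>u. \<Sum>i\<in>Basis. (Y x \<bullet> i) *\<^sub>R A' u i + (Y' u \<bullet> i) *\<^sub>R A x i)) (at x)"
    by (intro has_derivative_sum has_derivative_scaleR dA has_derivative_inner_left dY)
  also have "(\<lambda>u. \<Sum>i\<in>Basis. (Y x \<bullet> i) *\<^sub>R A' u i + (Y' u \<bullet> i) *\<^sub>R A x i)
      = (\<lambda>u. A' u (Y x) + A x (Y' u))"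
    by (rule ext) (simp add: sum.distrib exp[OF S(2), of "Y' _"] A'[of _ "Y x"])
  finally show ?thesis
    by (rule has_derivative_transform_within_open[OF _ S]) (metis exp)
qed

lemma has_derivative_bilinear_field:
  fixes B :: "'a::real_normed_vector \<Rightarrow> 'e::euclidean_space \<Rightarrow> 'g::euclidean_space \<Rightarrow> 'f::real_normed_vector"
  assumes S: "open S" "x \<in> S" and lin: "\<And>y. y \<in> S \<Longrightarrow> bilinear (B y)"
    and dB: "\<And>v w. ((\<lambda>y. B y v w) has_derivative (\<lambda>u. B' u v w)) (at x)"
    and dY: "(Y has_derivative Y') (at x)" and dZ: "(Z has_derivative Z') (at x)"
  shows "((\<lambda>y. B y (Y y) (Z y)) has_derivative
    (\<lambda>u. B' u (Y x) (Z x) + B x (Y' u) (Z x) + B x (Y x) (Z' u))) (at x)"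
proof -
  have 1: "((\<lambda>y. B y (Y y) w) has_derivative (\<lambda>u. B' u (Y x) w + B x (Y' u) w)) (at x)" for w
    using lin by (intro has_derivative_linear_field[OF S _ dB dY] linear_bilinear_left) auto
  show ?thesis
    using lin by (intro has_derivative_linear_field[OF S _ 1 dZ] linear_bilinear_right) auto
qed

lemma linear_imp_has_derivative: "linear f \<Longrightarrow> (f has_derivative f) (at x)"
  for f :: "'a::euclidean_space \<Rightarrow> 'b::real_normed_vector"
  by (simp add: bounded_linear_imp_has_derivative linear_conv_bounded_linear)

lemma frechet_derivative_linear: "linear f \<Longrightarrow> frechet_derivative f (at x) = f"
  for f :: "'a::euclidean_space \<Rightarrow> 'b::real_normed_vector"
  using frechet_derivative_at[OF linear_imp_has_derivative] by metis

section \<open>Calculus of finite orders of differentiability\<close>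

lemma diff_on_subset: "diff_on k S f \<Longrightarrow> T \<subseteq> S \<Longrightarrow> diff_on k T f"
  by (induction k arbitrary: f) (auto intro: continuous_on_subset)

lemma diff_on_cong:
  assumes "open S" "\<And>x. x \<in> S \<Longrightarrow> f x = g x" "diff_on k S f"
  shows "diff_on k S g"
  using assms(2,3)
proof (induction k arbitrary: f g)
  case 0
  then show ?case by (auto cong: continuous_on_cong)
next
  case (Suc k)
  have d: "f differentiable (at x)" if "x \<in> S" for x using Suc.prems that by simp
  have dg: "g differentiable (at x)" if "x \<in> S" for x
    using has_derivative_transform_within_open[OF _ assms(1) that, of f _ UNIV g] Suc.prems(1) d[OF that]
    unfolding differentiable_def by blast
  have eq: "frechet_derivative f (at x) v = frechet_derivative g (at x) v" if "x \<in> S" for x v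
    using frechet_derivative_transform_within_open[OF d[OF that] assms(1) that Suc.prems(1)] by simp
  have "diff_on k S (\<lambda>x. frechet_derivative f (at x) v)" for v
    using Suc.prems(2) by simp
  then have "diff_on k S (\<lambda>x. frechet_derivative g (at x) v)" for v
    by (rule Suc.IH[rotated]) (rule eq)
  with dg show ?case by simp
qed

lemma diff_on_SucI:
  assumes "open S" "\<And>x. x \<in> S \<Longrightarrow> (f has_derivative f' x) (at x)"
    and "\<And>v. diff_on k S (\<lambda>x. f' x v)"
  shows "diff_on (Suc k) S f"
proof -
  have "f' x v = frechet_derivative f (at x) v" if "x \<in> S" for x v
    using frechet_derivative_at[OF assms(2)[OF that]] by simp
  then have "diff_on k S (\<lambda>x. frechet_derivative f (at x) v)" for v
    by (rule diff_on_cong[OF assms(1) _ assms(3)])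
  then show ?thesis
    using assms(2) unfolding diff_on.simps(2) differentiable_def by blast
qed

lemma diff_on_Suc_has_derivative:
  "diff_on (Suc k) S f \<Longrightarrow> x \<in> S \<Longrightarrow> (f has_derivative frechet_derivative f (at x)) (at x)"
  by (simp add: frechet_derivative_works)

lemma diff_on_continuous: "diff_on k S f \<Longrightarrow> continuous_on S f"
  by (cases k)
    (auto intro!: continuous_at_imp_continuous_on differentiable_imp_continuous_within)

lemma diff_on_mono: "diff_on (Suc k) S f \<Longrightarrow> diff_on k S f"
proof (induction k arbitrary: f)
  case 0
  then show ?case using diff_on_continuous by (auto simp del: diff_on.simps(2))
next
  case (Suc k)
  show ?case
    unfolding diff_on.simps(2)[of k] using Suc.prems Suc.IH unfolding diff_on.simps(2)[of "Suc k"]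
    by blast
qed

lemma diff_on_const [simp]: "diff_on k S (\<lambda>x. c)"
  by (induction k arbitrary: c) auto

lemma diff_on_linear: "linear f \<Longrightarrow> diff_on k S f"
proof (cases k)
  case 0
  assume "linear f"
  then show ?thesis using 0
    by (simp add: linear_continuous_on linear_conv_bounded_linear)
next
  case (Suc j)
  assume "linear f"
  then show ?thesis
    using Suc by (auto simp: frechet_derivative_linear differentiable_def intro: linear_imp_has_derivative)
qed

lemma diff_on_add:
  assumes "open S" "diff_on k S f" "diff_on k S g"
  shows "diff_on k S (\<lambda>x. f x + g x)"
  using assms(2,3)
proof (induction k arbitrary: f g)
  case 0
  then show ?case by (auto intro: continuous_on_add)
next
  case (Suc k)
  note d = diff_on_Suc_has_derivative[OF Suc.prems(1)] diff_on_Suc_has_derivative[OF Suc.prems(2)]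
  show ?case
    by (rule diff_on_SucI[OF assms(1)], rule has_derivative_add[OF d], assumption, assumption)
      (use Suc in auto)
qed

lemma diff_on_sum:
  "open S \<Longrightarrow> (\<And>i. i \<in> I \<Longrightarrow> diff_on k S (f i)) \<Longrightarrow> diff_on k S (\<lambda>x. \<Sum>i\<in>I. f i x)"
  by (induction I rule: infinite_finite_induct) (auto intro: diff_on_add)

lemma diff_on_scaleR:
  assumes "open S" "diff_on k S f" "diff_on k S g"
  shows "diff_on k S (\<lambda>x. f x *\<^sub>R g x)"
  using assms(2,3)
proof (induction k arbitrary: f g)
  case 0
  then show ?case by (auto intro: continuous_on_scaleR)
next
  case (Suc k)
  note d = diff_on_Suc_has_derivative[OF Suc.prems(1)] diff_on_Suc_has_derivative[OF Suc.prems(2)]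
  note m = diff_on_mono[OF Suc.prems(1)] diff_on_mono[OF Suc.prems(2)]
  show ?case
    by (rule diff_on_SucI[OF assms(1)], rule has_derivative_scaleR[OF d], assumption, assumption)
      (use Suc m in \<open>auto intro!: Suc.IH diff_on_add assms(1)\<close>)
qed

lemma diff_on_linear_compose:
  assumes "open S" "linear L" "diff_on k S f"
  shows "diff_on k S (\<lambda>x. L (f x))"
  using assms(3)
proof (induction k arbitrary: f)
  case 0
  then show ?case using assms(2)
    by (auto simp: linear_conv_bounded_linear intro: bounded_linear.continuous_on)
next
  case (Suc k)
  have "((\<lambda>x. L (f x)) has_derivative (\<lambda>u. L (frechet_derivative f (at x) u))) (at x)" if "x \<in> S" for x
    using diff_on_Suc_has_derivative[OF Suc.prems that] assms(2)
    by (auto simp: linear_conv_bounded_linear intro: bounded_linear.has_derivative)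
  then show ?case
    by (rule diff_on_SucI[OF assms(1)]) (use Suc in auto)
qed

lemma diff_on_inner: "open S \<Longrightarrow> diff_on k S f \<Longrightarrow> diff_on k S (\<lambda>x. f x \<bullet> c)"
  by (rule diff_on_linear_compose) (auto intro: bounded_linear.linear bounded_linear_inner_left)

lemma diff_on_linear_field:
  fixes A :: "'a::euclidean_space \<Rightarrow> 'e::euclidean_space \<Rightarrow> 'f::euclidean_space"
  assumes S: "open S" and lin: "\<And>y. y \<in> S \<Longrightarrow> linear (A y)"
    and dA: "\<And>w. diff_on k S (\<lambda>y. A y w)" and dY: "diff_on k S Y"
  shows "diff_on k S (\<lambda>y. A y (Y y))"
proof (rule diff_on_cong[OF S])
  show "(\<Sum>i\<in>Basis. (Y x \<bullet> i) *\<^sub>R A x i) = A x (Y x)" if "x \<in> S" for x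
    using linear_Basis_expansion[OF lin[OF that]] by metis
  show "diff_on k S (\<lambda>x. \<Sum>i\<in>Basis. (Y x \<bullet> i) *\<^sub>R A x i)"
    by (intro diff_on_sum diff_on_scaleR diff_on_inner S dY dA)
qed

text \<open>Only \<open>f\<close> varies in the induction: by the chain rule the derivative is the
  linear field \<open>frechet_derivative f (at (g x))\<close> applied to a derivative of
  \<open>g\<close>, and the coefficients of that field are compositions of derivatives of
  \<open>f\<close> with the same \<open>g\<close>.\<close>

lemma diff_on_compose:
  fixes g :: "'a::euclidean_space \<Rightarrow> 'b::euclidean_space"
    and f :: "'b \<Rightarrow> 'c::euclidean_space"
  assumes "open S" "open T" "g ` S \<subseteq> T" "diff_on k T f" "diff_on k S g"
  shows "diff_on k S (\<lambda>x. f (g x))"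
  using assms(4,5)
proof (induction k arbitrary: f)
  case 0
  then show ?case using assms(3) by (auto intro: continuous_on_compose2)
next
  case (Suc k)
  have df: "(f has_derivative frechet_derivative f (at y)) (at y)" if "y \<in> T" for y
    using diff_on_Suc_has_derivative[OF Suc.prems(1) that] .
  have dg: "(g has_derivative frechet_derivative g (at y)) (at y)" if "y \<in> S" for y
    using diff_on_Suc_has_derivative[OF Suc.prems(2) that] .
  have "diff_on k S (\<lambda>x. frechet_derivative f (at (g x)) (frechet_derivative g (at x) v))" for v
  proof (rule diff_on_linear_field[OF assms(1), where A = "\<lambda>x. frechet_derivative f (at (g x))"])
    show "linear (frechet_derivative f (at (g y)))" if "y \<in> S" for y
      using has_derivative_linear[OF df] that assms(3) by auto
    show "diff_on k S (\<lambda>y. frechet_derivative f (at (g y)) w)" for w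
      using Suc.prems diff_on_mono[OF Suc.prems(2)] by (intro Suc.IH) auto
    show "diff_on k S (\<lambda>y. frechet_derivative g (at y) v)"
      using Suc.prems(2) by simp
  qed
  moreover have "((\<lambda>x. f (g x)) has_derivative
      (\<lambda>v. frechet_derivative f (at (g x)) (frechet_derivative g (at x) v))) (at x)" if "x \<in> S" for x
    using has_derivative_compose[OF dg[OF that] df] assms(3) that by (auto simp: o_def)
  ultimately show ?case
    by (intro diff_on_SucI[OF assms(1)])
qed

section \<open>Calculus of smooth maps\<close>

lemma smooth_on_subset: "smooth_on S f \<Longrightarrow> T \<subseteq> S \<Longrightarrow> smooth_on T f"
  unfolding smooth_on_def using diff_on_subset by blast

lemma smooth_on_cong: "open S \<Longrightarrow> (\<And>x. x \<in> S \<Longrightarrow> f x = g x) \<Longrightarrow> smooth_on S f \<Longrightarrow> smooth_on S g"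
  unfolding smooth_on_def using diff_on_cong by blast

lemma smooth_on_const [simp]: "smooth_on S (\<lambda>x. c)"
  by (simp add: smooth_on_def)

lemma smooth_on_linear: "linear f \<Longrightarrow> smooth_on S f"
  by (simp add: smooth_on_def diff_on_linear)

lemma smooth_on_linear_compose: "open S \<Longrightarrow> linear L \<Longrightarrow> smooth_on S f \<Longrightarrow> smooth_on S (\<lambda>x. L (f x))"
  by (simp add: smooth_on_def diff_on_linear_compose)

lemma smooth_on_add: "open S \<Longrightarrow> smooth_on S f \<Longrightarrow> smooth_on S g \<Longrightarrow> smooth_on S (\<lambda>x. f x + g x)"
  by (simp add: smooth_on_def diff_on_add)

lemma smooth_on_diff:
  assumes "open S" "smooth_on S f" "smooth_on S g"
  shows "smooth_on S (\<lambda>x. f x - g x)"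
proof -
  have "smooth_on S (\<lambda>x. f x + - g x)"
    using smooth_on_linear_compose[OF assms(1) linear_uminus assms(3)]
    by (rule smooth_on_add[OF assms(1,2)])
  then show ?thesis by simp
qed

lemma smooth_on_sum:
  "open S \<Longrightarrow> (\<And>i. i \<in> I \<Longrightarrow> smooth_on S (f i)) \<Longrightarrow> smooth_on S (\<lambda>x. \<Sum>i\<in>I. f i x)"
  by (simp add: smooth_on_def diff_on_sum)

lemma smooth_on_scaleR:
  "open S \<Longrightarrow> smooth_on S f \<Longrightarrow> smooth_on S g \<Longrightarrow> smooth_on S (\<lambda>x. f x *\<^sub>R g x)"
  by (simp add: smooth_on_def diff_on_scaleR)

lemma smooth_on_inner: "open S \<Longrightarrow> smooth_on S f \<Longrightarrow> smooth_on S (\<lambda>x. f x \<bullet> c)"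
  by (simp add: smooth_on_def diff_on_inner)

lemma smooth_on_compose:
  "open S \<Longrightarrow> open T \<Longrightarrow> g ` S \<subseteq> T \<Longrightarrow> smooth_on T f \<Longrightarrow> smooth_on S g \<Longrightarrow> smooth_on S (\<lambda>x. f (g x))"
  by (simp add: smooth_on_def diff_on_compose[of S T g])

lemma smooth_on_continuous: "smooth_on S f \<Longrightarrow> continuous_on S f"
  by (simp add: smooth_on_def diff_on_continuous[of 0])

lemma smooth_on_has_derivative:
  "smooth_on S f \<Longrightarrow> x \<in> S \<Longrightarrow> (f has_derivative frechet_derivative f (at x)) (at x)"
  unfolding smooth_on_def using diff_on_Suc_has_derivative by blast

lemma smooth_on_frechet_derivative:
  "smooth_on S f \<Longrightarrow> smooth_on S (\<lambda>x. frechet_derivative f (at x) v)"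
  unfolding smooth_on_def by (metis diff_on.simps(2))

lemma smooth_on_linear_frechet_derivative:
  "smooth_on S f \<Longrightarrow> x \<in> S \<Longrightarrow> linear (frechet_derivative f (at x))"
  using smooth_on_has_derivative has_derivative_linear by blast

lemma smooth_on_linear_field:
  fixes A :: "'a::euclidean_space \<Rightarrow> 'e::euclidean_space \<Rightarrow> 'f::euclidean_space"
  assumes "open S" "\<And>y. y \<in> S \<Longrightarrow> linear (A y)" "\<And>w. smooth_on S (\<lambda>y. A y w)" "smooth_on S Y"
  shows "smooth_on S (\<lambda>y. A y (Y y))"
  unfolding smooth_on_def
proof
  show "diff_on k S (\<lambda>y. A y (Y y))" for k
    by (rule diff_on_linear_field[where A = A, OF assms(1,2)]) (use assms(3,4) in \<open>auto simp: smooth_on_def\<close>)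
qed

lemma smooth_onI:
  assumes "open S" "\<And>x. x \<in> S \<Longrightarrow> (f has_derivative f' x) (at x)"
    and "\<And>v. smooth_on S (\<lambda>x. f' x v)"
  shows "smooth_on S f"
  unfolding smooth_on_def
proof
  show "diff_on k S f" for k
    by (rule diff_on_mono, rule diff_on_SucI[where f' = f', OF assms(1,2)])
      (use assms(3) in \<open>simp_all add: smooth_on_def\<close>)
qed

text \<open>Bootstrapping: the right-hand side \<open>M y u (\<alpha> y)\<close> is as regular as
  \<open>\<alpha>\<close>, so the equation raises the order of differentiability of
  \<open>\<alpha>\<close> by one at each step.\<close>

lemma smooth_on_of_differential_equation:
  fixes \<alpha> :: "'a::euclidean_space \<Rightarrow> 'f::euclidean_space"
  assumes S: "open S" and lin: "\<And>y u. y \<in> S \<Longrightarrow> linear (M y u)"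
    and M: "\<And>u v. smooth_on S (\<lambda>y. M y u v)"
    and d: "\<And>y. y \<in> S \<Longrightarrow> (\<alpha> has_derivative (\<lambda>u. M y u (\<alpha> y))) (at y)"
  shows "smooth_on S \<alpha>"
  unfolding smooth_on_def
proof
  show "diff_on k S \<alpha>" for k
  proof (induction k)
    case 0
    have "continuous_on S \<alpha>"
      by (rule has_derivative_continuous_on, rule has_derivative_at_withinI, rule d)
    then show ?case by simp
  next
    case (Suc k)
    have *: "diff_on k S (\<lambda>y. M y u (\<alpha> y))" for u
      by (rule diff_on_linear_field[where A = "\<lambda>y. M y u", OF S lin])
        (use M Suc in \<open>auto simp: smooth_on_def\<close>)
    show ?case using d * by (rule diff_on_SucI[OF S])
  qed
qed

section \<open>Radial integration of one-forms\<close>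

lemma ball_segment:
  fixes a s :: "'a::real_normed_vector" and t :: real
  assumes "s \<in> ball a r" "t \<in> {0..1}"
  shows "a + t *\<^sub>R (s - a) \<in> ball a r"
proof -
  have "norm (t *\<^sub>R (s - a)) \<le> 1 * norm (s - a)"
    using assms by (simp add: mult_left_le_one_le)
  then show ?thesis using assms by (simp add: dist_norm norm_minus_commute)
qed

text \<open>The integral in the derivative is the radial integral of \<open>d\<omega>\<close>, so it vanishes for closed \<open>\<omega>\<close>.\<close>

lemma homotopy_formula:
  fixes \<omega> :: "'e::euclidean_space \<Rightarrow> 'e \<Rightarrow> 'f::banach"
  assumes lin: "\<And>y. y \<in> ball a r \<Longrightarrow> linear (\<omega> y)"
    and d: "\<And>y w. y \<in> ball a r \<Longrightarrow> ((\<lambda>y. \<omega> y w) has_derivative (\<lambda>u. \<omega>' y u w)) (at y)"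
    and c: "\<And>u w. continuous_on (ball a r) (\<lambda>y. \<omega>' y u w)"
  shows "\<And>s. s \<in> ball a r \<Longrightarrow>
      ((\<lambda>s. integral {0..1} (\<lambda>t. \<omega> (a + t *\<^sub>R (s - a)) (s - a))) has_derivative
      (\<lambda>u. \<omega> s u + integral {0..1} (\<lambda>t. t *\<^sub>R
         (\<omega>' (a + t *\<^sub>R (s - a)) u (s - a) - \<omega>' (a + t *\<^sub>R (s - a)) (s - a) u)))) (at s)"
    and "\<And>u. continuous_on (ball a r) (\<lambda>s. \<omega> s u + integral {0..1} (\<lambda>t. t *\<^sub>R
         (\<omega>' (a + t *\<^sub>R (s - a)) u (s - a) - \<omega>' (a + t *\<^sub>R (s - a)) (s - a) u)))"
proof -
  let ?B = "ball a r"
  define p where "p s t = a + t *\<^sub>R (s - a)" for s and t :: real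
  have p: "p s t \<in> ?B" if "s \<in> ?B" "t \<in> {0..1}" for s t
    unfolding p_def by (rule ball_segment[OF that])
  have lin1: "linear (\<omega>' y u)" if "y \<in> ?B" for y u
    using linear_field_derivative[OF open_ball that lin d[OF that]] by simp
  have lin2: "bounded_linear (\<lambda>u. \<omega>' y u w)" if "y \<in> ?B" for y w
    using d[OF that] by (rule has_derivative_bounded_linear)
  have exp1: "\<omega>' y u w = (\<Sum>i\<in>Basis. (w \<bullet> i) *\<^sub>R \<omega>' y u i)" if "y \<in> ?B" for y u w
    by (rule linear_Basis_expansion[OF lin1[OF that]])
  have exp2: "\<omega>' y w u = (\<Sum>i\<in>Basis. (w \<bullet> i) *\<^sub>R \<omega>' y i u)" if "y \<in> ?B" for y u w
    by (rule linear_Basis_expansion) (rule bounded_linear.linear[OF lin2[OF that]])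
  have exp3: "\<omega> y w = (\<Sum>i\<in>Basis. (w \<bullet> i) *\<^sub>R \<omega> y i)" if "y \<in> ?B" for y w
    by (rule linear_Basis_expansion[OF lin[OF that]])
  have c\<omega>: "continuous_on ?B (\<lambda>y. \<omega> y w)" for w
    by (rule has_derivative_continuous_on, rule has_derivative_at_withinI, rule d)
  have cp: "continuous_on (?B \<times> cbox 0 1) (\<lambda>z. p (fst z) (snd z))"
    unfolding p_def by (intro continuous_intros)
  have pin: "(\<lambda>z. p (fst z) (snd z)) ` (?B \<times> cbox 0 1) \<subseteq> ?B"
    using p by auto
  have cp1: "continuous_on {0..1} (p s)" for s
    unfolding p_def by (intro continuous_intros)
  \<comment> \<open>The derivative of the integrand in \<open>s\<close>, as a bounded linear map so
    that differentiation under the integral sign applies to it as a whole.\<close>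
  define F where "F s t = Blinfun (\<lambda>u. t *\<^sub>R \<omega>' (p s t) u (s - a) + \<omega> (p s t) u)" for s t
  have F: "blinfun_apply (F s t) = (\<lambda>u. t *\<^sub>R \<omega>' (p s t) u (s - a) + \<omega> (p s t) u)"
    if "s \<in> ?B" "t \<in> {0..1}" for s t
    unfolding F_def
    by (rule bounded_linear_Blinfun_apply, intro bounded_linear_add bounded_linear_scaleR_right
          bounded_linear_const_scaleR lin2 p that)
      (use lin[OF p[OF that]] in \<open>simp add: linear_conv_bounded_linear\<close>)
  have dp: "((\<lambda>s. p s t) has_derivative (\<lambda>u. t *\<^sub>R u)) (at s)" for s t
    unfolding p_def by (auto intro!: derivative_eq_intros)
  have dF: "((\<lambda>s. \<omega> (p s t) (s - a)) has_derivative blinfun_apply (F s t)) (at s within ?B)"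
    if "s \<in> ?B" "t \<in> cbox 0 1" for s t
  proof -
    have t: "t \<in> {0..1}" using that by simp
    have op: "open ((\<lambda>s. p s t) -` ?B)"
      by (rule open_vimage) (auto simp: p_def intro!: continuous_intros)
    have 1: "((\<lambda>s. \<omega> (p s t) w) has_derivative (\<lambda>u. t *\<^sub>R \<omega>' (p s t) u w)) (at s)" for w
      using has_derivative_compose[OF dp d[OF p[OF that(1) t]], of w]
        linear_scale[OF bounded_linear.linear[OF lin2[OF p[OF that(1) t]]]] by simp
    have "((\<lambda>s. \<omega> (p s t) (s - a)) has_derivative
        (\<lambda>u. t *\<^sub>R \<omega>' (p s t) u (s - a) + \<omega> (p s t) u)) (at s)"
      by (rule has_derivative_linear_field[OF op _ _ 1])
        (use p[OF that(1) t] lin in \<open>auto intro!: derivative_eq_intros\<close>)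
    then show ?thesis unfolding F[OF that(1) t] by (rule has_derivative_at_withinI)
  qed
  have cF: "continuous_on (?B \<times> cbox 0 1) (\<lambda>(s, t). F s t)"
  proof (rule continuous_on_blinfun_componentwise)
    fix i :: 'e assume "i \<in> Basis"
    have "continuous_on (?B \<times> cbox 0 1) (\<lambda>z. snd z *\<^sub>R (\<Sum>j\<in>Basis.
        ((fst z - a) \<bullet> j) *\<^sub>R \<omega>' (p (fst z) (snd z)) i j) + \<omega> (p (fst z) (snd z)) i)"
      by (intro continuous_intros continuous_on_compose2[OF c cp pin]
          continuous_on_compose2[OF c\<omega> cp pin])
    then show "continuous_on (?B \<times> cbox 0 1) (\<lambda>z. blinfun_apply (case z of (s, t) \<Rightarrow> F s t) i)"
    proof (rule continuous_on_eq)
      show "snd z *\<^sub>R (\<Sum>j\<in>Basis.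
        ((fst z - a) \<bullet> j) *\<^sub>R \<omega>' (p (fst z) (snd z)) i j) + \<omega> (p (fst z) (snd z)) i
        = blinfun_apply (case z of (s, t) \<Rightarrow> F s t) i" if "z \<in> ?B \<times> cbox 0 1" for z
      using that by (auto simp: F p exp1[OF p, of _ _ _ "_ - a"])
    qed
  qed
  have int\<omega>: "(\<lambda>t. \<omega> (p s t) (s - a)) integrable_on cbox 0 1" if "s \<in> ?B" for s
  proof -
    have "p s ` cbox 0 1 \<subseteq> ?B" using p that by auto
    then show ?thesis
      by (intro integrable_continuous continuous_on_compose2[OF c\<omega>]) (auto simp: p_def intro!: continuous_intros)
  qed
  have L: "((\<lambda>s. integral (cbox 0 1) (\<lambda>t. \<omega> (p s t) (s - a))) has_derivative
      integral (cbox 0 1) (F s)) (at s)" if "s \<in> ?B" for s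
    using leibniz_rule[OF dF int\<omega> cF that convex_ball] by (simp add: at_within_open[OF that open_ball])
  have eq: "blinfun_apply (integral (cbox 0 1) (F s)) u = \<omega> s u +
      integral {0..1} (\<lambda>t. t *\<^sub>R (\<omega>' (p s t) u (s - a) - \<omega>' (p s t) (s - a) u))"
    if s: "s \<in> ?B" for s u
  proof -
    have p1in: "p s ` {0..1} \<subseteq> ?B" using p[OF s] by auto
    have cFs: "continuous_on (cbox 0 1) (F s)"
    proof -
      have "Pair s ` cbox 0 1 \<subseteq> ?B \<times> cbox 0 1" using s by auto
      moreover have "continuous_on (cbox 0 1) (Pair s)" by (intro continuous_intros)
      ultimately show ?thesis using continuous_on_compose2[OF cF] by fastforce
    qed
    \<comment> \<open>The derivative of \<open>t *\<^sub>R \<omega> (p s t) u\<close> integrates to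
      \<open>\<omega> s u\<close>. Subtracting it from \<open>F s t u\<close> leaves exactly the
      antisymmetric term of the claim.\<close>
    have ftc: "((\<lambda>t. \<omega> (p s t) u + t *\<^sub>R \<omega>' (p s t) (s - a) u) has_integral
        1 *\<^sub>R \<omega> (p s 1) u - 0 *\<^sub>R \<omega> (p s 0) u) {0..1}"
    proof (rule fundamental_theorem_of_calculus)
      fix t :: real assume t: "t \<in> {0..1}"
      have "(p s has_derivative (\<lambda>h. h *\<^sub>R (s - a))) (at t)"
        unfolding p_def by (auto intro!: derivative_eq_intros)
      from has_derivative_compose[OF this d[OF p[OF s t]], of u]
      have "((\<lambda>t. \<omega> (p s t) u) has_vector_derivative \<omega>' (p s t) (s - a) u) (at t)"
        using linear_scale[OF bounded_linear.linear[OF lin2[OF p[OF s t]]]]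
        by (simp add: has_vector_derivative_def)
      from has_vector_derivative_scaleR[OF DERIV_ident this]
      show "((\<lambda>t. t *\<^sub>R \<omega> (p s t) u) has_vector_derivative
          \<omega> (p s t) u + t *\<^sub>R \<omega>' (p s t) (s - a) u) (at t within {0..1})"
        by (auto simp: add.commute intro: has_vector_derivative_at_within)
    qed simp
    have c1: "continuous_on {0..1} (\<lambda>t. \<Sum>j\<in>Basis. ((s - a) \<bullet> j) *\<^sub>R \<omega>' (p s t) u j)"
      "continuous_on {0..1} (\<lambda>t. \<Sum>j\<in>Basis. ((s - a) \<bullet> j) *\<^sub>R \<omega>' (p s t) j u)"
      by (intro continuous_intros continuous_on_compose2[OF c cp1 p1in])+
    have c2: "continuous_on {0..1} (\<lambda>t. \<omega>' (p s t) u (s - a))"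
      using c1(1) by (rule continuous_on_eq) (simp add: exp1[OF p[OF s], of _ u "s - a"])
    have c3: "continuous_on {0..1} (\<lambda>t. \<omega>' (p s t) (s - a) u)"
      using c1(2) by (rule continuous_on_eq) (simp add: exp2[OF p[OF s], of _ "s - a" u])
    have "((\<lambda>t. t *\<^sub>R (\<omega>' (p s t) u (s - a) - \<omega>' (p s t) (s - a) u)) has_integral
        integral {0..1} (\<lambda>t. t *\<^sub>R (\<omega>' (p s t) u (s - a) - \<omega>' (p s t) (s - a) u))) {0..1}"
      by (intro integrable_integral integrable_continuous_interval continuous_intros c2 c3)
    from has_integral_add[OF ftc this]
    have "((\<lambda>t. blinfun_apply (F s t) u) has_integral \<omega> s u +
      integral {0..1} (\<lambda>t. t *\<^sub>R (\<omega>' (p s t) u (s - a) - \<omega>' (p s t) (s - a) u))) {0..1}"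
      by (rule has_integral_eq[rotated, THEN has_integral_eq_rhs])
        (auto simp: F[OF s] p_def algebra_simps)
    moreover have "((\<lambda>t. blinfun_apply (F s t) u) has_integral
        blinfun_apply (integral (cbox 0 1) (F s)) u) {0..1}"
      using has_integral_linear[OF integrable_integral[OF integrable_continuous[OF cFs]]
          blinfun.bounded_linear_left[of u]]
      by (simp add: o_def)
    ultimately show ?thesis by (rule has_integral_unique[symmetric])
  qed
  have "blinfun_apply (integral (cbox 0 1) (F s)) = (\<lambda>u. \<omega> s u +
      integral {0..1} (\<lambda>t. t *\<^sub>R (\<omega>' (p s t) u (s - a) - \<omega>' (p s t) (s - a) u)))"
    if "s \<in> ?B" for s
    using eq[OF that] by (rule ext)
  then show "((\<lambda>s. integral {0..1} (\<lambda>t. \<omega> (a + t *\<^sub>R (s - a)) (s - a))) has_derivative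
      (\<lambda>u. \<omega> s u + integral {0..1} (\<lambda>t. t *\<^sub>R
         (\<omega>' (a + t *\<^sub>R (s - a)) u (s - a) - \<omega>' (a + t *\<^sub>R (s - a)) (s - a) u)))) (at s)"
    if "s \<in> ?B" for s
    using L[OF that] that by (simp add: p_def[symmetric])
  have "continuous_on ?B (\<lambda>s. blinfun_apply (integral (cbox 0 1) (F s)) u)" for u
    using cF by (intro continuous_intros integral_continuous_on_param) (simp add: split_def)
  then show "continuous_on ?B (\<lambda>s. \<omega> s u + integral {0..1} (\<lambda>t. t *\<^sub>R
         (\<omega>' (a + t *\<^sub>R (s - a)) u (s - a) - \<omega>' (a + t *\<^sub>R (s - a)) (s - a) u)))" for u
    by (rule continuous_on_eq) (simp only: eq p_def[symmetric])
qed

text \<open>The radial integral of \<open>f'\<close> recovers \<open>f\<close> up to a constant and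
  hence has derivative \<open>f'\<close>, so the error integral of \<open>homotopy_formula\<close>
  must vanish. This integral averages the antisymmetric part of \<open>f''\<close> over a segment;
  letting the segment shrink to \<open>a\<close> gives the value at \<open>a\<close>.\<close>

lemma symmetric_second_derivative:
  fixes f :: "'e::euclidean_space \<Rightarrow> 'f::banach"
  assumes S: "open S" "a \<in> S"
    and df: "\<And>y. y \<in> S \<Longrightarrow> (f has_derivative f' y) (at y)"
    and ddf: "\<And>y w. y \<in> S \<Longrightarrow> ((\<lambda>y. f' y w) has_derivative (\<lambda>u. f'' y u w)) (at y)"
    and c: "\<And>u w. continuous_on S (\<lambda>y. f'' y u w)"
  shows "f'' a u w = f'' a w u"
proof -
  obtain r where r: "r > 0" "ball a r \<subseteq> S" using S open_contains_ball by blast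
  note rS = subsetD[OF r(2)]
  have lin: "linear (f' y)" if "y \<in> ball a r" for y
    using has_derivative_linear[OF df[OF rS[OF that]]] .
  define \<psi> where "\<psi> y = f'' y u w - f'' y w u" for y
  \<comment> \<open>Both computations of the derivative of \<open>f y - f a\<close> are compared at
    \<open>s = a + \<epsilon> *\<^sub>R w\<close>; bilinearity of \<open>f''\<close> then allows
    division by \<open>\<epsilon>\<close>.\<close>
  have zero: "integral {0..1} (\<lambda>t. t *\<^sub>R \<psi> (a + t *\<^sub>R (\<epsilon> *\<^sub>R w))) = 0"
    if \<epsilon>: "\<epsilon> > 0" "\<epsilon> * norm w < r" for \<epsilon> :: real
  proof -
    define s where "s = a + \<epsilon> *\<^sub>R w"
    have s: "s \<in> ball a r" using \<epsilon> by (simp add: s_def dist_norm)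
    have prim: "integral {0..1} (\<lambda>t. f' (a + t *\<^sub>R (y - a)) (y - a)) = f y - f a"
      if y: "y \<in> ball a r" for y
    proof -
      have "((\<lambda>t. f' (a + t *\<^sub>R (y - a)) (y - a)) has_integral
          f (a + 1 *\<^sub>R (y - a)) - f (a + 0 *\<^sub>R (y - a))) {0..1}"
      proof (rule fundamental_theorem_of_calculus)
        fix t :: real assume t: "t \<in> {0..1}"
        have "((\<lambda>t. a + t *\<^sub>R (y - a)) has_derivative (\<lambda>h. h *\<^sub>R (y - a))) (at t)"
          by (auto intro!: derivative_eq_intros)
        from has_derivative_compose[OF this df[OF rS[OF ball_segment[OF y t]]]]
        have "((\<lambda>t. f (a + t *\<^sub>R (y - a))) has_vector_derivative f' (a + t *\<^sub>R (y - a)) (y - a)) (at t)"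
          using linear_scale[OF lin[OF ball_segment[OF y t]]] by (simp add: has_vector_derivative_def)
        then show "((\<lambda>t. f (a + t *\<^sub>R (y - a))) has_vector_derivative f' (a + t *\<^sub>R (y - a)) (y - a))
            (at t within {0..1})"
          by (rule has_vector_derivative_at_within)
      qed simp
      then show ?thesis by (simp add: integral_unique)
    qed
    have h: "((\<lambda>s. integral {0..1} (\<lambda>t. f' (a + t *\<^sub>R (s - a)) (s - a))) has_derivative
      (\<lambda>u. f' s u + integral {0..1} (\<lambda>t. t *\<^sub>R
         (f'' (a + t *\<^sub>R (s - a)) u (s - a) - f'' (a + t *\<^sub>R (s - a)) (s - a) u)))) (at s)"
      by (rule homotopy_formula(1)[OF lin ddf[OF rS] continuous_on_subset[OF c r(2)] s])
    have "((\<lambda>y. f y - f a) has_derivative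
      (\<lambda>u. f' s u + integral {0..1} (\<lambda>t. t *\<^sub>R
         (f'' (a + t *\<^sub>R (s - a)) u (s - a) - f'' (a + t *\<^sub>R (s - a)) (s - a) u)))) (at s)"
      by (rule has_derivative_transform_within_open[OF h open_ball s prim])
    moreover have "((\<lambda>y. f y - f a) has_derivative f' s) (at s)"
      using df[OF rS[OF s]] by (auto intro!: derivative_eq_intros)
    ultimately have 0: "integral {0..1} (\<lambda>t. t *\<^sub>R
         (f'' (a + t *\<^sub>R (s - a)) u (s - a) - f'' (a + t *\<^sub>R (s - a)) (s - a) u)) = 0"
      using has_derivative_unique by (metis (no_types, lifting) add_cancel_left_right)
    have "integral {0..1} (\<lambda>t. \<epsilon> *\<^sub>R (t *\<^sub>R \<psi> (a + t *\<^sub>R (\<epsilon> *\<^sub>R w)))) = 0"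
      unfolding 0[symmetric]
    proof (rule integral_cong)
      fix t :: real assume t: "t \<in> {0..1}"
      let ?y = "a + t *\<^sub>R (s - a)"
      have y: "?y \<in> ball a r" by (rule ball_segment[OF s t])
      have "f'' ?y u (s - a) = \<epsilon> *\<^sub>R f'' ?y u w"
        using linear_scale[OF linear_field_derivative[OF open_ball y lin ddf[OF rS[OF y]]]]
        by (simp add: s_def)
      moreover have "f'' ?y (s - a) u = \<epsilon> *\<^sub>R f'' ?y w u"
        using linear_scale[OF has_derivative_linear[OF ddf[OF rS[OF y]]]] by (simp add: s_def)
      ultimately show "\<epsilon> *\<^sub>R (t *\<^sub>R \<psi> (a + t *\<^sub>R (\<epsilon> *\<^sub>R w)))
          = t *\<^sub>R (f'' ?y u (s - a) - f'' ?y (s - a) u)"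
        by (simp add: s_def \<psi>_def scaleR_diff_right algebra_simps)
    qed
    then have "\<epsilon> *\<^sub>R integral {0..1} (\<lambda>t. t *\<^sub>R \<psi> (a + t *\<^sub>R (\<epsilon> *\<^sub>R w))) = 0"
      by (simp only: integral_cmul)
    then show ?thesis using \<epsilon>(1) by simp
  qed
  have "norm (\<psi> a) \<le> e" if e: "e > 0" for e
  proof -
    have c\<psi>: "continuous_on S \<psi>" unfolding \<psi>_def by (intro continuous_intros c)
    obtain \<delta> where \<delta>: "\<delta> > 0" "\<And>y. y \<in> S \<Longrightarrow> dist y a \<le> \<delta> \<Longrightarrow> dist (\<psi> y) (\<psi> a) < e / 2"
      using continuous_onE[OF c\<psi> S(2), of "e / 2"] e by (metis half_gt_zero)
    \<comment> \<open>The factor 2 makes the bounds on \<open>\<epsilon> * norm w\<close> strict,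
      and the \<open>+ 1\<close> covers \<open>w = 0\<close>.\<close>
    define \<epsilon> where "\<epsilon> = min \<delta> r / (2 * (norm w + 1))"
    have \<epsilon>: "\<epsilon> > 0" using \<delta>(1) r(1) by (simp add: \<epsilon>_def add_nonneg_pos)
    have "\<epsilon> * norm w \<le> \<epsilon> * (norm w + 1)" using \<epsilon> by simp
    also have "\<dots> = min \<delta> r / 2"
    proof -
      have "norm w + 1 \<noteq> 0" using norm_ge_zero[of w] by linarith
      then show ?thesis by (simp add: \<epsilon>_def field_simps)
    qed
    finally have \<epsilon>w: "\<epsilon> * norm w < \<delta>" "\<epsilon> * norm w < r"
      using \<delta>(1) r(1) by auto
    have near: "dist (a + t *\<^sub>R (\<epsilon> *\<^sub>R w)) a \<le> \<epsilon> * norm w" if "t \<in> {0..1}" for t :: real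
      using that \<epsilon> by (simp add: dist_norm mult_left_le_one_le)
    have inS: "a + t *\<^sub>R (\<epsilon> *\<^sub>R w) \<in> S" if "t \<in> {0..1}" for t :: real
      using near[OF that] \<epsilon>w(2) by (intro rS) (simp add: dist_commute)
    have int: "(\<lambda>t. t *\<^sub>R \<psi> (a + t *\<^sub>R (\<epsilon> *\<^sub>R w))) integrable_on {0..1}"
      by (intro integrable_continuous_interval continuous_intros continuous_on_compose2[OF c\<psi>])
        (use inS in auto)
    have id: "((\<lambda>t. t) has_integral (1 / 2 :: real)) {0..1}"
      using ident_has_integral[of "0::real" 1] by simp
    \<comment> \<open>The weight \<open>t\<close> has integral 1/2. Since the integral of
      \<open>t *\<^sub>R \<psi>\<close> along the segment is 0, half of \<open>\<psi> a\<close> is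
      bounded by the oscillation of \<open>\<psi>\<close> there.\<close>
    have "((\<lambda>t. t *\<^sub>R \<psi> (a + t *\<^sub>R (\<epsilon> *\<^sub>R w)) - t *\<^sub>R \<psi> a) has_integral 0 - (1 / 2) *\<^sub>R \<psi> a) {0..1}"
      by (intro has_integral_diff has_integral_scaleR_left id)
        (use integrable_integral[OF int] zero[OF \<epsilon> \<epsilon>w(2)] in simp)
    moreover have "norm (t *\<^sub>R \<psi> (a + t *\<^sub>R (\<epsilon> *\<^sub>R w)) - t *\<^sub>R \<psi> a) \<le> e / 2" if t: "t \<in> cbox 0 (1::real)" for t
    proof -
      have t': "t \<in> {0..1}" using t by simp
      have "norm (\<psi> (a + t *\<^sub>R (\<epsilon> *\<^sub>R w)) - \<psi> a) \<le> e / 2"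
        using \<delta>(2)[OF inS[OF t']] near[OF t'] \<epsilon>w(1) by (simp add: dist_norm)
      then have "\<bar>t\<bar> * norm (\<psi> (a + t *\<^sub>R (\<epsilon> *\<^sub>R w)) - \<psi> a) \<le> 1 * (e / 2)"
        using t' by (intro mult_mono) auto
      then show ?thesis by (simp add: scaleR_diff_right[symmetric])
    qed
    ultimately have "norm (0 - (1 / 2) *\<^sub>R \<psi> a) \<le> e / 2 * measure lborel (cbox 0 (1::real))"
      using e by (intro has_integral_bound) auto
    then show ?thesis by simp
  qed
  then have "norm (\<psi> a) \<le> 0" by (rule field_le_epsilon) simp
  then show ?thesis by (simp add: \<psi>_def)
qed

text \<open>Continuity is given for fixed arguments only, but finitely many pairs of basis vectors
  determine the form, so their maxima on the compact set add up to a uniform bound.\<close>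

lemma bilinear_field_bounded:
  fixes M :: "'a::topological_space \<Rightarrow> 'e::euclidean_space \<Rightarrow> 'f::euclidean_space \<Rightarrow> 'g::real_normed_vector"
  assumes C: "compact C" and bil: "\<And>y. y \<in> C \<Longrightarrow> bilinear (M y)"
    and c: "\<And>u v. continuous_on C (\<lambda>y. M y u v)"
  obtains K where "K \<ge> 0" "\<And>y u v. y \<in> C \<Longrightarrow> norm (M y u v) \<le> K * norm u * norm v"
proof -
  have "\<exists>b. \<forall>y\<in>C. norm (M y i j) \<le> b" for i j
    using compact_imp_bounded[OF compact_continuous_image[OF c C]] by (auto simp: bounded_iff)
  then obtain b where b: "\<And>i j y. y \<in> C \<Longrightarrow> norm (M y i j) \<le> b i j" by metis
  define K where "K = (\<Sum>i\<in>Basis. \<Sum>j\<in>Basis. \<bar>b i j\<bar>)"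
  have "norm (M y u v) \<le> K * norm u * norm v" if y: "y \<in> C" for y u v
  proof -
    have "M y u v = (\<Sum>i\<in>Basis. (u \<bullet> i) *\<^sub>R M y i v)"
      by (rule linear_Basis_expansion[OF linear_bilinear_left[OF bil[OF y]]])
    also have "\<dots> = (\<Sum>i\<in>Basis. (u \<bullet> i) *\<^sub>R (\<Sum>j\<in>Basis. (v \<bullet> j) *\<^sub>R M y i j))"
      by (rule sum.cong[OF refl]) (metis linear_Basis_expansion[OF linear_bilinear_right[OF bil[OF y]]])
    also have "norm \<dots> \<le> (\<Sum>i\<in>Basis. norm u * (\<Sum>j\<in>Basis. norm v * \<bar>b i j\<bar>))"
    proof (rule sum_norm_le)
      fix i :: 'e assume i: "i \<in> Basis"
      have "norm (\<Sum>j\<in>Basis. (v \<bullet> j) *\<^sub>R M y i j) \<le> (\<Sum>j\<in>Basis. norm v * \<bar>b i j\<bar>)"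
      proof (rule sum_norm_le)
        fix j :: 'f assume "j \<in> Basis"
        then show "norm ((v \<bullet> j) *\<^sub>R M y i j) \<le> norm v * \<bar>b i j\<bar>"
          using b[OF y, of i j] by (auto intro!: mult_mono Basis_le_norm)
      qed
      then show "norm ((u \<bullet> i) *\<^sub>R (\<Sum>j\<in>Basis. (v \<bullet> j) *\<^sub>R M y i j))
          \<le> norm u * (\<Sum>j\<in>Basis. norm v * \<bar>b i j\<bar>)"
        using i by (auto intro!: mult_mono Basis_le_norm)
    qed
    also have "\<dots> = K * norm u * norm v"
      by (simp add: K_def sum_distrib_left sum_distrib_right mult_ac)
    finally show ?thesis .
  qed
  moreover have "K \<ge> 0" by (simp add: K_def sum_nonneg)
  ultimately show ?thesis using that by blast
qed

section \<open>Integrable linear total differential systems\<close>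

text \<open>
  Picard iteration along rays. By integrability the homotopy formula bounds the defect
  \<open>d\<alpha>\<^sub>k - M \<alpha>\<^sub>k\<close> of an iterate by that of its predecessor, so it tends to 0 together with
  \<open>\<alpha>\<^sub>k\<^sub>+\<^sub>1 - \<alpha>\<^sub>k\<close> and no differentiability of solutions in parameters is needed.
\<close>

lemma integrable_linear_system:
  fixes M :: "'e::euclidean_space \<Rightarrow> 'e \<Rightarrow> 'f::euclidean_space \<Rightarrow> 'f"
  assumes S: "open S" "a \<in> S" and bil: "\<And>y. y \<in> S \<Longrightarrow> bilinear (M y)"
    and dM: "\<And>y u v. y \<in> S \<Longrightarrow> ((\<lambda>y. M y u v) has_derivative (\<lambda>h. M' y h u v)) (at y)"
    and cM: "\<And>h u v. continuous_on S (\<lambda>y. M' y h u v)"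
    and integrable: "\<And>y u w v. y \<in> S \<Longrightarrow>
      M' y u w v + M y w (M y u v) = M' y w u v + M y u (M y w v)"
  shows "\<exists>r>0. ball a r \<subseteq> S \<and> (\<forall>v. \<exists>\<alpha>. \<alpha> a = v \<and>
    (\<forall>y\<in>ball a r. (\<alpha> has_derivative (\<lambda>u. M y u (\<alpha> y))) (at y)))"
proof -
  obtain r0 where r0: "r0 > 0" "cball a r0 \<subseteq> S" using S open_contains_cball by blast
  have cM0: "continuous_on S (\<lambda>y. M y u v)" for u v
    by (rule has_derivative_continuous_on, rule has_derivative_at_withinI, rule dM)
  obtain K where K: "K \<ge> 0" "\<And>y u v. y \<in> cball a r0 \<Longrightarrow> norm (M y u v) \<le> K * norm u * norm v"
    by (rule bilinear_field_bounded[of "cball a r0" M])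
      (use r0 bil continuous_on_subset[OF cM0] in auto)
  \<comment> \<open>This gives \<open>K * norm (s - a) \<le> 1 / 8\<close>. Two such terms bound the
    error integral by 1/4 of the previous defect bound, and the increment of the iterates adds at
    most another 1/4, whence the ratio 1/2 in \<open>defect\<close>; the increments themselves
    shrink by 1/4. The \<open>+ 1\<close> covers \<open>K = 0\<close>.\<close>
  define r where "r = min r0 (1 / (8 * (K + 1)))"
  have r: "r > 0" using r0(1) K(1) by (simp add: r_def)
  let ?B = "ball a r"
  have BS: "?B \<subseteq> S" and BC: "?B \<subseteq> cball a r0" using r0(2) by (auto simp: r_def)
  note inS = subsetD[OF BS]
  have K: "K \<ge> 0" "\<And>y u v. y \<in> ?B \<Longrightarrow> norm (M y u v) \<le> K * norm u * norm v"
    using K BC by blast+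
  have Kr: "K * norm (s - a) \<le> 1 / 8" if "s \<in> ?B" for s
  proof -
    have "K * norm (s - a) \<le> (K + 1) * (1 / (8 * (K + 1)))"
      using that K(1) by (intro mult_mono) (auto simp: r_def dist_norm norm_minus_commute)
    also have "\<dots> = 1 / 8"
    proof -
      have "K + 1 \<noteq> 0" using K(1) by simp
      then show ?thesis by (simp add: field_simps)
    qed
    finally show ?thesis .
  qed
  have bilB: "bilinear (M y)" if "y \<in> ?B" for y using bil[OF inS[OF that]] .
  have lin2: "linear (M y u)" if "y \<in> ?B" for y u
    using linear_bilinear_right[OF bilB[OF that]] .
  have lin3: "linear (M' y h u)" if "y \<in> ?B" for y h u
    using linear_field_derivative[OF open_ball that lin2 dM[OF inS[OF that]]] .
  note p = ball_segment[of _ a r]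
  have "\<exists>\<alpha>. \<alpha> a = v \<and> (\<forall>y\<in>?B. (\<alpha> has_derivative (\<lambda>u. M y u (\<alpha> y))) (at y))" for v
  proof -
    define \<alpha> where "\<alpha> = rec_nat (\<lambda>_. v) (\<lambda>_ f s. v +
      integral {0..1} (\<lambda>t. M (a + t *\<^sub>R (s - a)) (s - a) (f (a + t *\<^sub>R (s - a)))))"
    have \<alpha>0: "\<alpha> 0 = (\<lambda>_. v)"
      and \<alpha>S: "\<And>k. \<alpha> (Suc k) = (\<lambda>s. v +
        integral {0..1} (\<lambda>t. M (a + t *\<^sub>R (s - a)) (s - a) (\<alpha> k (a + t *\<^sub>R (s - a)))))"
      by (simp_all add: \<alpha>_def)
    \<comment> \<open>If \<open>f'\<close> is the derivative of \<open>\<alpha> k\<close>, then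
      \<open>W k f'\<close> is the derivative of the one-form
      \<open>w \<mapsto> M y w (\<alpha> k y)\<close>. With it, \<open>\<alpha>'\<close> spells out
      the derivative that the homotopy formula predicts for the next iterate.\<close>
    define W where "W k f' y u w = M' y u w (\<alpha> k y) + M y w (f' y u)" for k f' y u w
    define \<alpha>' where "\<alpha>' = rec_nat (\<lambda>_ _. 0) (\<lambda>k f' s u. M s u (\<alpha> k s) +
      integral {0..1} (\<lambda>t. t *\<^sub>R (W k f' (a + t *\<^sub>R (s - a)) u (s - a) -
        W k f' (a + t *\<^sub>R (s - a)) (s - a) u)))"
    have \<alpha>'0: "\<alpha>' 0 = (\<lambda>_ _. 0)"
      and \<alpha>'S: "\<And>k. \<alpha>' (Suc k) = (\<lambda>s u. M s u (\<alpha> k s) +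
        integral {0..1} (\<lambda>t. t *\<^sub>R (W k (\<alpha>' k) (a + t *\<^sub>R (s - a)) u (s - a) -
        W k (\<alpha>' k) (a + t *\<^sub>R (s - a)) (s - a) u)))"
      by (simp_all add: \<alpha>'_def)
    have d: "(\<forall>y\<in>?B. (\<alpha> k has_derivative \<alpha>' k y) (at y)) \<and> (\<forall>u. continuous_on ?B (\<lambda>y. \<alpha>' k y u))" for k
    proof (induction k)
      case 0
      then show ?case by (simp add: \<alpha>0 \<alpha>'0)
    next
      case (Suc k)
      have c: "continuous_on ?B (\<alpha> k)"
        by (rule has_derivative_continuous_on[where f' = "\<alpha>' k"])
          (use Suc has_derivative_at_withinI in blast)
      have lin: "linear (\<lambda>w. M y w (\<alpha> k y))" if "y \<in> ?B" for y
        using linear_bilinear_left[OF bilB[OF that]] .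
      have d\<omega>: "((\<lambda>y. M y w (\<alpha> k y)) has_derivative (\<lambda>u. W k (\<alpha>' k) y u w)) (at y)"
        if "y \<in> ?B" for y w
        unfolding W_def
        by (rule has_derivative_linear_field[OF open_ball that lin2 dM[OF inS[OF that]]])
          (use Suc that in auto)
      have cW: "continuous_on ?B (\<lambda>y. W k (\<alpha>' k) y u w)" for u w
      proof -
        have "continuous_on ?B (\<lambda>y. (\<Sum>i\<in>Basis. (\<alpha> k y \<bullet> i) *\<^sub>R M' y u w i)
            + (\<Sum>i\<in>Basis. (\<alpha>' k y u \<bullet> i) *\<^sub>R M y w i))"
          using Suc by (intro continuous_intros c continuous_on_subset[OF cM BS]
              continuous_on_subset[OF cM0 BS]) auto
        then show ?thesis
          by (rule continuous_on_eq)
            (simp add: W_def linear_Basis_expansion[OF lin3, of _ _ _ "\<alpha> k _"]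
              linear_Basis_expansion[OF lin2, of _ _ "\<alpha>' k _ _"])
      qed
      note h = homotopy_formula[OF lin d\<omega> cW]
      show ?case
      proof (intro conjI ballI allI)
        fix y assume y: "y \<in> ?B"
        show "(\<alpha> (Suc k) has_derivative \<alpha>' (Suc k) y) (at y)"
          unfolding \<alpha>S \<alpha>'S
          by (rule has_derivative_eq_rhs, rule has_derivative_add[OF has_derivative_const h(1)])
            (use y in auto)
      next
        show "continuous_on ?B (\<lambda>y. \<alpha>' (Suc k) y u)" for u
          using h(2)[of u] by (simp add: \<alpha>'S)
      qed
    qed
    have c\<alpha>: "continuous_on ?B (\<alpha> k)" for k
      by (rule has_derivative_continuous_on[where f' = "\<alpha>' k"])
        (use d has_derivative_at_withinI in blast)
    have cMB: "continuous_on ?B (\<lambda>y. M y w (f y))" if "continuous_on ?B f" for w f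
    proof -
      have "continuous_on ?B (\<lambda>y. \<Sum>i\<in>Basis. (f y \<bullet> i) *\<^sub>R M y w i)"
        by (intro continuous_intros that continuous_on_subset[OF cM0 BS])
      then show ?thesis
        by (rule continuous_on_eq) (simp add: linear_Basis_expansion[OF lin2, of _ _ "f _"])
    qed
    have int: "(\<lambda>t. M (a + t *\<^sub>R (s - a)) (s - a) (\<alpha> k (a + t *\<^sub>R (s - a)))) integrable_on {0..1}"
      if "s \<in> ?B" for s k
      by (intro integrable_continuous_interval continuous_on_compose2[OF cMB[OF c\<alpha>]] continuous_intros)
        (use p[OF that] in auto)
    have diff: "norm (\<alpha> (Suc k) s - \<alpha> k s) \<le> norm v * (1 / 4) ^ Suc k" if "s \<in> ?B" for k s
      using that
    proof (induction k arbitrary: s)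
      case 0
      have "norm (integral (cbox 0 1) (\<lambda>t::real. M (a + t *\<^sub>R (s - a)) (s - a) v))
          \<le> norm v / 4 * measure lborel (cbox 0 (1::real))"
      proof (rule integrable_bound)
        show "(\<lambda>t. M (a + t *\<^sub>R (s - a)) (s - a) v) integrable_on cbox 0 1"
          using int[OF 0, of 0] by (simp add: \<alpha>0)
        fix t :: real assume "t \<in> cbox 0 1"
        then have "norm (M (a + t *\<^sub>R (s - a)) (s - a) v) \<le> K * norm (s - a) * norm v"
          using p[OF 0] by (intro K) auto
        also have "\<dots> \<le> 1 / 8 * norm v" by (intro mult_right_mono Kr 0) auto
        also have "\<dots> \<le> norm v / 4" by simp
        finally show "norm (M (a + t *\<^sub>R (s - a)) (s - a) v) \<le> norm v / 4" .
      qed simp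
      then show ?case by (simp add: \<alpha>S \<alpha>0)
    next
      case (Suc k)
      let ?D = "\<lambda>t. M (a + t *\<^sub>R (s - a)) (s - a) (\<alpha> (Suc k) (a + t *\<^sub>R (s - a)))
        - M (a + t *\<^sub>R (s - a)) (s - a) (\<alpha> k (a + t *\<^sub>R (s - a)))"
      have "norm (integral (cbox 0 1) ?D) \<le> norm v * (1 / 4) ^ Suc (Suc k) * measure lborel (cbox 0 (1::real))"
      proof (rule integrable_bound)
        show "?D integrable_on cbox 0 1"
          using integrable_diff[OF int[OF Suc.prems] int[OF Suc.prems]] by simp
        fix t :: real assume "t \<in> cbox 0 1"
        then have y: "a + t *\<^sub>R (s - a) \<in> ?B" (is "?y \<in> _") using p[OF Suc.prems] by auto
        have "?D t = M ?y (s - a) (\<alpha> (Suc k) ?y - \<alpha> k ?y)" by (simp add: linear_diff[OF lin2[OF y]])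
        also have "norm \<dots> \<le> K * norm (s - a) * norm (\<alpha> (Suc k) ?y - \<alpha> k ?y)" by (rule K(2)[OF y])
        also have "\<dots> \<le> 1 / 8 * (norm v * (1 / 4) ^ Suc k)"
          using K(1) by (intro mult_mono Kr Suc Suc.IH y) auto
        also have "\<dots> \<le> norm v * (1 / 4) ^ Suc (Suc k)" by simp
        finally show "norm (?D t) \<le> norm v * (1 / 4) ^ Suc (Suc k)" .
      qed simp
      moreover have "integral (cbox 0 1) ?D = \<alpha> (Suc (Suc k)) s - \<alpha> (Suc k) s"
        unfolding \<alpha>S[of "Suc k"] \<alpha>S[of k, THEN fun_cong, of s]
        using integral_diff[OF int[OF Suc.prems, of "Suc k"] int[OF Suc.prems, of k]] by simp
      ultimately show ?case by simp
    qed
    \<comment> \<open>Integrability replaces the antisymmetrized \<open>M'\<close> by a commutator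
      of values of \<open>M\<close>, which combines with the remaining terms into the defects
      alone.\<close>
    have dW: "W k (\<alpha>' k) y u w - W k (\<alpha>' k) y w u
        = M y w (\<alpha>' k y u - M y u (\<alpha> k y)) - M y u (\<alpha>' k y w - M y w (\<alpha> k y))"
      if "y \<in> ?B" for k y u w
      using integrable[OF inS[OF that], of u w "\<alpha> k y"]
      by (simp add: W_def linear_diff[OF lin2[OF that]] algebra_simps)
    have defect: "norm (\<alpha>' k s u - M s u (\<alpha> k s)) \<le> K * norm v * norm u * (1 / 2) ^ k"
      if "s \<in> ?B" for k s u
      using that
    proof (induction k arbitrary: s u)
      case 0
      then show ?case using K(2)[OF 0, of u v] by (simp add: \<alpha>0 \<alpha>'0 mult_ac)
    next
      case (Suc k)
      let ?y = "\<lambda>t. a + t *\<^sub>R (s - a)"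
      let ?I = "\<lambda>t. t *\<^sub>R (W k (\<alpha>' k) (?y t) u (s - a) - W k (\<alpha>' k) (?y t) (s - a) u)"
      have "norm (?I t) \<le> K * norm v * norm u * (1 / 2) ^ k * (1 / 4)" if t: "t \<in> {0..1}" for t
      proof -
        note y = p[OF Suc.prems t]
        define A where "A u = \<alpha>' k (?y t) u - M (?y t) u (\<alpha> k (?y t))" for u
        have A: "norm (A u) \<le> K * norm v * norm u * (1 / 2) ^ k" for u
          unfolding A_def by (rule Suc.IH[OF y])
        have "W k (\<alpha>' k) (?y t) u (s - a) - W k (\<alpha>' k) (?y t) (s - a) u
            = M (?y t) (s - a) (A u) - M (?y t) u (A (s - a))"
          unfolding A_def by (rule dW[OF y])
        also have "norm \<dots> \<le> norm (M (?y t) (s - a) (A u)) + norm (M (?y t) u (A (s - a)))"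
          by (rule norm_triangle_ineq4)
        also have "\<dots> \<le> K * norm (s - a) * (K * norm v * norm u * (1 / 2) ^ k)
            + K * norm u * (K * norm v * norm (s - a) * (1 / 2) ^ k)"
          using K(1) by (intro add_mono order_trans[OF K(2)[OF y]] mult_left_mono A) auto
        also have "\<dots> = (K * norm (s - a)) * (2 * (K * norm v * norm u * (1 / 2) ^ k))" by simp
        also have "\<dots> \<le> 1 / 8 * (2 * (K * norm v * norm u * (1 / 2) ^ k))"
          using K(1) by (intro mult_right_mono Kr Suc.prems) auto
        finally have "norm (W k (\<alpha>' k) (?y t) u (s - a) - W k (\<alpha>' k) (?y t) (s - a) u)
            \<le> K * norm v * norm u * (1 / 2) ^ k * (1 / 4)" by (simp add: mult_ac)
        then have "\<bar>t\<bar> * norm (W k (\<alpha>' k) (?y t) u (s - a) - W k (\<alpha>' k) (?y t) (s - a) u)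
            \<le> 1 * (K * norm v * norm u * (1 / 2) ^ k * (1 / 4))"
          using t K(1) by (intro mult_mono) auto
        then show ?thesis by simp
      qed
      note bound = this
      have I: "norm (integral {0..1} ?I) \<le> K * norm v * norm u * (1 / 2) ^ k * (1 / 4)"
      proof (cases "?I integrable_on cbox 0 1")
        case True
        have "norm (integral (cbox 0 1) ?I)
            \<le> K * norm v * norm u * (1 / 2) ^ k * (1 / 4) * measure lborel (cbox 0 (1::real))"
          by (rule integrable_bound[OF _ True]) (use K(1) bound in auto)
        then show ?thesis by simp
      next
        \<comment> \<open>A function that is not integrable has integral 0 by convention, so the
          bound is immediate.\<close>
        case False
        then show ?thesis using K(1) by (simp add: not_integrable_integral)
      qed
      have "norm (M s u (\<alpha> (Suc k) s - \<alpha> k s)) \<le> K * norm u * norm (\<alpha> (Suc k) s - \<alpha> k s)"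
        by (rule K(2)[OF Suc.prems])
      also have "\<dots> \<le> K * norm u * (norm v * (1 / 4) ^ Suc k)"
        by (rule mult_left_mono[OF diff[OF Suc.prems]]) (use K(1) in simp)
      finally have D: "norm (M s u (\<alpha> (Suc k) s - \<alpha> k s)) \<le> K * norm u * (norm v * (1 / 4) ^ Suc k)" .
      have "\<alpha>' (Suc k) s u - M s u (\<alpha> (Suc k) s)
          = integral {0..1} ?I - M s u (\<alpha> (Suc k) s - \<alpha> k s)"
        by (simp add: \<alpha>'S linear_diff[OF lin2[OF Suc.prems]])
      then have "norm (\<alpha>' (Suc k) s u - M s u (\<alpha> (Suc k) s))
          \<le> norm (integral {0..1} ?I) + norm (M s u (\<alpha> (Suc k) s - \<alpha> k s))"
        by (simp only: norm_triangle_ineq4)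
      also have "\<dots> \<le> K * norm v * norm u * (1 / 2) ^ k * (1 / 4)
          + K * norm u * (norm v * (1 / 4) ^ Suc k)"
        by (rule add_mono[OF I D])
      also have "\<dots> = K * norm v * norm u * ((1 / 2) ^ k * (1 / 4) + (1 / 4) ^ k * (1 / 4))"
        by (simp add: algebra_simps)
      also have "\<dots> \<le> K * norm v * norm u * ((1 / 2) ^ k * (1 / 4) + (1 / 2) ^ k * (1 / 4))"
        using K(1) by (intro mult_left_mono add_left_mono mult_right_mono power_mono) auto
      also have "\<dots> = K * norm v * norm u * (1 / 2) ^ Suc k" by simp
      finally show ?case .
    qed
    have sm: "summable (\<lambda>k. norm v * (1 / 4) ^ Suc k)"
      by (intro summable_mult summable_Suc_iff[THEN iffD2] summable_geometric) simp
    define \<beta> where "\<beta> x = (\<Sum>k. \<alpha> (Suc k) x - \<alpha> k x)" for x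
    have \<beta>: "uniform_limit ?B (\<lambda>n x. \<Sum>k<n. \<alpha> (Suc k) x - \<alpha> k x) \<beta> sequentially"
      unfolding \<beta>_def[abs_def] by (rule Weierstrass_m_test[OF diff sm])
    have tele: "(\<Sum>k<n. \<alpha> (Suc k) x - \<alpha> k x) = \<alpha> n x - v" for n x
      using sum_lessThan_telescope[of "\<lambda>k. \<alpha> k x" n] by (simp add: \<alpha>0)
    define g' where "g' y u = M y u (v + \<beta> y)" for y u
    \<comment> \<open>The derivatives converge uniformly: \<open>\<alpha>' n\<close> is close to
      \<open>M\<close> applied to \<open>\<alpha> n\<close> by \<open>defect\<close>, and
      \<open>\<alpha> n\<close> converges uniformly to \<open>v + \<beta>\<close>. So the limit of
      the derivatives is already the right-hand side of the equation.\<close>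
    have "\<exists>g. \<forall>x\<in>?B. (\<lambda>n. \<alpha> n x) \<longlonglongrightarrow> g x \<and> (g has_derivative g' x) (at x within ?B)"
    proof (rule has_derivative_sequence[OF convex_ball])
      show "(\<alpha> n has_derivative \<alpha>' n x) (at x within ?B)" if "x \<in> ?B" for n x
        using d[of n] that has_derivative_at_withinI by blast
      show "a \<in> ?B" using r by simp
      show "(\<lambda>n. \<alpha> n a) \<longlonglongrightarrow> v"
      proof -
        have "M a 0 w = 0" for w
          using linear_0[OF linear_bilinear_left[OF bilB]] r by simp
        then have "\<alpha> n a = v" for n by (cases n) (simp_all add: \<alpha>0 \<alpha>S)
        then show ?thesis by simp
      qed
      fix e :: real assume e: "e > 0"
      have "(\<lambda>n. K * norm v * (1 / 2) ^ n) \<longlonglongrightarrow> K * norm v * 0"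
        by (intro tendsto_intros LIMSEQ_power_zero) simp
      then have "\<forall>\<^sub>F n in sequentially. K * norm v * (1 / 2) ^ n < e / 2"
        using e order_tendstoD(2)[of _ "K * norm v * 0" sequentially "e / 2"] by simp
      moreover have "\<forall>\<^sub>F n in sequentially. \<forall>x\<in>?B. dist (\<Sum>k<n. \<alpha> (Suc k) x - \<alpha> k x) (\<beta> x) < e / (2 * (K + 1))"
        using \<beta> e K(1) by (intro uniform_limitD) auto
      ultimately show "\<forall>\<^sub>F n in sequentially. \<forall>x\<in>?B. \<forall>h. norm (\<alpha>' n x h - g' x h) \<le> e * norm h"
      proof eventually_elim
        case (elim n)
        show ?case
        proof (intro ballI allI)
          fix x h assume x: "x \<in> ?B"
          have n: "norm (\<alpha> n x - (v + \<beta> x)) \<le> e / (2 * (K + 1))"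
            using elim(2) x by (auto simp: tele dist_norm algebra_simps intro: less_imp_le)
          have "norm (M x h (\<alpha> n x - (v + \<beta> x))) \<le> K * norm h * norm (\<alpha> n x - (v + \<beta> x))"
            by (rule K(2)[OF x])
          also have "\<dots> \<le> K * norm h * (e / (2 * (K + 1)))"
            by (rule mult_left_mono[OF n]) (use K(1) in simp)
          finally have D: "norm (M x h (\<alpha> n x - (v + \<beta> x))) \<le> K * norm h * (e / (2 * (K + 1)))" .
          have "norm (\<alpha>' n x h - g' x h) = norm ((\<alpha>' n x h - M x h (\<alpha> n x)) + M x h (\<alpha> n x - (v + \<beta> x)))"
            by (simp add: g'_def linear_diff[OF lin2[OF x]])
          also have "\<dots> \<le> norm (\<alpha>' n x h - M x h (\<alpha> n x)) + norm (M x h (\<alpha> n x - (v + \<beta> x)))"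
            by (rule norm_triangle_ineq)
          also have "\<dots> \<le> K * norm v * norm h * (1 / 2) ^ n + K * norm h * (e / (2 * (K + 1)))"
            by (rule add_mono[OF defect[OF x] D])
          also have "\<dots> = (K * norm v * (1 / 2) ^ n + K * (e / (2 * (K + 1)))) * norm h"
            by (simp add: algebra_simps)
          also have "\<dots> \<le> (e / 2 + e / 2) * norm h"
          proof (intro mult_right_mono add_mono)
            show "K * norm v * (1 / 2) ^ n \<le> e / 2" using elim(1) by simp
            have "K * (e / (2 * (K + 1))) \<le> (K + 1) * (e / (2 * (K + 1)))"
              using K(1) e by (intro mult_right_mono) auto
            also have "\<dots> = e / 2"
            proof -
              have "K + 1 \<noteq> 0" using K(1) by simp
              then show ?thesis by (simp add: field_simps)
            qed
            finally show "K * (e / (2 * (K + 1))) \<le> e / 2" .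
          qed simp
          finally show "norm (\<alpha>' n x h - g' x h) \<le> e * norm h" by simp
        qed
      qed
    qed
    then obtain g where g: "\<And>x. x \<in> ?B \<Longrightarrow> (\<lambda>n. \<alpha> n x) \<longlonglongrightarrow> g x"
      "\<And>x. x \<in> ?B \<Longrightarrow> (g has_derivative g' x) (at x within ?B)" by blast
    have g\<beta>: "g x = v + \<beta> x" if "x \<in> ?B" for x
    proof -
      have "(\<lambda>n. v + (\<Sum>k<n. \<alpha> (Suc k) x - \<alpha> k x)) \<longlonglongrightarrow> v + \<beta> x"
        by (intro tendsto_intros tendsto_uniform_limitI[OF \<beta> that])
      then have "(\<lambda>n. \<alpha> n x) \<longlonglongrightarrow> v + \<beta> x" by (simp add: tele)
      then show ?thesis using LIMSEQ_unique[OF g(1)[OF that]] by blast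
    qed
    have "(g has_derivative (\<lambda>u. M y u (g y))) (at y)" if "y \<in> ?B" for y
      using g(2)[OF that] by (simp add: at_within_open[OF that open_ball] g'_def[abs_def] g\<beta>[OF that])
    moreover have "g a = v"
    proof -
      have "M a 0 w = 0" for w
        using linear_0[OF linear_bilinear_left[OF bilB]] r by simp
      then have "\<alpha> n a = v" for n by (cases n) (simp_all add: \<alpha>0 \<alpha>S)
      then show ?thesis using g(1)[of a] r by (simp add: LIMSEQ_const_iff)
    qed
    ultimately show ?thesis by blast
  qed
  then show ?thesis using r BS by blast
qed

section \<open>Flat coordinates\<close>

text \<open>
  \<open>E\<close> is the coframe of parallel one-forms and \<open>N\<close> the frame of parallel vector fields; \<open>E\<close> is
  closed since the connection is torsion-free, so it is the differential of a chart \<open>h\<close>.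
\<close>

lemma flat_coordinates:
  fixes \<Gamma> :: "'e::euclidean_space \<Rightarrow> 'e \<Rightarrow> 'e \<Rightarrow> 'e"
  assumes S: "open S" "a \<in> S" and bil: "\<And>y. y \<in> S \<Longrightarrow> bilinear (\<Gamma> y)"
    and sm: "\<And>u v. smooth_on S (\<lambda>y. \<Gamma> y u v)"
    and sym: "\<And>y u v. y \<in> S \<Longrightarrow> \<Gamma> y u v = \<Gamma> y v u"
    and flat: "\<And>y u v w. y \<in> S \<Longrightarrow>
      differential (\<lambda>y. \<Gamma> y w v) y u + \<Gamma> y u (\<Gamma> y w v) = differential (\<lambda>y. \<Gamma> y u v) y w + \<Gamma> y w (\<Gamma> y u v)"
  obtains r h E N where "r > 0" "ball a r \<subseteq> S" "diffeo_on (ball a r) h"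
    "\<And>y. y \<in> ball a r \<Longrightarrow> (h has_derivative E y) (at y)"
    "\<And>y. linear (N y)" "\<And>v. N a v = v"
    "\<And>y v. y \<in> ball a r \<Longrightarrow> E y (N y v) = v" "\<And>y v. y \<in> ball a r \<Longrightarrow> N y (E y v) = v"
    "\<And>y v. y \<in> ball a r \<Longrightarrow> ((\<lambda>y. E y v) has_derivative (\<lambda>u. E y (\<Gamma> y u v))) (at y)"
    "\<And>y v. y \<in> ball a r \<Longrightarrow> ((\<lambda>y. N y v) has_derivative (\<lambda>u. - \<Gamma> y u (N y v))) (at y)"
proof -
  define \<Gamma>' where "\<Gamma>' y h u v = differential (\<lambda>y. \<Gamma> y u v) y h" for y h u v
  have d\<Gamma>: "((\<lambda>y. \<Gamma> y u v) has_derivative (\<lambda>h. \<Gamma>' y h u v)) (at y)" if "y \<in> S" for y u v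
    using smooth_on_has_derivative[OF sm that] by (simp add: \<Gamma>'_def)
  have c\<Gamma>': "continuous_on S (\<lambda>y. \<Gamma>' y h u v)" for h u v
    unfolding \<Gamma>'_def by (rule smooth_on_continuous[OF smooth_on_frechet_derivative[OF sm]])
  have flat': "\<Gamma>' y u w v + \<Gamma> y u (\<Gamma> y w v) = \<Gamma>' y w u v + \<Gamma> y w (\<Gamma> y u v)" if "y \<in> S" for y u v w
    using flat[OF that] by (simp add: \<Gamma>'_def)
  have lin1: "linear (\<lambda>u. \<Gamma> y u v)" and lin2: "linear (\<Gamma> y u)" if "y \<in> S" for y u v
    using bil[OF that] by (auto simp: bilinear_def)
  have lin3: "linear (\<Gamma>' y h u)" if "y \<in> S" for y h u
    using linear_field_derivative[OF S(1) that lin2 d\<Gamma>[OF that]] .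
  have expand: "(\<Sum>j\<in>Basis. (\<alpha> \<bullet> A j) *\<^sub>R j) \<bullet> v = \<alpha> \<bullet> A v" if "linear A" for A :: "'e \<Rightarrow> 'e" and \<alpha> v
  proof -
    have "\<alpha> \<bullet> A v = (\<Sum>j\<in>Basis. (v \<bullet> j) * (\<alpha> \<bullet> A j))"
      by (subst linear_Basis_expansion[OF that]) (simp add: inner_sum_right)
    then show ?thesis by (simp add: inner_sum_left mult.commute inner_commute[of v])
  qed
  \<comment> \<open>A one-form is represented by a vector through the inner product. Then
    \<open>M y u\<close> is the transpose of \<open>\<Gamma> y u\<close>, and parallel one-forms are
    the solutions of the system given by \<open>M\<close>.\<close>
  define M where "M y u \<alpha> = (\<Sum>j\<in>Basis. (\<alpha> \<bullet> \<Gamma> y u j) *\<^sub>R j)" for y u \<alpha>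
  define M' where "M' y h u \<alpha> = (\<Sum>j\<in>Basis. (\<alpha> \<bullet> \<Gamma>' y h u j) *\<^sub>R j)" for y h u \<alpha>
  have M: "M y u \<alpha> \<bullet> v = \<alpha> \<bullet> \<Gamma> y u v" if "y \<in> S" for y u \<alpha> v
    unfolding M_def by (rule expand[OF lin2[OF that]])
  have M': "M' y h u \<alpha> \<bullet> v = \<alpha> \<bullet> \<Gamma>' y h u v" if "y \<in> S" for y h u \<alpha> v
    unfolding M'_def by (rule expand[OF lin3[OF that]])
  have bilM: "bilinear (M y)" if y: "y \<in> S" for y
    unfolding bilinear_def
    by (auto intro!: linearI euclidean_eqI[where 'a = 'e] simp: M[OF y] inner_add_left inner_add_right
        linear_add[OF lin1[OF y]] linear_scale[OF lin1[OF y]])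
  have dM: "((\<lambda>y. M y u v) has_derivative (\<lambda>h. M' y h u v)) (at y)" if "y \<in> S" for y u v
    unfolding M_def M'_def
    by (intro has_derivative_sum has_derivative_scaleR_left has_derivative_inner_right d\<Gamma> that)
  have cM': "continuous_on S (\<lambda>y. M' y h u v)" for h u v
    unfolding M'_def by (intro continuous_intros c\<Gamma>')
  have "\<exists>r>0. ball a r \<subseteq> S \<and> (\<forall>v. \<exists>\<alpha>. \<alpha> a = v \<and>
    (\<forall>y\<in>ball a r. (\<alpha> has_derivative (\<lambda>u. M y u (\<alpha> y))) (at y)))"
  proof (rule integrable_linear_system[OF S bilM dM cM'])
    fix y u w v assume y: "y \<in> S"
    show "M' y u w v + M y w (M y u v) = M' y w u v + M y u (M y w v)"
    proof (rule euclidean_eqI[where 'a = 'e])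
      fix b :: 'e
      show "(M' y u w v + M y w (M y u v)) \<bullet> b = (M' y w u v + M y u (M y w v)) \<bullet> b"
        using flat'[OF y, of u w b] by (simp add: M[OF y] M'[OF y] inner_add_left flip: inner_add_right)
    qed
  qed
  then obtain r1 where r1: "r1 > 0" "ball a r1 \<subseteq> S"
    "\<And>v. \<exists>\<alpha>. \<alpha> a = v \<and> (\<forall>y\<in>ball a r1. (\<alpha> has_derivative (\<lambda>u. M y u (\<alpha> y))) (at y))"
    by metis
  have bil_minus: "bilinear (\<lambda>u v. - \<Gamma> y u v)" if "y \<in> S" for y
    using bil[OF that] unfolding bilinear_def by (auto intro: linear_compose_neg)
  have "\<exists>r>0. ball a r \<subseteq> S \<and> (\<forall>v. \<exists>\<nu>. \<nu> a = v \<and>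
    (\<forall>y\<in>ball a r. (\<nu> has_derivative (\<lambda>u. - \<Gamma> y u (\<nu> y))) (at y)))"
  proof (rule integrable_linear_system[where M' = "\<lambda>y h u v. - \<Gamma>' y h u v", OF S bil_minus])
    show "((\<lambda>y. - \<Gamma> y u v) has_derivative (\<lambda>h. - \<Gamma>' y h u v)) (at y)" if "y \<in> S" for y u v
      by (intro has_derivative_minus d\<Gamma> that)
    show "continuous_on S (\<lambda>y. - \<Gamma>' y h u v)" for h u v by (intro continuous_intros c\<Gamma>')
    show "- \<Gamma>' y u w v + - \<Gamma> y w (- \<Gamma> y u v) = - \<Gamma>' y w u v + - \<Gamma> y u (- \<Gamma> y w v)" if "y \<in> S" for y u w v
      using flat'[OF that, of u w v] by (simp add: linear_neg[OF lin2[OF that]] algebra_simps)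
  qed
  then obtain r2 where r2: "r2 > 0" "ball a r2 \<subseteq> S"
    "\<And>v. \<exists>\<nu>. \<nu> a = v \<and> (\<forall>y\<in>ball a r2. (\<nu> has_derivative (\<lambda>u. - \<Gamma> y u (\<nu> y))) (at y))"
    by metis
  define r0 where "r0 = min r1 r2"
  let ?B = "ball a r0"
  have r0: "r0 > 0" "?B \<subseteq> S" using r1 r2 by (auto simp: r0_def)
  note inS = subsetD[OF r0(2)]
  have "\<exists>\<alpha>. \<forall>v. \<alpha> v a = v \<and> (\<forall>y\<in>?B. (\<alpha> v has_derivative (\<lambda>u. M y u (\<alpha> v y))) (at y))"
  proof (rule choice, rule allI)
    fix v
    obtain f where "f a = v" "\<forall>y\<in>ball a r1. (f has_derivative (\<lambda>u. M y u (f y))) (at y)"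
      using r1(3)[of v] by blast
    then show "\<exists>f. f a = v \<and> (\<forall>y\<in>?B. (f has_derivative (\<lambda>u. M y u (f y))) (at y))"
      by (intro exI[of _ f]) (simp add: r0_def)
  qed
  then obtain \<alpha> where \<alpha>: "\<And>v. \<alpha> v a = v"
    "\<And>v y. y \<in> ?B \<Longrightarrow> (\<alpha> v has_derivative (\<lambda>u. M y u (\<alpha> v y))) (at y)"
    by blast
  have "\<exists>\<nu>. \<forall>v. \<nu> v a = v \<and> (\<forall>y\<in>?B. (\<nu> v has_derivative (\<lambda>u. - \<Gamma> y u (\<nu> v y))) (at y))"
  proof (rule choice, rule allI)
    fix v
    obtain f where "f a = v" "\<forall>y\<in>ball a r2. (f has_derivative (\<lambda>u. - \<Gamma> y u (f y))) (at y)"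
      using r2(3)[of v] by blast
    then show "\<exists>f. f a = v \<and> (\<forall>y\<in>?B. (f has_derivative (\<lambda>u. - \<Gamma> y u (f y))) (at y))"
      by (intro exI[of _ f]) (simp add: r0_def)
  qed
  then obtain \<nu> where \<nu>: "\<And>v. \<nu> v a = v"
    "\<And>v y. y \<in> ?B \<Longrightarrow> (\<nu> v has_derivative (\<lambda>u. - \<Gamma> y u (\<nu> v y))) (at y)"
    by blast
  \<comment> \<open>\<open>E y v\<close> lists the values on \<open>v\<close> of the parallel
    one-forms that form the standard dual basis at \<open>a\<close>; \<open>N y\<close> sends each
    basis vector to the parallel field extending it.\<close>
  define E where "E y v = (\<Sum>i\<in>Basis. (\<alpha> i y \<bullet> v) *\<^sub>R i)" for y v
  define N where "N y v = (\<Sum>i\<in>Basis. (v \<bullet> i) *\<^sub>R \<nu> i y)" for y v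
  have linE: "linear (E y)" for y
    by (rule linearI) (simp_all add: E_def inner_add_right scaleR_add_left sum.distrib scaleR_sum_right)
  have linN: "linear (N y)" for y
    by (rule linearI) (simp_all add: N_def inner_add_left scaleR_add_left sum.distrib scaleR_sum_right)
  have Na: "N a v = v" and Ea: "E a v = v" for v
    by (simp_all add: N_def E_def \<nu>(1) \<alpha>(1) inner_commute[of _ v] euclidean_representation)
  have dE: "((\<lambda>y. E y v) has_derivative (\<lambda>u. E y (\<Gamma> y u v))) (at y)" if y: "y \<in> ?B" for y v
    unfolding E_def M[OF inS[OF y], symmetric]
    by (intro has_derivative_sum has_derivative_scaleR_left has_derivative_inner_left \<alpha>(2) y)
  have dN: "((\<lambda>y. N y v) has_derivative (\<lambda>u. - \<Gamma> y u (N y v))) (at y)" if y: "y \<in> ?B" for y v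
  proof -
    have "((\<lambda>y. N y v) has_derivative (\<lambda>u. \<Sum>i\<in>Basis. (v \<bullet> i) *\<^sub>R - \<Gamma> y u (\<nu> i y))) (at y)"
      unfolding N_def by (intro has_derivative_sum has_derivative_scaleR_right \<nu>(2) y)
    moreover have "(\<lambda>u. \<Sum>i\<in>Basis. (v \<bullet> i) *\<^sub>R - \<Gamma> y u (\<nu> i y)) = (\<lambda>u. - \<Gamma> y u (N y v))"
      by (simp add: N_def linear_sum[OF lin2[OF inS[OF y]]] linear_scale[OF lin2[OF inS[OF y]]] sum_negf)
    ultimately show ?thesis by simp
  qed
  \<comment> \<open>The pairing of parallel one-forms with parallel fields is constant, and at
    \<open>a\<close> both \<open>E\<close> and \<open>N\<close> are the identity.\<close>
  have EN: "E y (N y v) = v" if y: "y \<in> ?B" for y v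
  proof -
    have "((\<lambda>y. E y (N y v)) has_derivative (\<lambda>_. 0)) (at z within ?B)" if z: "z \<in> ?B" for z
    proof -
      have "((\<lambda>y. E y (N y v)) has_derivative
          (\<lambda>u. E z (\<Gamma> z u (N z v)) + E z (- \<Gamma> z u (N z v)))) (at z)"
        by (rule has_derivative_linear_field[OF open_ball z linE dE[OF z] dN[OF z]])
      then show ?thesis by (simp add: linear_neg[OF linE] has_derivative_at_withinI)
    qed
    from has_derivative_zero_constant[OF convex_ball this]
    obtain c where c: "\<And>z. z \<in> ?B \<Longrightarrow> E z (N z v) = c" by blast
    show ?thesis using c[OF y] c[of a] r0 by (simp add: Ea Na)
  qed
  have NE: "N y (E y v) = v" if y: "y \<in> ?B" for y v
    using linear_inverse_left[OF linE linN, of y y] EN[OF y] by (auto simp: fun_eq_iff)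
  have smM: "smooth_on ?B (\<lambda>y. M y u v)" for u v
    unfolding M_def inner_commute[of v]
    by (auto intro!: smooth_on_sum smooth_on_scaleR smooth_on_inner smooth_on_subset[OF sm r0(2)])
  have sm\<alpha>: "smooth_on ?B (\<alpha> v)" for v
    by (rule smooth_on_of_differential_equation[where M = M, OF open_ball _ smM \<alpha>(2)])
      (use linear_bilinear_right[OF bilM[OF inS]] in auto)
  have smE: "smooth_on ?B (\<lambda>y. E y v)" for v
    unfolding E_def by (auto intro!: smooth_on_sum smooth_on_scaleR smooth_on_inner sm\<alpha>)
  have sm\<nu>: "smooth_on ?B (\<nu> v)" for v
  proof (rule smooth_on_of_differential_equation[where M = "\<lambda>y u v. - \<Gamma> y u v", OF open_ball])
    show "(\<nu> v has_derivative (\<lambda>u. - \<Gamma> y u (\<nu> v y))) (at y)" if "y \<in> ?B" for y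
      by (rule \<nu>(2)[OF that])
    show "linear (\<lambda>v. - \<Gamma> y u v)" if "y \<in> ?B" for y u
      using lin2[OF inS[OF that]] by (rule linear_compose_neg)
    show "smooth_on ?B (\<lambda>y. - \<Gamma> y u v)" for u v
      by (rule smooth_on_linear_compose[OF open_ball linear_uminus smooth_on_subset[OF sm r0(2)]])
  qed
  have smN: "smooth_on ?B (\<lambda>y. N y v)" for v
    unfolding N_def by (auto intro!: smooth_on_sum smooth_on_scaleR sm\<nu>)
  have c\<Gamma>: "continuous_on ?B (\<lambda>y. E y (\<Gamma> y u v))" for u v
    by (rule smooth_on_continuous, rule smooth_on_linear_field[OF open_ball linE smE])
      (rule smooth_on_subset[OF sm r0(2)])
  \<comment> \<open>The radial primitive of \<open>E\<close>. Symmetry of \<open>\<Gamma>\<close>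
    makes the derivative of \<open>E\<close> symmetric, so the error integral vanishes and
    \<open>h\<close> has differential \<open>E\<close>.\<close>
  define h where "h s = integral {0..1} (\<lambda>t. E (a + t *\<^sub>R (s - a)) (s - a))" for s
  have dh: "(h has_derivative E y) (at y)" if y: "y \<in> ?B" for y
  proof -
    have sym': "E (a + t *\<^sub>R (y - a)) (\<Gamma> (a + t *\<^sub>R (y - a)) u (y - a))
        = E (a + t *\<^sub>R (y - a)) (\<Gamma> (a + t *\<^sub>R (y - a)) (y - a) u)" if "t \<in> {0..1}" for t u
      using sym[OF inS[OF ball_segment[OF y that]]] by metis
    have "integral {0..1} (\<lambda>t. t *\<^sub>R (E (a + t *\<^sub>R (y - a)) (\<Gamma> (a + t *\<^sub>R (y - a)) u (y - a)) -
        E (a + t *\<^sub>R (y - a)) (\<Gamma> (a + t *\<^sub>R (y - a)) (y - a) u)))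
      = integral {0..1} (\<lambda>t::real. 0)" for u
      by (rule integral_cong) (simp add: sym')
    then show ?thesis
      using homotopy_formula(1)[OF linE dE c\<Gamma> y] by (simp add: h_def[abs_def])
  qed
  have blE: "blinfun_apply (Blinfun (E y)) = E y" for y
    using linE by (intro bounded_linear_Blinfun_apply) (simp add: linear_conv_bounded_linear)
  have blN: "blinfun_apply (Blinfun (N y)) = N y" for y
    using linN by (intro bounded_linear_Blinfun_apply) (simp add: linear_conv_bounded_linear)
  have "Blinfun (N a) o\<^sub>L Blinfun (E a) = id_blinfun"
    by (rule blinfun_eqI) (simp add: blE blN Na Ea)
  moreover have "continuous_on ?B (\<lambda>y. Blinfun (E y))"
    by (rule continuous_on_blinfun_componentwise) (simp add: blE smooth_on_continuous[OF smE])
  ultimately obtain U V g g' where U: "open U" "U \<subseteq> ?B" "a \<in> U" and hom: "homeomorphism U V h g"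
    and g: "\<And>y. y \<in> V \<Longrightarrow> (g has_derivative g' y) (at y)"
    "\<And>y. y \<in> V \<Longrightarrow> g' y = inv (E (g y))"
    using inverse_function_theorem[of ?B h "\<lambda>y. Blinfun (E y)" a "Blinfun (N a)"] dh r0
    unfolding blE by (metis centre_in_ball open_ball)
  obtain r where r: "r > 0" "ball a r \<subseteq> U" using U open_contains_ball by blast
  let ?C = "ball a r"
  have CB: "?C \<subseteq> ?B" using r U by blast
  have gh: "g (h x) = x" if "x \<in> U" for x using hom that by (simp add: homeomorphism_def)
  have hV: "h x \<in> V" if "x \<in> U" for x using hom that by (auto simp: homeomorphism_def)
  have inj: "inj_on h ?C" using gh r(2) by (metis inj_on_inverseI subsetD)
  have smh: "smooth_on ?C h"
    by (rule smooth_onI[OF open_ball dh smooth_on_subset[OF smE CB]]) (use CB in blast)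
  have oh: "open (h ` ?C)"
    by (rule invariance_of_domain[OF smooth_on_continuous[OF smh] open_ball inj])
  have dg: "(g has_derivative N (g y)) (at y)" if y: "y \<in> h ` ?C" for y
  proof -
    obtain x where x: "x \<in> ?C" "y = h x" using y by blast
    have "inv (E x) = N x"
      using x CB EN NE by (intro inv_equality) auto
    then show ?thesis using g[OF hV[of x]] gh[of x] x r(2) by auto
  qed
  have gC: "g ` h ` ?C \<subseteq> ?C" using gh r(2) by auto
  \<comment> \<open>The derivative of \<open>g\<close> is \<open>N\<close> composed with
    \<open>g\<close>, so every order of differentiability of \<open>g\<close> yields the next
    one.\<close>
  have "diff_on k (h ` ?C) g" for k
  proof (induction k)
    case 0
    have "continuous_on (h ` ?C) g"
      by (rule has_derivative_continuous_on, rule has_derivative_at_withinI, rule dg)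
    then show ?case by simp
  next
    case (Suc k)
    have "diff_on k ?C (\<lambda>x. N x v)" for v
      using smooth_on_subset[OF smN CB] by (simp add: smooth_on_def)
    from diff_on_compose[OF oh open_ball gC this Suc] dg
    show ?case by (intro diff_on_SucI[OF oh, where f' = "\<lambda>y. N (g y)"])
  qed
  then have "smooth_on (h ` ?C) g" by (simp add: smooth_on_def)
  then have "smooth_on (h ` ?C) (inv_into ?C h)"
  proof (rule smooth_on_cong[OF oh, rotated])
    show "g y = inv_into ?C h y" if "y \<in> h ` ?C" for y
      using that inj gh r(2) by (auto simp: inv_into_f_f)
  qed
  then have "diffeo_on ?C h" using smh inj oh by (simp add: diffeo_on_def)
  then show ?thesis
    using that[OF r(1) _ _ dh linN Na EN NE dE dN] CB r0(2) by blast
qed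

section \<open>Composition of structure-preserving maps\<close>

lemma diffeo_on_subset:
  assumes "diffeo_on S h" "T \<subseteq> S" "open T"
  shows "diffeo_on T h"
proof -
  have h: "smooth_on S h" "inj_on h S" "open (h ` S)" "smooth_on (h ` S) (inv_into S h)"
    using assms(1) by (auto simp: diffeo_on_def)
  have inj: "inj_on h T" using h(2) assms(2) by (rule inj_on_subset)
  \<comment> \<open>The image of the smaller set is a preimage under the continuous inverse, hence
    open.\<close>
  have "h ` T = h ` S \<inter> inv_into S h -` T"
    using assms(2) inv_into_f_f[OF h(2)] by auto
  then have o: "open (h ` T)"
    using continuous_open_preimage[OF smooth_on_continuous[OF h(4)] h(3) assms(3)] by simp
  have "smooth_on (h ` T) (inv_into T h)"
  proof (rule smooth_on_cong[OF o])
    show "smooth_on (h ` T) (inv_into S h)" using h(4) assms(2) by (blast intro: smooth_on_subset)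
    show "inv_into S h y = inv_into T h y" if "y \<in> h ` T" for y
      using that inj h(2) assms(2) by (auto simp: inv_into_f_f subset_iff)
  qed
  then show ?thesis using o inj smooth_on_subset[OF h(1) assms(2)] by (simp add: diffeo_on_def)
qed

lemma diffeo_on_compose:
  assumes S: "open S" and h: "diffeo_on S h" and k: "diffeo_on T k" and sub: "h ` S \<subseteq> T" and T: "open T"
  shows "diffeo_on S (\<lambda>x. k (h x))"
proof -
  have h': "smooth_on S h" "inj_on h S" "open (h ` S)" "smooth_on (h ` S) (inv_into S h)"
    using h by (auto simp: diffeo_on_def)
  have k': "smooth_on (h ` S) k" "inj_on k (h ` S)" "open (k ` h ` S)"
    "smooth_on (k ` h ` S) (inv_into (h ` S) k)"
    using diffeo_on_subset[OF k sub h'(3)] by (auto simp: diffeo_on_def)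
  have inj: "inj_on (\<lambda>x. k (h x)) S"
    using comp_inj_on[OF h'(2) k'(2)] by (simp add: o_def)
  have "smooth_on (k ` h ` S) (\<lambda>y. inv_into S h (inv_into (h ` S) k y))"
    by (rule smooth_on_compose[OF k'(3) h'(3) _ h'(4) k'(4)]) (auto intro: inv_into_into)
  then have "smooth_on (k ` h ` S) (inv_into S (\<lambda>x. k (h x)))"
    by (rule smooth_on_cong[OF k'(3), rotated])
      (auto simp: inv_into_f_f[OF inj] inv_into_f_f[OF k'(2)] inv_into_f_f[OF h'(2)])
  moreover have "smooth_on S (\<lambda>x. k (h x))"
    by (rule smooth_on_compose[OF S h'(3) _ k'(1) h'(1)]) simp
  ultimately show ?thesis using inj k'(3) by (simp add: diffeo_on_def image_image)
qed

lemma diffeo_on_linear: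
  fixes L :: "'e::euclidean_space \<Rightarrow> 'e"
  assumes "linear L" "bij L"
  shows "diffeo_on UNIV L"
  unfolding diffeo_on_def
proof (intro conjI)
  have s: "range L = UNIV" and i: "inj L" using assms(2) by (auto simp: bij_def)
  show "smooth_on UNIV L" using assms(1) by (rule smooth_on_linear)
  show "inj L" by (rule i)
  show "open (range L)" by (simp add: s)
  show "smooth_on (range L) (inv L)"
    by (rule smooth_on_linear) (rule inj_linear_imp_inv_linear[OF assms(1) i])
qed

lemma diffeo_on_differential_bij:
  fixes h :: "'e::euclidean_space \<Rightarrow> 'e"
  assumes S: "open S" "x \<in> S" and h: "diffeo_on S h"
  shows "linear (differential h x)" "bij (differential h x)"
proof -
  have h': "smooth_on S h" "inj_on h S" "smooth_on (h ` S) (inv_into S h)"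
    using h by (auto simp: diffeo_on_def)
  show lin: "linear (differential h x)" by (rule smooth_on_linear_frechet_derivative[OF h'(1) S(2)])
  let ?g = "inv_into S h"
  have "((\<lambda>x. ?g (h x)) has_derivative (\<lambda>u. differential ?g (h x) (differential h x u))) (at x)"
    by (rule has_derivative_compose[OF smooth_on_has_derivative[OF h'(1) S(2)]
          smooth_on_has_derivative[OF h'(3)]]) (use S in simp)
  then have "((\<lambda>x. x) has_derivative (\<lambda>u. differential ?g (h x) (differential h x u))) (at x)"
    by (rule has_derivative_transform_within_open[OF _ S]) (simp add: inv_into_f_f[OF h'(2)])
  from has_derivative_unique[OF this has_derivative_ident]
  have "inj (differential h x)" by (metis injI)
  then show "bij (differential h x)"
    using linear_injective_imp_surjective[OF lin] by (auto simp: bij_def)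
qed

lemma differential_compose:
  assumes "smooth_on S h" "smooth_on T k" "h ` S \<subseteq> T" "x \<in> S"
  shows "differential (\<lambda>x. k (h x)) x = (\<lambda>u. differential k (h x) (differential h x u))"
  using assms by (intro frechet_derivative_at[symmetric] has_derivative_compose[OF
        smooth_on_has_derivative[OF assms(1)] smooth_on_has_derivative[OF assms(2)]]) auto

lemma preserves_metric_compose:
  assumes "smooth_on S h" "smooth_on T k" "h ` S \<subseteq> T"
    and "preserves_metric S h g g'" "preserves_metric T k g' g''"
  shows "preserves_metric S (\<lambda>x. k (h x)) g g''"
  using assms(3-5) by (auto simp: preserves_metric_def differential_compose[OF assms(1-3)] image_subset_iff)

lemma preserves_endo_compose:
  assumes "smooth_on S h" "smooth_on T k" "h ` S \<subseteq> T"
    and "preserves_endo S h A A'" "preserves_endo T k A' A''"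
  shows "preserves_endo S (\<lambda>x. k (h x)) A A''"
  using assms(3-5) by (auto simp: preserves_endo_def differential_compose[OF assms(1-3)] image_subset_iff)

text \<open>The second derivative of the composition has two terms. One is absorbed by the
  transformation law of \<open>h\<close> after applying the differential of \<open>k\<close>, the
  other by the law of \<open>k\<close> at the image vectors.\<close>

lemma preserves_connection_compose:
  assumes S: "open S" and sm: "smooth_on S h" "smooth_on T k" "h ` S \<subseteq> T" and T: "open T"
    and h: "preserves_connection S h \<Gamma> \<Gamma>'" and k: "preserves_connection T k \<Gamma>' \<Gamma>''"
  shows "preserves_connection S (\<lambda>x. k (h x)) \<Gamma> \<Gamma>''"
  unfolding preserves_connection_def
proof (intro ballI allI)
  fix x u v assume x: "x \<in> S"
  then have hx: "h x \<in> T" using sm(3) by blast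
  note D = differential_compose[OF sm]
  have lin: "linear (differential k y)" if "y \<in> T" for y
    by (rule smooth_on_linear_frechet_derivative[OF sm(2) that])
  have op: "open (S \<inter> h -` T)"
    by (rule continuous_open_preimage[OF smooth_on_continuous[OF sm(1)] S T])
  let ?u = "differential h x u" and ?v = "differential h x v"
  have "((\<lambda>y. differential k (h y) (differential h y v)) has_derivative
     (\<lambda>u. differential (\<lambda>y. differential k y ?v) (h x) (differential h x u)
        + differential k (h x) (differential (\<lambda>y. differential h y v) x u))) (at x)"
  proof (rule has_derivative_linear_field[where A = "\<lambda>y. differential k (h y)", OF op])
    show "x \<in> S \<inter> h -` T" using x hx by simp
    show "linear (differential k (h y))" if "y \<in> S \<inter> h -` T" for y using lin that by simp
    show "((\<lambda>y. differential h y v) has_derivative differential (\<lambda>y. differential h y v) x) (at x)"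
      by (rule smooth_on_has_derivative[OF smooth_on_frechet_derivative[OF sm(1)] x])
    show "((\<lambda>y. differential k (h y) w) has_derivative
        (\<lambda>u. differential (\<lambda>y. differential k y w) (h x) (differential h x u))) (at x)" for w
      by (rule has_derivative_compose[OF smooth_on_has_derivative[OF sm(1) x]
            smooth_on_has_derivative[OF smooth_on_frechet_derivative[OF sm(2)] hx]])
  qed
  then have "((\<lambda>y. differential (\<lambda>x. k (h x)) y v) has_derivative
     (\<lambda>u. differential (\<lambda>y. differential k y ?v) (h x) (differential h x u)
        + differential k (h x) (differential (\<lambda>y. differential h y v) x u))) (at x)"
    by (rule has_derivative_transform_within_open[OF _ S x]) (simp add: D)
  from frechet_derivative_at[OF this, symmetric]
  have "differential (\<lambda>y. differential (\<lambda>x. k (h x)) y v) x u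
    = differential (\<lambda>y. differential k y ?v) (h x) ?u
        + differential k (h x) (differential (\<lambda>y. differential h y v) x u)" by simp
  moreover have "differential h x (\<Gamma> x u v) = differential (\<lambda>y. differential h y v) x u + \<Gamma>' (h x) ?u ?v"
    using h x by (simp add: preserves_connection_def)
  moreover have "differential k (h x) (\<Gamma>' (h x) ?u ?v)
      = differential (\<lambda>y. differential k y ?v) (h x) ?u
        + \<Gamma>'' (k (h x)) (differential k (h x) ?u) (differential k (h x) ?v)"
    using k hx by (simp add: preserves_connection_def)
  ultimately show "differential (\<lambda>x. k (h x)) x (\<Gamma> x u v) =
      differential (\<lambda>y. differential (\<lambda>x. k (h x)) y v) x u +
      \<Gamma>'' (k (h x)) (differential (\<lambda>x. k (h x)) x u) (differential (\<lambda>x. k (h x)) x v)"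
    by (simp add: D[OF x] linear_add[OF lin[OF hx]])
qed

section \<open>Pseudo-Hermitian linear algebra\<close>

lemma bilinear_simps:
  assumes "bilinear B"
  shows "B (u + v) w = B u w + B v w" "B w (u + v) = B w u + B w v"
    "B (u - v) w = B u w - B v w" "B w (u - v) = B w u - B w v"
    "B (c *\<^sub>R u) w = c *\<^sub>R B u w" "B w (c *\<^sub>R u) = c *\<^sub>R B w u"
    "B (- u) w = - B u w" "B w (- u) = - B w u" "B 0 w = 0" "B w 0 = 0"
  using assms by (simp_all add: bilinear_ladd bilinear_radd bilinear_lsub bilinear_rsub
      bilinear_lmul bilinear_rmul bilinear_lneg bilinear_rneg bilinear_lzero bilinear_rzero)

lemma bilinear_sum:
  assumes "bilinear B"
  shows "B (\<Sum>i\<in>I. f i) w = (\<Sum>i\<in>I. B (f i) w)" "B w (\<Sum>i\<in>I. f i) = (\<Sum>i\<in>I. B w (f i))"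
  using linear_sum[OF linear_bilinear_left[OF assms]] linear_sum[OF linear_bilinear_right[OF assms]]
  by (auto simp: o_def)

text \<open>The structure of a single tangent space in a chart. Charts need not be holomorphic, so
  \<open>J\<close> is an arbitrary complex structure on the coordinate space rather than
  multiplication by \<open>\<i>\<close>.\<close>

locale hermitian_space =
  fixes g :: "complex ^ 'n::finite \<Rightarrow> complex ^ 'n \<Rightarrow> real" and J :: "complex ^ 'n \<Rightarrow> complex ^ 'n"
  assumes bil: "bilinear g" and sym: "g u v = g v u"
    and nondeg: "(\<And>v. g u v = 0) \<Longrightarrow> u = 0"
    and linJ: "linear J" and JJ: "J (J u) = - u" and gJ: "g (J u) (J v) = g u v"
begin

lemmas g_simps = bilinear_simps[OF bil]
lemmas g_sum = bilinear_sum[OF bil]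

lemma J_skew: "g u (J v) = - g (J u) v"
  using gJ[of u "J v"] by (simp add: JJ g_simps)

lemma g_J_self: "g u (J u) = 0"
  using J_skew[of u u] sym[of u "J u"] by simp

definition unitary_family :: "'n set \<Rightarrow> ('n \<Rightarrow> complex ^ 'n) \<Rightarrow> bool" where
  "unitary_family I b \<longleftrightarrow> (\<forall>i\<in>I. g (b i) (b i) \<in> {1, - 1} \<and>
     (\<forall>j\<in>I. g (b i) (J (b j)) = 0 \<and> (i \<noteq> j \<longrightarrow> g (b i) (b j) = 0)))"

text \<open>Orthonormalization of a given vector breaks down if it becomes null. Instead, the
  orthogonal complement of the family is used: it is nonzero by dimension and \<open>g\<close> is
  nondegenerate on it, so it contains some vector with nonzero square.\<close>

lemma unitary_family_extend:
  assumes b: "unitary_family I b" and x: "x \<notin> I"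
  shows "\<exists>b'. unitary_family (insert x I) b'"
proof -
  define \<epsilon> where "\<epsilon> i = g (b i) (b i)" for i
  have \<epsilon>: "\<epsilon> i \<noteq> 0" if "i \<in> I" for i using b that by (auto simp: unitary_family_def \<epsilon>_def)
  have gb: "g (b i) (b j) = (if i = j then \<epsilon> i else 0)" "g (b i) (J (b j)) = 0"
    "g (J (b i)) (b j) = 0" if "i \<in> I" "j \<in> I" for i j
    using b that by (auto simp: unitary_family_def \<epsilon>_def sym[of "J _"])
  \<comment> \<open>The orthogonal projection onto the span of all \<open>b i\<close> and
    \<open>J (b i)\<close>; both vectors of a pair have the same square
    \<open>\<epsilon> i\<close>.\<close>
  define pr where "pr w = (\<Sum>i\<in>I. (g w (b i) / \<epsilon> i) *\<^sub>R b i + (g w (J (b i)) / \<epsilon> i) *\<^sub>R J (b i))" for w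
  have pr: "g (pr w) (b j) = g w (b j)" "g (pr w) (J (b j)) = g w (J (b j))" if j: "j \<in> I" for w j
  proof -
    have "g (pr w) (b j) = (\<Sum>i\<in>I. if i = j then g w (b j) else 0)"
      unfolding pr_def g_sum by (rule sum.cong[OF refl]) (use \<epsilon> j in \<open>simp add: g_simps gb\<close>)
    then show "g (pr w) (b j) = g w (b j)" using j by simp
    have "g (pr w) (J (b j)) = (\<Sum>i\<in>I. if i = j then g w (J (b j)) else 0)"
      unfolding pr_def g_sum by (rule sum.cong[OF refl]) (use \<epsilon> j in \<open>simp add: g_simps gb gJ\<close>)
    then show "g (pr w) (J (b j)) = g w (J (b j))" using j by simp
  qed
  define U where "U = {u. \<forall>i\<in>I. g u (b i) = 0 \<and> g u (J (b i)) = 0}"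
  have Upr: "w - pr w \<in> U" for w by (simp add: U_def g_simps pr)
  let ?B = "b ` I \<union> (J \<circ> b) ` I"
  have "card ?B \<le> card (b ` I) + card ((J \<circ> b) ` I)" by (rule card_Un_le)
  also have "\<dots> \<le> card I + card I" by (intro add_mono card_image_le) auto
  also have "card I + card I < 2 * CARD('n)"
  proof -
    have "I \<subset> UNIV" using x by blast
    then show ?thesis using psubset_card_mono[of UNIV I] by simp
  qed
  finally have "card ?B < DIM(complex ^ 'n)" by simp
  moreover have "dim ?B \<le> card ?B" by (rule dim_le_card') simp
  ultimately have "span ?B \<noteq> UNIV" by (metis dim_UNIV dim_span not_le)
  then obtain v where v: "v \<notin> span ?B" by blast
  have "pr v \<in> span ?B"
    unfolding pr_def by (intro span_sum span_add span_scale span_base) auto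
  then have v0: "v - pr v \<noteq> 0" using v by auto
  \<comment> \<open>If all squares on \<open>U\<close> were 0, then by polarization \<open>g\<close>
    would vanish on \<open>U\<close>; as \<open>U\<close> is orthogonal to the image of
    \<open>pr\<close>, the vector \<open>v - pr v\<close> would be orthogonal to everything.\<close>
  have "\<exists>u\<in>U. g u u \<noteq> 0"
  proof (rule ccontr)
    assume none: "\<not> ?thesis"
    have zero: "g u w = 0" if "u \<in> U" "w \<in> U" for u w
    proof -
      have "u + w \<in> U" using that by (simp add: U_def g_simps)
      then have "g (u + w) (u + w) = 0" "g u u = 0" "g w w = 0" using none that by auto
      then show ?thesis using sym[of w u] by (simp add: g_simps)
    qed
    have "g (v - pr v) w = 0" for w
    proof -
      have "g (v - pr v) (pr w) = 0"
        unfolding pr_def[of w] g_sum using Upr[of v] by (simp add: U_def g_simps)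
      moreover have "g (v - pr v) (w - pr w) = 0" by (rule zero[OF Upr Upr])
      ultimately show ?thesis by (simp add: g_simps)
    qed
    then show False using nondeg v0 by blast
  qed
  then obtain u where u: "u \<in> U" "g u u \<noteq> 0" by blast
  define c where "c = inverse (sqrt \<bar>g u u\<bar>)"
  have c: "c * c * g u u \<in> {1, - 1}"
  proof -
    have "c * c = inverse \<bar>g u u\<bar>" by (simp add: c_def flip: inverse_mult_distrib)
    then show ?thesis using u(2) by (auto simp: abs_if)
  qed
  define b' where "b' = b(x := c *\<^sub>R u)"
  have "unitary_family (insert x I) b'"
    unfolding unitary_family_def
  proof (intro ballI conjI impI)
    have old: "b' i = b i" if "i \<in> I" for i using that x by (auto simp: b'_def)
    have new: "b' x = c *\<^sub>R u" by (simp add: b'_def)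
    have Jb: "J (c *\<^sub>R u) = c *\<^sub>R J u" by (simp add: linear_scale[OF linJ])
    have U0: "g u (b i) = 0" "g (b i) u = 0" "g u (J (b i)) = 0" "g (b i) (J u) = 0"
      "g (J u) (b i) = 0" if "i \<in> I" for i
      using u(1) that J_skew[of "b i" u] sym[of u] sym[of "b i" "J u"]
      by (auto simp: U_def)
    fix i assume i: "i \<in> insert x I"
    show "g (b' i) (b' i) \<in> {1, - 1}"
      using i b c by (auto simp: old new g_simps unitary_family_def mult.assoc)
    fix j assume j: "j \<in> insert x I"
    show "g (b' i) (J (b' j)) = 0"
      using i j by (auto simp: old new Jb g_simps U0 gb g_J_self)
    assume "i \<noteq> j"
    then show "g (b' i) (b' j) = 0"
      using i j by (auto simp: old new g_simps U0 gb)
  qed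
  then show ?thesis by blast
qed

lemma ex_unitary_family: "\<exists>b. unitary_family I b"
proof -
  have "finite I" by simp
  then show ?thesis
    by (induction I) (auto simp: unitary_family_def[of "{}"] intro: unitary_family_extend)
qed

text \<open>The signature of \<open>g\<close> is not prescribed, so \<open>P\<close> is read off
  from the signs of the squares in a unitary frame.\<close>

lemma ex_unitary_frame:
  "\<exists>(P :: 'n set) N. linear N \<and> bij N \<and> (\<forall>a b. g (N a) (N b) = std_metric P a b) \<and> (\<forall>a. N (\<i> *s a) = J (N a))"
proof -
  obtain b where b: "unitary_family UNIV b" using ex_unitary_family by blast
  define P where "P = {i. g (b i) (b i) = 1}"
  define \<epsilon> :: "'n \<Rightarrow> real" where "\<epsilon> i = (if i \<in> P then 1 else - 1)" for i
  have gb: "g (b i) (b j) = (if i = j then \<epsilon> i else 0)" "g (b i) (J (b j)) = 0"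
    "g (J (b i)) (b j) = 0" for i j
    using b by (auto simp: unitary_family_def P_def \<epsilon>_def sym[of "J _"])
  define N where "N z = (\<Sum>i\<in>UNIV. Re (z $ i) *\<^sub>R b i + Im (z $ i) *\<^sub>R J (b i))" for z :: "complex ^ 'n"
  have linN: "linear N"
    by (rule linearI) (simp_all add: N_def scaleR_add_left sum.distrib scaleR_sum_right scaleR_add_right
        add.commute add.left_commute)
  have gN: "g (N z) (b j) = \<epsilon> j * Re (z $ j)" "g (N z) (J (b j)) = \<epsilon> j * Im (z $ j)" for z j
  proof -
    have "g (N z) (b j) = (\<Sum>i\<in>UNIV. if i = j then \<epsilon> j * Re (z $ j) else 0)"
      unfolding N_def g_sum by (rule sum.cong[OF refl]) (simp add: g_simps gb)
    then show "g (N z) (b j) = \<epsilon> j * Re (z $ j)" by simp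
    have "g (N z) (J (b j)) = (\<Sum>i\<in>UNIV. if i = j then \<epsilon> j * Im (z $ j) else 0)"
      unfolding N_def g_sum by (rule sum.cong[OF refl]) (simp add: g_simps gb gJ)
    then show "g (N z) (J (b j)) = \<epsilon> j * Im (z $ j)" by simp
  qed
  have std: "std_metric P z w = (\<Sum>i\<in>UNIV. \<epsilon> i * (Re (z $ i) * Re (w $ i) + Im (z $ i) * Im (w $ i)))" for z w
    unfolding std_metric_def Re_sum by (rule sum.cong) (auto simp: \<epsilon>_def)
  have gNN: "g (N z) (N w) = std_metric P z w" for z w
    unfolding std N_def[of w] g_sum
    by (rule sum.cong) (auto simp: g_simps gN algebra_simps)
  have "inj N"
  proof (rule linear_injective_0[THEN iffD2, OF linN, rule_format])
    fix z assume z: "N z = 0"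
    have "Re (z $ j) = 0" "Im (z $ j) = 0" for j
      using gN[of z j] by (auto simp: z g_simps \<epsilon>_def split: if_splits)
    then show "z = 0" by (simp add: vec_eq_iff complex_eq_iff)
  qed
  then have "bij N" using linear_injective_imp_surjective[OF linN] by (simp add: bij_def)
  moreover have "N (\<i> *s a) = J (N a)" for a
  proof -
    have "J (N a) = (\<Sum>i\<in>UNIV. Re (a $ i) *\<^sub>R J (b i) + Im (a $ i) *\<^sub>R J (J (b i)))"
      unfolding N_def by (simp add: linear_sum[OF linJ] linear_add[OF linJ] linear_scale[OF linJ])
    then show ?thesis by (simp add: N_def JJ add.commute)
  qed
  ultimately show ?thesis using linN gNN by (intro exI[of _ P] exI[of _ N]) simp
qed

end

text \<open>The complex-valued form behind the two real ones: its real part is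
  \<open>std_metric\<close> and its imaginary part is minus \<open>std_omega\<close>. Both inherit
  their rules from its sesquilinearity.\<close>

definition herm :: "'n::finite set \<Rightarrow> complex ^ 'n \<Rightarrow> complex ^ 'n \<Rightarrow> complex" where
  "herm P u v = (\<Sum>i\<in>UNIV. (if i \<in> P then 1 else - 1) * u $ i * cnj (v $ i))"

lemma herm_add_left: "herm P (u + v) w = herm P u w + herm P v w"
  by (simp add: herm_def sum.distrib algebra_simps)

lemma herm_add_right: "herm P w (u + v) = herm P w u + herm P w v"
  by (simp add: herm_def sum.distrib algebra_simps)

lemma herm_smult_left: "herm P (c *s u) w = c * herm P u w"
  by (simp add: herm_def sum_distrib_left mult_ac)

lemma herm_smult_right: "herm P w (c *s u) = cnj c * herm P w u"
  by (simp add: herm_def sum_distrib_left mult_ac)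

lemma herm_minus: "herm P (- u) w = - herm P u w" "herm P w (- u) = - herm P w u"
  by (simp_all add: herm_def sum_negf)

lemma herm_cnj: "cnj (herm P u v) = herm P v u"
  unfolding herm_def cnj_sum by (rule sum.cong) auto

lemma herm_axis: "herm P (axis i 1) v = (if i \<in> P then 1 else - 1) * cnj (v $ i)"
proof -
  have "herm P (axis i 1) v = (\<Sum>j\<in>UNIV. if j = i then (if i \<in> P then 1 else - 1) * cnj (v $ i) else 0)"
    unfolding herm_def by (rule sum.cong) (auto simp: axis_def)
  then show ?thesis by simp
qed

lemma scaleR_eq_smult: "c *\<^sub>R u = complex_of_real c *s (u :: complex ^ 'n)"
  by (simp add: vec_eq_iff complex_eq_iff)

lemma i_smult_i [simp]: "\<i> *s (\<i> *s u) = - (u :: complex ^ 'n)"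
  by (simp add: vec_eq_iff)

lemma smult_decompose: "c *s u = Re c *\<^sub>R u + Im c *\<^sub>R (\<i> *s (u :: complex ^ 'n))"
  by (simp add: vec_eq_iff complex_eq_iff)

lemma linear_i_smult: "linear (\<lambda>u :: complex ^ 'n. \<i> *s u)"
  by (rule linearI) (simp_all add: vec_eq_iff algebra_simps)

lemma std_metric_herm: "std_metric P u v = Re (herm P u v)"
  by (simp add: std_metric_def herm_def)

lemma std_omega_herm: "std_omega P u v = - Im (herm P u v)"
  by (simp add: std_omega_def std_metric_herm herm_smult_left)

lemma herm_std_omega: "herm P u v = Complex (std_omega P u (\<i> *s v)) (- std_omega P u v)"
  by (simp add: std_omega_herm herm_smult_right complex_eq_iff)

lemma bilinear_std_metric: "bilinear (std_metric P)"
  unfolding bilinear_def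
  by (auto intro!: linearI simp: std_metric_herm herm_add_left herm_add_right herm_smult_left
      herm_smult_right scaleR_eq_smult)

lemma bilinear_std_omega: "bilinear (std_omega P)"
  unfolding bilinear_def
  by (auto intro!: linearI simp: std_omega_herm herm_add_left herm_add_right herm_smult_left
      herm_smult_right scaleR_eq_smult)

lemma std_metric_sym: "std_metric P u v = std_metric P v u"
  by (simp add: std_metric_herm flip: herm_cnj[of P v u])

lemma std_omega_skew: "std_omega P u v = - std_omega P v u"
  by (simp add: std_omega_herm flip: herm_cnj[of P v u])

lemma std_metric_i: "std_metric P (\<i> *s u) (\<i> *s v) = std_metric P u v"
  by (simp add: std_metric_herm herm_smult_left herm_smult_right)

lemma std_omega_i: "std_omega P u (\<i> *s v) = - std_omega P (\<i> *s u) v"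
  by (simp add: std_omega_herm herm_smult_left herm_smult_right)

lemma herm_nondegenerate:
  assumes "\<And>v. herm P u v = 0"
  shows "u = 0"
proof -
  have 0: "herm P (axis i 1) u = 0" for i using assms[of "axis i 1"] herm_cnj[of P u "axis i 1"] by simp
  have "u $ i = 0" for i using 0[of i] by (simp add: herm_axis split: if_splits)
  then show ?thesis by (simp add: vec_eq_iff)
qed

lemma std_omega_nondegenerate:
  assumes "\<And>v. std_omega P u v = 0"
  shows "u = 0"
  using assms by (intro herm_nondegenerate[of P]) (simp add: herm_std_omega Complex_eq_0)

lemma std_omega_eqI:
  assumes "\<And>Z. std_omega P U Z = std_omega P V Z"
  shows "U = V"
proof -
  have "std_omega P (U - V) Z = 0" for Z
    using assms by (simp add: bilinear_simps[OF bilinear_std_omega])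
  then have "U - V = 0" by (rule std_omega_nondegenerate)
  then show ?thesis by simp
qed

lemma std_metric_nondegenerate:
  assumes "\<And>v. std_metric P u v = 0"
  shows "u = 0"
proof -
  have "std_omega P (\<i> *s u) v = 0" for v
    using assms[of "- v"] by (simp add: std_omega_def bilinear_simps[OF bilinear_std_metric])
  then have "\<i> *s u = 0" by (rule std_omega_nondegenerate)
  then show ?thesis by (simp add: vec_eq_iff)
qed

lemma std_omega_represents:
  assumes "linear \<phi>"
  shows "\<exists>U. \<forall>Z. std_omega P U Z = \<phi> Z"
proof -
  let ?T = "\<lambda>U. \<Sum>b\<in>Basis. std_omega P U b *\<^sub>R b"
  have T: "?T U \<bullet> Z = std_omega P U Z" for U Z
    using linear_Basis_expansion[OF linear_bilinear_right[OF bilinear_std_omega], of P U Z]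
    by (simp add: inner_sum_left inner_commute[of Z] mult.commute)
  have lin: "linear ?T"
    by (rule linearI)
      (simp_all add: bilinear_simps[OF bilinear_std_omega] scaleR_add_left sum.distrib scaleR_sum_right)
  have "inj ?T"
  proof (rule linear_injective_0[THEN iffD2, OF lin, rule_format])
    fix U assume "?T U = 0"
    then have "std_omega P U Z = 0" for Z using T[of U Z] by simp
    then show "U = 0" by (rule std_omega_nondegenerate)
  qed
  then have "surj ?T" by (rule linear_inj_imp_surj[OF lin])
  then obtain U where U: "(\<Sum>b\<in>Basis. \<phi> b *\<^sub>R b) = ?T U" by (rule surjE)
  have "std_omega P U Z = \<phi> Z" for Z
  proof -
    have "std_omega P U Z = (\<Sum>b\<in>Basis. \<phi> b *\<^sub>R b) \<bullet> Z" using T[of U Z] U by simp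
    also have "\<dots> = \<phi> Z"
      using linear_Basis_expansion[OF assms, of Z]
      by (simp add: inner_sum_left inner_commute[of Z] mult.commute)
    finally show ?thesis .
  qed
  then show ?thesis by blast
qed

section \<open>Complex cubic forms\<close>

text \<open>Forms on \<open>V\<close> itself, with the complex scalars acting through
  \<open>J\<close>. They stand for the (3,0)-forms on the complexification, restricted to vectors
  \<open>(x, 0)\<close>.\<close>

definition complex_cubic_form ::
  "(complex ^ 'n \<Rightarrow> complex ^ 'n \<Rightarrow> complex ^ 'n \<Rightarrow> complex) \<Rightarrow> bool" where
  "complex_cubic_form t \<longleftrightarrow>
     (\<forall>x x' y z. t (x + x') y z = t x y z + t x' y z) \<and>
     (\<forall>c x y z. t (c *s x) y z = c * t x y z) \<and>
     (\<forall>x y z. t x y z = t y x z \<and> t x y z = t x z y)"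

lemma complex_cubic_form_simps:
  assumes "complex_cubic_form t"
  shows "t (x + x') y z = t x y z + t x' y z" "t x (y + y') z = t x y z + t x y' z"
    "t x y (z + z') = t x y z + t x y z'"
    "t (c *s x) y z = c * t x y z" "t x (c *s y) z = c * t x y z" "t x y (c *s z) = c * t x y z"
  using assms unfolding complex_cubic_form_def by metis+

lemma complex_cubic_form_commute:
  assumes "complex_cubic_form t"
  shows "t x y z = t y x z" "t x y z = t x z y" "t x y z = t z y x"
  using assms unfolding complex_cubic_form_def by metis+

lemma complex_cubic_form_linear:
  assumes "complex_cubic_form t"
  shows "linear (\<lambda>x. t x y z)" "linear (\<lambda>y. t x y z)" "linear (\<lambda>z. t x y z)"
  by (auto intro!: linearI simp: complex_cubic_form_simps[OF assms] scaleR_eq_smult scaleR_conv_of_real)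

text \<open>The vectors \<open>(\<i> *s x, 0)\<close> and \<open>cscale \<i> (x, 0)\<close> differ
  by an element of \<open>V01\<close>, which the form annihilates. So on real vectors the two
  multiplications by the imaginary unit agree.\<close>

lemma forms30_complex_cubic_form:
  assumes "F \<in> forms30"
  shows "complex_cubic_form (\<lambda>x y z. F (x, 0) (y, 0) (z, 0))"
proof -
  have add: "F (X + X') Y Z = F X Y Z + F X' Y Z" and scale: "F (cscale c X) Y Z = c * F X Y Z"
    and sym: "F X Y Z = F Y X Z" "F X Y Z = F X Z Y" and V01: "X \<in> V01 \<Longrightarrow> F X Y Z = 0" for X X' Y Z c
    using assms unfolding forms30_def mem_Collect_eq by blast+
  have J: "F (\<i> *s x, 0) Y Z = \<i> * F (x, 0) Y Z" for x Y Z
  proof -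
    define X where "X = (\<i> *s x, - x)"
    have "X \<in> V01" by (simp add: V01_def J_C_def cscale_def X_def vec_eq_iff)
    then have "F X Y Z = 0" by (rule V01)
    moreover have "(\<i> *s x, 0) = X + cscale \<i> (x, 0)" by (simp add: X_def cscale_def)
    ultimately show ?thesis by (simp add: add scale)
  qed
  have real: "F (a *\<^sub>R x, 0) Y Z = a * F (x, 0) Y Z" for a x Y Z
    using scale[of "complex_of_real a" "(x, 0)" Y Z] by (simp add: cscale_def)
  have plus: "F (x + x', 0) Y Z = F (x, 0) Y Z + F (x', 0) Y Z" for x x' Y Z
    using add[of "(x, 0)" "(x', 0)"] by simp
  have "F (c *s x, 0) Y Z = c * F (x, 0) Y Z" for c x Y Z
    unfolding smult_decompose[of c] plus real J
    by (simp add: complex_eq_iff)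
  then show ?thesis using plus sym unfolding complex_cubic_form_def by blast
qed

section \<open>Derivatives of holomorphic cubic polynomials\<close>

lemma has_derivative_cubic_polynomial:
  assumes "complex_cubic_form t"
  shows "((\<lambda>p. t p p p) has_derivative (\<lambda>u. 3 * t u p p)) (at p)"
proof -
  note lin = complex_cubic_form_linear[OF assms]
  have "((\<lambda>p. t p p p) has_derivative (\<lambda>u. t u p p + t p u p + t p p u)) (at p)"
  proof (rule has_derivative_bilinear_field[where B = t and B' = t and Y = "\<lambda>p. p" and Z = "\<lambda>p. p", OF open_UNIV])
    show "bilinear (t y)" for y using lin by (simp add: bilinear_def)
    show "((\<lambda>y. t y v w) has_derivative (\<lambda>u. t u v w)) (at p)" for v w
      by (rule linear_imp_has_derivative[OF lin(1)])
  qed simp_all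
  moreover have "t u p p + t p u p + t p p u = 3 * t u p p" for u
    using complex_cubic_form_commute(1)[OF assms, of p u p]
      complex_cubic_form_commute(3)[OF assms, of p p u] by simp
  ultimately show ?thesis by simp
qed

lemma has_derivative_quadratic_polynomial:
  assumes "complex_cubic_form t"
  shows "((\<lambda>p. t Z p p) has_derivative (\<lambda>u. 2 * t Z u p)) (at p)"
proof -
  note lin = complex_cubic_form_linear[OF assms]
  have "((\<lambda>p. t Z p p) has_derivative (\<lambda>u. t Z u p + t Z p u)) (at p)"
    by (rule has_derivative_linear_field[where A = "t Z", OF open_UNIV])
      (auto intro: lin linear_imp_has_derivative)
  moreover have "t Z u p + t Z p u = 2 * t Z u p" for u
    using complex_cubic_form_commute(2)[OF assms, of Z p u] by simp
  ultimately show ?thesis by simp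
qed

text \<open>For a complex linear differential the two terms of \<open>deriv10\<close> are equal, so
  its (1,0) part is the whole differential.\<close>

lemma deriv10_eq:
  assumes "(f has_derivative (\<lambda>u. c * \<phi> u)) (at p)" "\<And>u. \<phi> (\<i> *s u) = \<i> * \<phi> u"
  shows "deriv10 X f p = c * \<phi> X"
  unfolding deriv10_def frechet_derivative_at[OF assms(1), symmetric] by (simp add: assms(2) field_simps)

text \<open>Three differentiations of \<open>t p p p\<close> contribute 3! and adding the conjugate
  doubles the real part, whence 12.\<close>

lemma S_form_cubic_polynomial:
  assumes "complex_cubic_form t"
  shows "S_form (\<lambda>p. t p p p) p X Y Z = 12 * Re (t X Y Z)"
proof -
  note simps = complex_cubic_form_simps[OF assms]
  have 1: "deriv10 Z (\<lambda>p. t p p p) = (\<lambda>p. 3 * t Z p p)"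
    by (rule ext, rule deriv10_eq[OF has_derivative_cubic_polynomial[OF assms]]) (simp add: simps)
  have 2: "deriv10 Y (\<lambda>p. 3 * t Z p p) = (\<lambda>p. 6 * t Z Y p)"
  proof
    fix p
    have "((\<lambda>p. 3 * t Z p p) has_derivative (\<lambda>u. 6 * t Z u p)) (at p)"
      using has_derivative_mult_right[OF has_derivative_quadratic_polynomial[OF assms], of 3 Z p] by simp
    then show "deriv10 Y (\<lambda>p. 3 * t Z p p) p = 6 * t Z Y p"
      by (rule deriv10_eq) (simp add: simps)
  qed
  have "((\<lambda>p. 6 * t Z Y p) has_derivative (\<lambda>u. 6 * t Z Y u)) (at p)"
    using has_derivative_mult_right[OF linear_imp_has_derivative[OF complex_cubic_form_linear(3)[OF assms]]] .
  then have "deriv10 X (\<lambda>p. 6 * t Z Y p) p = 6 * t Z Y X"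
    by (rule deriv10_eq) (simp add: simps)
  then have "del3 (\<lambda>p. t p p p) p X Y Z = 6 * t X Y Z"
    using complex_cubic_form_commute(3)[OF assms, of Z Y X] by (simp add: del3_def 1 2)
  then show ?thesis by (simp add: S_form_def)
qed

lemma S_tensor_eqI:
  assumes "complex_cubic_form t" "\<And>Z. std_omega P U Z = 12 * Re (t X Y Z)"
  shows "S_tensor P (\<lambda>p. t p p p) p X Y = U"
  unfolding S_tensor_def S_form_cubic_polynomial[OF assms(1)]
proof (rule the_equality)
  show "\<forall>Z. std_omega P U Z = 12 * Re (t X Y Z)" using assms(2) by blast
next
  fix U' assume "\<forall>Z. std_omega P U' Z = 12 * Re (t X Y Z)"
  then show "U' = U" using assms(2) by (intro std_omega_eqI[of P]) simp
qed

text \<open>The description by \<open>THE\<close> in \<open>S_tensor\<close> denotes a vector: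
  nondegeneracy of \<open>std_omega\<close> gives uniqueness, and in finite dimension it also
  represents every linear functional.\<close>

lemma std_omega_S_tensor:
  assumes "complex_cubic_form t"
  shows "std_omega P (S_tensor P (\<lambda>p. t p p p) p X Y) Z = 12 * Re (t X Y Z)"
proof -
  have "linear (\<lambda>Z. 12 * Re (t X Y Z))"
    by (rule linearI) (simp_all add: complex_cubic_form_simps[OF assms] scaleR_eq_smult)
  then obtain U where U: "\<And>Z. std_omega P U Z = 12 * Re (t X Y Z)"
    using std_omega_represents[of _ P] by blast
  then show ?thesis using S_tensor_eqI[OF assms U] by simp
qed

text \<open>Elements of \<open>V01\<close> have the form \<open>(A, \<i> *s A)\<close>. Pairing with
  one of them factors through the projection \<open>fst X + \<i> *s snd X\<close> to
  \<open>V\<close>, where it becomes a complex linear functional given by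
  \<open>herm\<close>.\<close>

lemma omega_C_type_01:
  "omega_C P (A, \<i> *s A) X = - \<i> * herm P (fst X + \<i> *s snd X) A"
  by (simp add: omega_C_def herm_std_omega complex_eq_iff bilinear_simps[OF bilinear_std_omega]
      std_omega_i std_omega_skew[of P "fst X"] std_omega_skew[of P "snd X"]
      std_omega_skew[of P "\<i> *s fst X"] std_omega_skew[of P "\<i> *s snd X"])

lemma sub01_iff: "X \<in> sub01 W \<longleftrightarrow> fst X \<in> W \<and> snd X \<in> W \<and> snd X = \<i> *s fst X"
proof -
  have "J_C X = cscale (- \<i>) X \<longleftrightarrow> snd X = \<i> *s fst X"
    by (cases X) (auto simp: J_C_def cscale_def)
  then show ?thesis by (cases X) (auto simp: sub01_def V01_def)
qed

lemma isotropic_herm: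
  assumes "complex_isotropic P W" "u \<in> W" "v \<in> W"
  shows "herm P u v = 0"
  using assms by (simp add: complex_isotropic_def herm_std_omega Complex_eq_0)

text \<open>All factors of the symmetric products are functionals \<open>herm P _ w\<close> with
  \<open>w\<close> in \<open>W\<close>, up to a constant, and these vanish at \<open>x\<close>. This
  applies to elements of an isotropic \<open>W\<close> as well as to the values of
  \<open>S_tensor\<close>.\<close>

lemma S03_image_vanishes:
  assumes F: "F \<in> S03_image P W" and x: "\<And>w. w \<in> W \<Longrightarrow> herm P x w = 0"
  shows "F (x, 0) Y Z = 0"
proof -
  have 0: "omega_C P U (x, 0) = 0" if "U \<in> sub01 W" for U
  proof -
    have "U = (fst U, \<i> *s fst U)" "fst U \<in> W" using that by (auto simp: sub01_iff prod_eq_iff)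
    then show ?thesis using omega_C_type_01[of P "fst U" "(x, 0)"] x by simp
  qed
  obtain m c u v w where
    m: "\<And>i. i < (m::nat) \<Longrightarrow> u i \<in> sub01 W \<and> v i \<in> sub01 W \<and> w i \<in> sub01 W"
    and F: "F = (\<lambda>X Y Z. \<Sum>i<m. c i *
            sym_prod (omega_C P (u i)) (omega_C P (v i)) (omega_C P (w i)) X Y Z)"
    using F unfolding S03_image_def by blast
  show ?thesis unfolding F by (rule sum.neutral) (use m 0 in \<open>simp add: sym_prod_def\<close>)
qed

text \<open>The algebraic properties of \<open>S\<^sub>f\<close> which make \<open>D + S\<^sub>f\<close> a flat special connection.\<close>

locale cubic_tensor =
  fixes P :: "'n::finite set" and S :: "complex ^ 'n \<Rightarrow> complex ^ 'n \<Rightarrow> complex ^ 'n"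
  assumes bil: "bilinear S" and sym: "S X Y = S Y X"
    and omega: "std_omega P (S X Y) Z = std_omega P (S X Z) Y"
    and i_shift: "S X (\<i> *s Y) = S (\<i> *s X) Y"
    and commute: "S X (S Y Z) = S Y (S X Z)"
begin

lemmas S_simps = bilinear_simps[OF bil]

text \<open>By total symmetry of \<open>std_omega P (S X Y) Z\<close>, the rule
  \<open>i_shift\<close> moves \<open>\<i>\<close> from any argument to any other. Taking it from
  \<open>Z\<close> to the left entry of \<open>std_omega\<close> costs a sign.\<close>

lemma S_i: "S (\<i> *s X) Y = - (\<i> *s S X Y)"
proof (rule std_omega_eqI[of P])
  show "std_omega P (S (\<i> *s X) Y) Z = std_omega P (- (\<i> *s S X Y)) Z" for Z
  proof -
    have "std_omega P (S (\<i> *s X) Y) Z = std_omega P (S X (\<i> *s Z)) Y"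
      using omega[of "\<i> *s X" Y Z] by (simp add: i_shift)
    also have "\<dots> = std_omega P (- (\<i> *s S X Y)) Z"
      using omega[of X "\<i> *s Z" Y]
      by (simp add: std_omega_i bilinear_simps[OF bilinear_std_omega])
    finally show ?thesis .
  qed
qed

text \<open>\<open>S\<^sub>X\<close> and \<open>S\<^sub>Z\<close> commute, while \<open>S\<^sub>i\<^sub>X = - i S\<^sub>X\<close> and \<open>S\<^sub>X i = - i S\<^sub>X\<close> make them anticommute.\<close>

lemma S_S: "S X (S Z Y) = 0"
proof -
  have "S (\<i> *s X) (S Z Y) = S Z (S (\<i> *s X) Y)" by (rule commute)
  then have "- (\<i> *s S X (S Z Y)) = S Z (- (\<i> *s S X Y))" by (simp add: S_i)
  also have "\<dots> = \<i> *s S X (S Z Y)" by (simp add: S_simps i_shift S_i commute[of X])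
  finally show ?thesis by (simp add: vec_eq_iff)
qed

definition W :: "(complex ^ 'n) set" where "W = span (\<Union>X. range (S X))"

lemma S_in_W: "S X Y \<in> W"
  unfolding W_def by (rule span_base) blast

lemma W_i: "w \<in> W \<Longrightarrow> \<i> *s w \<in> W"
  unfolding W_def
proof (induction rule: span_induct_alt)
  case base
  then show ?case by (simp add: span_zero)
next
  case (step c x y)
  then obtain X Y where x: "x = S X Y" by blast
  have eq: "\<i> *s (c *\<^sub>R x + y) = (- c) *\<^sub>R S (\<i> *s X) Y + \<i> *s y"
    unfolding x S_i by (simp add: vec_eq_iff complex_eq_iff)
  have "(- c) *\<^sub>R S (\<i> *s X) Y \<in> span (\<Union>X. range (S X))"
    by (rule span_scale, rule span_base) blast
  then show ?case unfolding eq by (rule span_add) (use step in simp)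
qed

lemma complex_isotropic_W: "complex_isotropic P W"
  unfolding complex_isotropic_def
proof (intro conjI ballI)
  show "subspace W" by (simp add: W_def)
  show "\<i> *s w \<in> W" if "w \<in> W" for w using that by (rule W_i)
  fix u v assume u: "u \<in> W" and v: "v \<in> W"
  note lin = linear_bilinear_left[OF bilinear_std_omega] linear_bilinear_right[OF bilinear_std_omega]
  have 1: "std_omega P (S X Y) v = 0" for X Y
  proof (rule linear_eq_0_on_span[OF lin(2) _ v[unfolded W_def]])
    fix x assume "x \<in> (\<Union>X. range (S X))"
    then obtain Z U where "x = S Z U" by blast
    then show "std_omega P (S X Y) x = 0"
      using omega[of X Y "S Z U"] by (simp add: S_S bilinear_simps[OF bilinear_std_omega])
  qed
  show "std_omega P u v = 0"
    by (rule linear_eq_0_on_span[OF lin(1) _ u[unfolded W_def]]) (use 1 in auto)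
qed

text \<open>\<open>S\<close> is antilinear in both arguments and \<open>herm\<close> in its second
  one, so the expression is complex linear throughout. The factor \<open>- \<i>\<close> selects the
  imaginary part of \<open>herm\<close>, that is \<open>std_omega\<close>, and 1/12 cancels the
  constant of \<open>S_form_cubic_polynomial\<close>.\<close>

definition t :: "complex ^ 'n \<Rightarrow> complex ^ 'n \<Rightarrow> complex ^ 'n \<Rightarrow> complex" where
  "t x y z = - \<i> / 12 * herm P x (S y z)"

lemma Re_t: "12 * Re (t X Y Z) = std_omega P (S X Y) Z"
  using omega[of Y Z X] std_omega_skew[of P "S Y Z" X] by (simp add: t_def std_omega_herm sym[of Y X])

text \<open>The symmetry of \<open>std_omega P (S X Y) Z\<close> controls only the imaginary part of
  \<open>herm P x (S y z)\<close>. The real part follows by replacing \<open>x\<close> with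
  \<open>\<i> *s x\<close>.\<close>

lemma complex_cubic_form_t: "complex_cubic_form t"
proof -
  have C: "herm P x (S y z) = herm P y (S x z)" for x y z
  proof -
    have *: "Im (herm P x (S y z)) = Im (herm P y (S x z))" for x y z
      using omega[of z y x] std_omega_skew[of P "S z y" x] std_omega_skew[of P "S z x" y]
      by (simp add: std_omega_herm sym[of z])
    have "Re (herm P x (S y z)) = Im (herm P (\<i> *s x) (S y z))" by (simp add: herm_smult_left)
    also have "\<dots> = Im (herm P y (S (\<i> *s x) z))" by (rule *)
    also have "\<dots> = Re (herm P y (S x z))" by (simp add: S_i herm_smult_right herm_minus)
    finally show ?thesis using *[of x y z] by (simp add: complex_eq_iff)
  qed
  then show ?thesis
    unfolding complex_cubic_form_def t_def
    by (simp add: herm_add_left herm_smult_left algebra_simps) (metis sym)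
qed

text \<open>The projection of the complexification onto \<open>V\<close> along \<open>V01\<close>:
  it is the identity on vectors \<open>(x, 0)\<close> and turns \<open>cscale\<close> into
  multiplication by complex scalars. Hence \<open>F\<close> extends \<open>t\<close> to a form of
  type (3,0).\<close>

definition \<pi> :: "'n cvec \<Rightarrow> complex ^ 'n" where "\<pi> X = fst X + \<i> *s snd X"

definition F :: "'n cform3" where "F X Y Z = t (\<pi> X) (\<pi> Y) (\<pi> Z)"

lemma F_forms30: "F \<in> forms30"
proof -
  have "\<pi> (X + Y) = \<pi> X + \<pi> Y" for X Y by (simp add: \<pi>_def vec_eq_iff algebra_simps)
  moreover have "\<pi> (cscale c X) = c *s \<pi> X" for c X
    by (simp add: \<pi>_def cscale_def vec_eq_iff complex_eq_iff algebra_simps)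
  moreover have "\<pi> X = 0" if "X \<in> V01" for X
  proof -
    have "snd X = \<i> *s fst X" using that sub01_iff[of X UNIV] by (simp add: sub01_def)
    then show ?thesis by (simp add: \<pi>_def)
  qed
  moreover have "t 0 y z = 0" for y z
    using linear_0[OF complex_cubic_form_linear(1)[OF complex_cubic_form_t]] .
  moreover note complex_cubic_form_commute(1,2)[OF complex_cubic_form_t]
    complex_cubic_form_simps(1,4)[OF complex_cubic_form_t]
  ultimately show ?thesis
    unfolding forms30_def mem_Collect_eq F_def by (intro conjI allI ballI) metis+
qed

text \<open>
  A complex linear projection \<open>p\<close> onto \<open>W\<close> turns \<open>t\<close> into a cubic expression in the functionals
  \<open>herm P _ (p e\<^sub>i)\<close>, since the values of \<open>S\<close> lie in \<open>W\<close>.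
\<close>

lemma t_expansion:
  obtains p :: "'n \<Rightarrow> complex ^ 'n" where "\<And>i. p i \<in> W"
    "\<And>x y z. t x y z = (\<Sum>i\<in>UNIV. herm P x (p i) * t ((if i \<in> P then 1 else - 1) *s axis i 1) y z)"
proof -
  have subW: "subspace W" by (simp add: W_def)
  obtain q where q: "range q \<subseteq> W" "linear q" "\<And>v. v \<in> W \<Longrightarrow> q v = v"
    using linear_exists_right_inverse_on[OF linear_id subW] by auto
  \<comment> \<open>Averaging the real projection \<open>q\<close> over \<open>\<i>\<close> makes it
    complex linear; it remains a projection onto \<open>W\<close> because \<open>W\<close> is
    invariant under \<open>\<i>\<close>.\<close>
  define p where "p x = (1 / 2) *\<^sub>R (q x - \<i> *s q (\<i> *s x))" for x
  have pW: "p x \<in> W" for x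
    unfolding p_def using q(1) by (intro subspace_scale[OF subW] subspace_diff[OF subW] W_i) auto
  have pid: "p w = w" if "w \<in> W" for w
    using that W_i[OF that] by (simp add: p_def q(3) vec_eq_iff complex_eq_iff)
  have padd: "p (x + y) = p x + p y" for x y
    by (simp add: p_def vector_add_ldistrib linear_add[OF q(2)] algebra_simps)
  have preal: "p (c *\<^sub>R x) = c *\<^sub>R p x" for c x
  proof -
    have "\<i> *s (c *\<^sub>R x) = c *\<^sub>R (\<i> *s x)" for x :: "complex ^ 'n"
      by (simp add: vec_eq_iff complex_eq_iff)
    then show ?thesis by (simp add: p_def linear_scale[OF q(2)] scaleR_diff_right mult.commute)
  qed
  have pi: "p (\<i> *s x) = \<i> *s p x" for x
    by (simp add: p_def linear_neg[OF q(2)] vec_eq_iff complex_eq_iff)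
  have psmult: "p (c *s x) = c *s p x" for c x
    unfolding smult_decompose[of c] padd preal pi ..
  have lin: "linear p" by (rule linearI) (simp_all add: padd preal)
  have exp: "p s = (\<Sum>i\<in>UNIV. s $ i *s p (axis i 1))" for s
  proof -
    have "s = (\<Sum>i\<in>UNIV. s $ i *s axis i 1)" by (simp add: basis_expansion)
    then have "p s = p (\<Sum>i\<in>UNIV. s $ i *s axis i 1)" by simp
    then show ?thesis by (simp add: linear_sum[OF lin] psmult)
  qed
  have herm_sum: "herm P x (\<Sum>i\<in>UNIV. f i) = (\<Sum>i\<in>UNIV. herm P x (f i))" for x and f :: "'n \<Rightarrow> complex ^ 'n"
  proof -
    have "linear (herm P x)"
      by (rule linearI) (simp_all add: herm_add_right scaleR_eq_smult herm_smult_right scaleR_conv_of_real)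
    then show ?thesis by (rule linear_sum)
  qed
  \<comment> \<open>The conjugate coordinate of \<open>S y z\<close> is \<open>herm\<close> with a
    signed unit vector, so the coefficients are again values of \<open>t\<close> and the expansion
    can be repeated in the other arguments.\<close>
  have "t x y z = (\<Sum>i\<in>UNIV. herm P x (p (axis i 1)) *
      t ((if i \<in> P then 1 else - 1) *s axis i 1) y z)" for x y z
  proof -
    have "t x y z = - \<i> / 12 * herm P x (p (S y z))" by (simp add: t_def pid S_in_W)
    also have "\<dots> = (\<Sum>i\<in>UNIV. - \<i> / 12 * (cnj (S y z $ i) * herm P x (p (axis i 1))))"
      unfolding exp[of "S y z"] herm_sum by (simp add: herm_smult_right sum_distrib_left)
    also have "\<dots> = (\<Sum>i\<in>UNIV. herm P x (p (axis i 1)) *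
      t ((if i \<in> P then 1 else - 1) *s axis i 1) y z)"
      by (rule sum.cong) (auto simp: t_def herm_smult_left herm_axis)
    finally show ?thesis .
  qed
  then show ?thesis using that[of "\<lambda>i. p (axis i 1)"] pW by blast
qed

lemma F_S03_image: "F \<in> S03_image P W"
proof -
  obtain p :: "'n \<Rightarrow> complex ^ 'n" where pW: "\<And>i. p i \<in> W" and
    t: "\<And>x y z. t x y z = (\<Sum>i\<in>UNIV. herm P x (p i) * t ((if i \<in> P then 1 else - 1) *s axis i 1) y z)"
    using t_expansion by blast
  define e :: "'n \<Rightarrow> complex ^ 'n" where "e i = (if i \<in> P then 1 else - 1) *s axis i 1" for i
  note comm = complex_cubic_form_commute[OF complex_cubic_form_t]
  define u :: "'n \<Rightarrow> 'n cvec" where "u i = (p i, \<i> *s p i)" for i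
  have u: "u i \<in> sub01 W" for i by (simp add: u_def sub01_iff pW W_i)
  define \<omega> where "\<omega> i = omega_C P (u i)" for i
  have \<omega>: "herm P (\<pi> X) (p i) = \<i> * \<omega> i X" for i X
    by (simp add: \<omega>_def u_def omega_C_type_01 \<pi>_def)
  \<comment> \<open>Expanding in all three arguments produces one factor \<open>\<i>\<close> each,
    and \<open>- \<i>\<close> is their product.\<close>
  define c where "c i j k = - \<i> * t (e i) (e j) (e k)" for i j k
  have exp1: "t x y z = (\<Sum>i\<in>UNIV. herm P x (p i) * t (e i) y z)" for x y z
    unfolding e_def by (rule t)
  have exp2: "t x y z = (\<Sum>i\<in>UNIV. herm P y (p i) * t x (e i) z)" for x y z
    using exp1[of y x z] by (simp add: comm(1)[of y] comm(1)[of "e _" x])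
  have exp3: "t x y z = (\<Sum>i\<in>UNIV. herm P z (p i) * t x y (e i))" for x y z
    using exp1[of z y x] by (simp add: comm(3)[of z] comm(3)[of "e _" y x])
  have F3: "F X Y Z = (\<Sum>(i, j, k)\<in>UNIV. c i j k * (\<omega> i X * \<omega> j Y * \<omega> k Z))" for X Y Z
  proof -
    have "F X Y Z = (\<Sum>i\<in>UNIV. \<i> * \<omega> i X * (\<Sum>j\<in>UNIV. \<i> * \<omega> j Y * (\<Sum>k\<in>UNIV. \<i> * \<omega> k Z * t (e i) (e j) (e k))))"
      unfolding F_def \<omega>[symmetric] exp3[symmetric] exp2[symmetric] exp1[symmetric] ..
    also have "\<dots> = (\<Sum>i\<in>UNIV. \<Sum>j\<in>UNIV. \<Sum>k\<in>UNIV. c i j k * (\<omega> i X * \<omega> j Y * \<omega> k Z))"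
      by (simp add: sum_distrib_left c_def mult_ac)
    also have "\<dots> = (\<Sum>(i, j, k)\<in>UNIV \<times> UNIV \<times> UNIV. c i j k * (\<omega> i X * \<omega> j Y * \<omega> k Z))"
      by (simp add: sum.cartesian_product split_def)
    finally show ?thesis by (simp add: UNIV_Times_UNIV)
  qed
  have Fsym: "F X Y Z = F X Z Y" "F X Y Z = F Y X Z" "F X Y Z = F Y Z X" "F X Y Z = F Z X Y" "F X Y Z = F Z Y X"
    for X Y Z unfolding F_def using comm by metis+
  have F6: "F X Y Z = (\<Sum>(i, j, k)\<in>UNIV. c i j k / 6 * sym_prod (\<omega> i) (\<omega> j) (\<omega> k) X Y Z)" for X Y Z
  proof -
    \<comment> \<open>Averaging the triple expansion over the six permutations of the arguments
      turns plain products of functionals into \<open>sym_prod\<close>.\<close>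
    have "6 * F X Y Z = F X Y Z + F X Z Y + F Y X Z + F Z X Y + F Y Z X + F Z Y X"
      using Fsym[of X Y Z] by simp
    also have "\<dots> = (\<Sum>(i, j, k)\<in>UNIV. c i j k * sym_prod (\<omega> i) (\<omega> j) (\<omega> k) X Y Z)"
      unfolding F3 sum.distrib[symmetric] by (rule sum.cong) (auto simp: sym_prod_def algebra_simps)
    finally have "F X Y Z = (1 / 6) * (\<Sum>(i, j, k)\<in>UNIV. c i j k * sym_prod (\<omega> i) (\<omega> j) (\<omega> k) X Y Z)"
      by (simp add: mult.commute)
    then show ?thesis by (simp add: sum_distrib_left split_def)
  qed
  \<comment> \<open>\<open>S03_image\<close> indexes its sums by natural numbers, so the triples of
    indices are enumerated.\<close>
  obtain h where h: "bij_betw h {0..<card (UNIV :: ('n \<times> 'n \<times> 'n) set)} (UNIV :: ('n \<times> 'n \<times> 'n) set)"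
    using ex_bij_betw_nat_finite[of "UNIV :: ('n \<times> 'n \<times> 'n) set"] by auto
  have "F = (\<lambda>X Y Z. \<Sum>i<card (UNIV :: ('n \<times> 'n \<times> 'n) set). (case h i of (i, j, k) \<Rightarrow> c i j k / 6) *
      sym_prod (omega_C P (u (fst (h i)))) (omega_C P (u (fst (snd (h i))))) (omega_C P (u (snd (snd (h i))))) X Y Z)"
    unfolding F6 sum.reindex_bij_betw[OF h, symmetric] \<omega>_def
    by (intro ext) (simp add: split_def atLeast0LessThan)
  then show ?thesis
    unfolding S03_image_def mem_Collect_eq
    by (intro exI[of _ "card (UNIV :: ('n \<times> 'n \<times> 'n) set)"]
        exI[of _ "\<lambda>l. case h l of (i, j, k) \<Rightarrow> c i j k / 6"] exI[of _ "\<lambda>l. u (fst (h l))"]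
        exI[of _ "\<lambda>l. u (fst (snd (h l)))"] exI[of _ "\<lambda>l. u (snd (snd (h l)))"]
        conjI allI impI u)
qed

text \<open>The algebraic half of the local classification: the conditions of
  \<open>cubic_tensor\<close> suffice to recover a polynomial, with \<open>W\<close> spanned by the
  values of \<open>S\<close>.\<close>

lemma ex_cubic_polynomial:
  "\<exists>W f. complex_isotropic P W \<and> cubic_poly_in_S03 P W f \<and> (\<forall>p X Y. S_tensor P f p X Y = S X Y)"
proof (intro exI conjI allI)
  show "complex_isotropic P W" by (rule complex_isotropic_W)
  have eq: "cubic_poly_of_form F = (\<lambda>x. t x x x)"
    by (rule ext) (simp add: cubic_poly_of_form_def F_def \<pi>_def)
  show "cubic_poly_in_S03 P W (\<lambda>x. t x x x)"
    unfolding cubic_poly_in_S03_def using F_forms30 F_S03_image eq by (intro bexI[of _ F]) auto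
  show "S_tensor P (\<lambda>x. t x x x) p X Y = S X Y" for p X Y
    by (rule S_tensor_eqI[OF complex_cubic_form_t]) (simp add: Re_t)
qed

end

text \<open>Isotropy makes \<open>t\<close> vanish as soon as one argument lies in \<open>W\<close>.
  Hence the values of the tensor are orthogonal to \<open>W\<close>, and \<open>t\<close> vanishes
  on them too, so that any two of its operators compose to zero. Independence of \<open>p\<close>
  holds because the third derivative of a cubic is constant.\<close>

lemma cubic_tensor_S_tensor:
  assumes W: "complex_isotropic P W" and f: "cubic_poly_in_S03 P W f"
  shows "S_tensor P f p = S_tensor P f 0" "cubic_tensor P (S_tensor P f p)"
proof -
  obtain F where F: "F \<in> forms30" "F \<in> S03_image P W" "f = cubic_poly_of_form F"
    using f by (auto simp: cubic_poly_in_S03_def)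
  define t where "t x y z = F (x, 0) (y, 0) (z, 0)" for x y z
  have t: "complex_cubic_form t"
    unfolding t_def by (rule forms30_complex_cubic_form[OF F(1)])
  note tc = complex_cubic_form_commute[OF t] and ts = complex_cubic_form_simps[OF t]
  have feq: "f = (\<lambda>x. t x x x)" by (simp add: F(3) cubic_poly_of_form_def t_def fun_eq_iff)
  let ?S = "S_tensor P f"
  note om = std_omega_S_tensor[OF t, folded feq]
  show "?S p = ?S 0" by (intro ext std_omega_eqI[of P]) (simp add: om)
  have nil: "?S p X (?S p Y Z) = 0" for X Y Z
  proof (rule std_omega_eqI[of P])
    fix U
    \<comment> \<open>The two parts of \<open>herm\<close> are values of \<open>std_omega\<close> at
      \<open>w\<close> and at \<open>\<i> *s w\<close>; both vectors lie in
      \<open>W\<close>.\<close>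
    have "herm P (?S p Y Z) w = 0" if w: "w \<in> W" for w
    proof -
      have 0: "t Y Z w = 0" if "w \<in> W" for w
        using S03_image_vanishes[OF F(2) isotropic_herm[OF W that]] tc(3)[of Y Z w] by (simp add: t_def)
      have "\<i> *s w \<in> W" using W w by (simp add: complex_isotropic_def)
      then show ?thesis using 0[of w] 0[of "\<i> *s w"] w by (simp add: herm_std_omega om Complex_eq_0)
    qed
    from S03_image_vanishes[OF F(2) this]
    have "t X (?S p Y Z) U = 0" using tc(1)[of X] by (simp add: t_def)
    then show "std_omega P (?S p X (?S p Y Z)) U = std_omega P 0 U"
      by (simp add: om bilinear_simps[OF bilinear_std_omega])
  qed
  show "cubic_tensor P (?S p)"
  proof
    show "bilinear (?S p)"
      unfolding bilinear_def
      by (auto intro!: linearI std_omega_eqI[of P] simp: om bilinear_simps[OF bilinear_std_omega] ts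
          linear_scale[OF complex_cubic_form_linear(1)[OF t]] linear_scale[OF complex_cubic_form_linear(2)[OF t]]
          distrib_left)
    show "?S p X Y = ?S p Y X" for X Y by (rule std_omega_eqI[of P]) (simp add: om tc(1)[of X Y])
    show "std_omega P (?S p X Y) Z = std_omega P (?S p X Z) Y" for X Y Z by (simp add: om tc(2)[of X Y])
    show "?S p X (\<i> *s Y) = ?S p (\<i> *s X) Y" for X Y by (rule std_omega_eqI[of P]) (simp add: om ts)
    show "?S p X (?S p Y Z) = ?S p Y (?S p X Z)" for X Y Z by (simp add: nil)
  qed
qed

section \<open>The spaces associated with a cubic polynomial\<close>

lemma second_countable_euclidean: "second_countable (euclidean :: 'a::second_countable_topology topology)"
proof -
  obtain \<B> :: "'a set set" where \<B>: "countable \<B>" "\<And>C. C \<in> \<B> \<Longrightarrow> open C"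
    "\<And>S. open S \<Longrightarrow> \<exists>U. U \<subseteq> \<B> \<and> S = \<Union>U"
    using univ_second_countable by blast
  have "\<exists>V\<in>\<B>. x \<in> V \<and> V \<subseteq> U" if "open U" "x \<in> U" for U x
    using \<B>(3)[OF that(1)] that(2) by blast
  then show ?thesis unfolding second_countable_def using \<B> by auto
qed

section \<open>Connections with constant symbols on a vector space\<close>

lemma differential_bilinear:
  fixes B :: "'e::euclidean_space \<Rightarrow> 'e \<Rightarrow> 'f::euclidean_space"
  assumes "bilinear B" "smooth_on UNIV Y" "smooth_on UNIV Z"
  shows "differential (\<lambda>y. B (Y y) (Z y)) x u = B (differential Y x u) (Z x) + B (Y x) (differential Z x u)"
proof -
  have "((\<lambda>y. B (Y y) (Z y)) has_derivative
      (\<lambda>u. 0 + B (differential Y x u) (Z x) + B (Y x) (differential Z x u))) (at x)"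
    by (rule has_derivative_bilinear_field[where B = "\<lambda>_. B" and B' = "\<lambda>_ _ _. 0", OF open_UNIV UNIV_I assms(1)
          has_derivative_const smooth_on_has_derivative smooth_on_has_derivative])
      (use assms in auto)
  from frechet_derivative_at[OF this, symmetric] show ?thesis by simp
qed

text \<open>Second derivatives of \<open>Z\<close> cancel by symmetry and the bracket absorbs the
  derivatives of \<open>X\<close> and \<open>Y\<close>; what remains is the commutator of
  \<open>S\<close> at \<open>X x\<close> and \<open>Y x\<close>.\<close>

lemma curvature_constant_connection:
  fixes S :: "'e::euclidean_space \<Rightarrow> 'e \<Rightarrow> 'e"
  assumes S: "bilinear S" and comm: "\<And>X Y Z. S X (S Y Z) = S Y (S X Z)"
    and sm: "smooth_on UNIV X" "smooth_on UNIV Y" "smooth_on UNIV Z"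
  shows "curvature (\<lambda>_. S) X Y Z x = 0"
proof -
  let ?d2 = "\<lambda>u w. differential (\<lambda>y. differential Z y w) x u"
  note d = smooth_on_has_derivative[OF _ UNIV_I]
  have lin: "linear (differential Z y)" for y
    by (rule smooth_on_linear_frechet_derivative[OF sm(3) UNIV_I])
  have sym: "?d2 u w = ?d2 w u" for u w
    by (rule symmetric_second_derivative[OF open_UNIV UNIV_I d[OF sm(3)]
          d[OF smooth_on_frechet_derivative[OF sm(3)]]
          smooth_on_continuous[OF smooth_on_frechet_derivative[OF smooth_on_frechet_derivative[OF sm(3)]]]])
  have D: "differential (\<lambda>y. differential Z y (A y) + S (A y) (Z y)) x u
      = ?d2 u (A x) + differential Z x (differential A x u)
        + (S (differential A x u) (Z x) + S (A x) (differential Z x u))"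
    if A: "smooth_on UNIV A" for A u
  proof -
    have 1: "((\<lambda>y. differential Z y (A y)) has_derivative
        (\<lambda>u. ?d2 u (A x) + differential Z x (differential A x u))) (at x)"
      by (rule has_derivative_linear_field[where A = "differential Z", OF open_UNIV UNIV_I lin
            d[OF smooth_on_frechet_derivative[OF sm(3)]] d[OF A]])
    have 2: "((\<lambda>y. S (A y) (Z y)) has_derivative
        (\<lambda>u. 0 + S (differential A x u) (Z x) + S (A x) (differential Z x u))) (at x)"
      by (rule has_derivative_bilinear_field[where B = "\<lambda>_. S" and B' = "\<lambda>_ _ _. 0", OF open_UNIV UNIV_I S
            has_derivative_const d[OF A] d[OF sm(3)]])
    from frechet_derivative_at[OF has_derivative_add[OF 1 2], symmetric] show ?thesis by simp
  qed
  show ?thesis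
    unfolding curvature_def cov_def lie_def D[OF sm(1)] D[OF sm(2)]
    by (simp add: linear_diff[OF lin] linear_add[OF lin] bilinear_simps[OF S] sym[of "X x" "Y x"] comm[of "X x" "Y x"])
qed

text \<open>The acceleration is constant along a geodesic: the derivative of
  \<open>S (v t) (v t)\<close> is a multiple of \<open>S (S (v t) (v t)) (v t) = 0\<close>.\<close>

lemma complete_constant_connection:
  fixes M :: "('e::euclidean_space, 'e, 'z) geometry_scheme"
  assumes M: "mtop M = euclidean" "atlas M = {(UNIV, id)}" and \<Gamma>: "\<And>x. \<Gamma> (UNIV, id) x = S"
    and S: "bilinear S" and sym: "\<And>X Y. S X Y = S Y X" and nil: "\<And>X Y Z. S X (S Y Z) = 0"
  shows "complete_connection M \<Gamma>"
  unfolding complete_connection_def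
proof (intro allI impI, elim conjE)
  note simps = bilinear_simps[OF S]
  fix I \<gamma> assume I: "open I" "is_interval I" "I \<noteq> {}" and geo: "geodesic_on M \<Gamma> I \<gamma>"
  obtain v where v: "\<And>t. t \<in> I \<Longrightarrow> (\<gamma> has_vector_derivative v t) (at t)"
    "\<And>t. t \<in> I \<Longrightarrow> (v has_vector_derivative - S (v t) (v t)) (at t)"
    using geo by (auto simp: geodesic_on_def M \<Gamma>)
  obtain t0 where t0: "t0 \<in> I" using I by blast
  have const: "f t = f t0" if "\<And>t. t \<in> I \<Longrightarrow> (f has_vector_derivative 0) (at t)" "t \<in> I" for f :: "real \<Rightarrow> 'e" and t
  proof -
    have "(f has_derivative (\<lambda>_. 0)) (at t within I)" if "t \<in> I" for t
      using \<open>\<And>t. t \<in> I \<Longrightarrow> (f has_vector_derivative 0) (at t)\<close>[OF that]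
      by (simp add: has_vector_derivative_def has_derivative_at_withinI)
    from has_derivative_zero_constant[OF is_interval_convex[OF I(2)] this]
    show ?thesis using that(2) t0 by metis
  qed
  define a where "a = S (v t0) (v t0)"
  have a: "S (v t) (v t) = a" if "t \<in> I" for t
    unfolding a_def
  proof (rule const[OF _ that])
    fix t assume t: "t \<in> I"
    have "((\<lambda>t. S (v t) (v t)) has_derivative
      (\<lambda>h. 0 + S (h *\<^sub>R - S (v t) (v t)) (v t) + S (v t) (h *\<^sub>R - S (v t) (v t)))) (at t)"
      by (rule has_derivative_bilinear_field[where B = "\<lambda>_. S" and B' = "\<lambda>_ _ _. 0", OF open_UNIV UNIV_I S has_derivative_const])
        (use v(2)[OF t] in \<open>simp_all add: has_vector_derivative_def\<close>)
    then show "((\<lambda>t. S (v t) (v t)) has_vector_derivative 0) (at t)"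
      by (simp add: has_vector_derivative_def simps nil sym[of "S _ _"])
  qed
  have v_eq: "v t = v t0 - (t - t0) *\<^sub>R a" if "t \<in> I" for t
  proof -
    have "v t + (t - t0) *\<^sub>R a = v t0 + (t0 - t0) *\<^sub>R a"
    proof (rule const[OF _ that])
      fix t assume t: "t \<in> I"
      show "((\<lambda>t. v t + (t - t0) *\<^sub>R a) has_vector_derivative 0) (at t)"
        by (rule has_vector_derivative_eq_rhs, rule has_vector_derivative_add, rule v(2)[OF t])
          (auto intro!: derivative_eq_intros simp: a[OF t])
    qed
    then show ?thesis by (simp add: algebra_simps)
  qed
  define w where "w t = v t0 - (t - t0) *\<^sub>R a" for t
  define \<gamma>' where "\<gamma>' t = \<gamma> t0 + (t - t0) *\<^sub>R v t0 - ((t - t0)\<^sup>2 / 2) *\<^sub>R a" for t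
  have d\<gamma>': "(\<gamma>' has_vector_derivative w t) (at t)" for t
    unfolding \<gamma>'_def w_def by (auto intro!: derivative_eq_intros)
  \<comment> \<open>The same nilpotency shows that the affine velocity \<open>w\<close> solves the
    geodesic equation at all times, also outside \<open>I\<close>.\<close>
  have Sw: "S (w t) (w t) = a" for t
    by (simp add: w_def simps a_def nil sym[of "S _ _"])
  have dw: "(w has_vector_derivative - S (w t) (w t)) (at t)" for t
    unfolding Sw unfolding w_def by (auto intro!: derivative_eq_intros)
  have "\<gamma>' t = \<gamma> t" if "t \<in> I" for t
  proof -
    have "\<gamma> t - \<gamma>' t = \<gamma> t0 - \<gamma>' t0"
    proof (rule const[OF _ that])
      fix t assume t: "t \<in> I"
      show "((\<lambda>t. \<gamma> t - \<gamma>' t) has_vector_derivative 0) (at t)"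
        using has_vector_derivative_diff[OF v(1)[OF t] d\<gamma>'[of t]] by (simp add: v_eq[OF t] w_def)
    qed
    then show ?thesis by (simp add: \<gamma>'_def)
  qed
  moreover have "geodesic_on M \<Gamma> UNIV \<gamma>'"
  proof -
    have "continuous_on UNIV \<gamma>'"
      by (rule continuous_on_vector_derivative[OF has_vector_derivative_at_within[OF d\<gamma>']])
    then show ?thesis
      unfolding geodesic_on_def M using d\<gamma>' dw by (auto simp: \<Gamma> intro!: exI[of _ w])
  qed
  ultimately show "\<exists>\<gamma>'. geodesic_on M \<Gamma> UNIV \<gamma>' \<and> (\<forall>t\<in>I. \<gamma>' t = \<gamma> t)" by blast
qed

lemma differential_i_smult:
  assumes "smooth_on UNIV Y"
  shows "differential (\<lambda>y. \<i> *s Y y) x u = \<i> *s differential Y x u"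
proof -
  have "((\<lambda>y. \<i> *s Y y) has_derivative (\<lambda>u. \<i> *s differential Y x u)) (at x)"
    by (rule has_derivative_compose[OF smooth_on_has_derivative[OF assms UNIV_I]
          linear_imp_has_derivative[OF linear_i_smult]])
  from frechet_derivative_at[OF this, symmetric] show ?thesis by simp
qed

section \<open>Verification of the conditions for \<open>V_space P f\<close>\<close>

lemma diffeo_on_id: "diffeo_on UNIV (id :: 'e::euclidean_space \<Rightarrow> 'e)"
  by (rule diffeo_on_linear[OF linear_id]) simp

lemma chart_image_id: "chart_image (UNIV, id) = UNIV"
  by (simp add: chart_image_def)

lemma coord_id: "coord_dom (UNIV, id) (UNIV, id) UNIV id = UNIV"
  "coord_rep (UNIV, id) (UNIV, id) id = (id :: 'e \<Rightarrow> 'e)"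
  by (auto simp: coord_dom_def coord_rep_def fun_eq_iff inv_id[unfolded id_def] id_def)

lemma bilinear_zero: "bilinear (\<lambda>_ _. 0)"
  by (simp add: bilinear_def linear_zero)

context
  fixes P :: "'n::finite set" and W and f
  assumes W: "complex_isotropic P W" and f: "cubic_poly_in_S03 P W f"
begin

interpretation cubic_tensor P "S_tensor P f 0"
  by (rule cubic_tensor_S_tensor(2)[OF W f])

lemma V_space_simps:
  "mtop (V_space P f) = euclidean" "atlas (V_space P f) = {(UNIV, id)}"
  "metr (V_space P f) c x = std_metric P" "cplx (V_space P f) c x u = \<i> *s u"
  "conn (V_space P f) c x = S_tensor P f 0"
  "kaehler_form (V_space P f) c x = std_omega P"
  using cubic_tensor_S_tensor(1)[OF W f, of x]
  by (auto simp: V_space_def D_std_def kaehler_form_def std_omega_def fun_eq_iff)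

text \<open>Like the next two lemmas, stated for any connection with constant symbols
  \<open>B\<close>, in order to serve both \<open>D_std\<close>, where \<open>B\<close> is zero, and
  \<open>conn (V_space P f)\<close>.\<close>

lemma V_space_is_connection:
  assumes "\<And>x. \<Gamma> (UNIV, id) x = (B :: complex ^ 'n \<Rightarrow> _)" "bilinear B"
  shows "is_connection (V_space P f) \<Gamma>"
  using assms by (simp add: is_connection_def V_space_simps chart_image_id coord_id preserves_connection_def)

lemma V_space_torsion_free:
  assumes "\<And>x. \<Gamma> (UNIV, id) x = (B :: complex ^ 'n \<Rightarrow> _)" "\<And>X Y. B X Y = B Y X"
  shows "torsion_free (V_space P f) \<Gamma>"
  using assms by (simp add: torsion_free_def V_space_simps cov_def lie_def)

lemma V_space_flat_connection:
  assumes "\<And>x. \<Gamma> (UNIV, id) x = (B :: complex ^ 'n \<Rightarrow> _)" "bilinear B" "\<And>X Y Z. B X (B Y Z) = B Y (B X Z)"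
  shows "flat_connection (V_space P f) \<Gamma>"
proof -
  have "\<Gamma> (UNIV, id) = (\<lambda>_. B)" using assms(1) by (rule ext)
  then show ?thesis
    using curvature_constant_connection[OF assms(2,3)]
    by (simp add: flat_connection_def V_space_simps chart_image_id)
qed

lemma V_space_kaehler_manifold: "kaehler_manifold (V_space P f) D_std"
proof -
  have D: "D_std (UNIV, id) x = (\<lambda>_ _. 0 :: complex ^ 'n)" for x
    by (simp add: D_std_def fun_eq_iff)
  have "smooth_manifold (V_space P f)"
    by (simp add: smooth_manifold_def V_space_simps chart_image_id coord_id second_countable_euclidean diffeo_on_id)
  moreover have "pseudo_metric (V_space P f)"
    using std_metric_nondegenerate[of P]
    by (auto simp: pseudo_metric_def V_space_simps chart_image_id coord_id preserves_metric_def
        bilinear_std_metric std_metric_sym[of P])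
  moreover have "complex_structure (V_space P f)"
    unfolding complex_structure_def V_space_simps
    by (auto simp: chart_image_id coord_id preserves_endo_def linear_i_smult diffeo_on_id
        intro!: exI[of _ UNIV] exI[of _ id])
  moreover have "levi_civita (V_space P f) D_std"
    unfolding levi_civita_def
  proof (intro conjI)
    show "is_connection (V_space P f) D_std" by (rule V_space_is_connection[where \<Gamma> = D_std, OF D bilinear_zero])
    show "torsion_free (V_space P f) D_std" by (rule V_space_torsion_free[where \<Gamma> = D_std, OF D]) simp
    show "parallel_form (V_space P f) D_std (metr (V_space P f))"
      by (simp add: parallel_form_def V_space_simps chart_image_id cov_form_def cov_def D
          differential_bilinear[OF bilinear_std_metric])
  qed
  moreover have "parallel_endo (V_space P f) D_std (cplx (V_space P f))"
    by (simp add: parallel_endo_def V_space_simps chart_image_id cov_endo_def cov_def D differential_i_smult)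
  moreover have "\<forall>c\<in>atlas (V_space P f). \<forall>x\<in>chart_image c. \<forall>u v.
        metr (V_space P f) c x (cplx (V_space P f) c x u) (cplx (V_space P f) c x v) = metr (V_space P f) c x u v"
    by (simp add: V_space_simps std_metric_i)
  ultimately show ?thesis by (simp add: kaehler_manifold_def)
qed

lemma V_space_flat_special_kaehler:
  "flat_special_kaehler_manifold (V_space P f) D_std"
  "constant_cubic_form (V_space P f) D_std"
  "complete_connection (V_space P f) D_std"
  "complete_connection (V_space P f) (conn (V_space P f))"
proof -
  have D: "D_std (UNIV, id) x = (\<lambda>_ _. 0 :: complex ^ 'n)" for x
    by (simp add: D_std_def fun_eq_iff)
  let ?M = "V_space P f"
  note C = V_space_simps(5)[of "(UNIV, id)"]
  have key: "std_omega P Y (S_tensor P f 0 X Z) = - std_omega P (S_tensor P f 0 X Y) Z" for X Y Z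
    using omega[of X Z Y] std_omega_skew[of P Y] by simp
  have *: "parallel_form ?M (conn ?M) (kaehler_form ?M)"
    by (simp add: key parallel_form_def V_space_simps chart_image_id cov_form_def cov_def
        differential_bilinear[OF bilinear_std_omega] bilinear_simps[OF bilinear_std_omega])
  \<comment> \<open>Antilinearity of the tensor in each argument gives the value \<open>- 2\<close>
    times \<open>\<i> *s S_tensor P f 0 (X x) (Y x)\<close>, which is symmetric in \<open>X\<close>
    and \<open>Y\<close>.\<close>
  have endo: "cov_endo (conn ?M c) X (cplx ?M c) Y x =
      - (\<i> *s S_tensor P f 0 (X x) (Y x)) - \<i> *s S_tensor P f 0 (X x) (Y x)"
    if "smooth_on UNIV Y" for c X Y x
    by (simp add: that V_space_simps cov_endo_def cov_def differential_i_smult vector_add_ldistrib i_shift S_i)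
  have "\<forall>c\<in>atlas ?M. \<forall>X Y. smooth_on (chart_image c) X \<longrightarrow> smooth_on (chart_image c) Y \<longrightarrow>
        (\<forall>x\<in>chart_image c.
           cov_endo (conn ?M c) X (cplx ?M c) Y x = cov_endo (conn ?M c) Y (cplx ?M c) X x)"
    by (simp add: endo V_space_simps(2) chart_image_id) (simp add: sym)
  with * show "flat_special_kaehler_manifold ?M D_std"
    unfolding flat_special_kaehler_manifold_def special_kaehler_manifold_def
    using V_space_kaehler_manifold V_space_is_connection[where \<Gamma> = "conn (V_space P f)", OF C bil] V_space_torsion_free[where \<Gamma> = "conn (V_space P f)", OF C sym]
      V_space_flat_connection[where \<Gamma> = "conn (V_space P f)", OF C bil commute] V_space_flat_connection[where \<Gamma> = D_std, OF D bilinear_zero]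
    by simp
  show "constant_cubic_form ?M D_std"
    by (simp add: constant_cubic_form_def parallel_tensor12_def V_space_simps chart_image_id
        cov_tensor12_def cov_def D differential_bilinear[OF bil])
  show "complete_connection ?M D_std"
    by (rule complete_constant_connection[where \<Gamma> = D_std, OF V_space_simps(1,2) D bilinear_zero]) simp_all
  show "complete_connection ?M (conn ?M)"
    by (rule complete_constant_connection[where \<Gamma> = "conn ?M", OF V_space_simps(1,2) C bil sym S_S])
qed

end

section \<open>Flat special Kaehler structures in a chart\<close>

text \<open>The conditions on the manifold in one chart, tested on constant coordinate fields, which
  turns them into pointwise identities. \<open>\<Gamma>\<close> holds the symbols of the Levi-Civita
  connection and \<open>\<Gamma>'\<close> those of the flat special connection.\<close>

locale flat_special_chart =
  fixes S :: "(complex ^ 'n::finite) set" and g :: "complex ^ 'n \<Rightarrow> complex ^ 'n \<Rightarrow> complex ^ 'n \<Rightarrow> real"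
    and J :: "complex ^ 'n \<Rightarrow> complex ^ 'n \<Rightarrow> complex ^ 'n"
    and \<Gamma> \<Gamma>' :: "complex ^ 'n \<Rightarrow> complex ^ 'n \<Rightarrow> complex ^ 'n \<Rightarrow> complex ^ 'n"
  assumes S: "open S"
    and \<Gamma>_smooth: "smooth_on S (\<lambda>x. \<Gamma> x u v)" and \<Gamma>_bilinear: "x \<in> S \<Longrightarrow> bilinear (\<Gamma> x)"
    and \<Gamma>'_smooth: "smooth_on S (\<lambda>x. \<Gamma>' x u v)" and \<Gamma>'_bilinear: "x \<in> S \<Longrightarrow> bilinear (\<Gamma>' x)"
    and g_smooth: "smooth_on S (\<lambda>x. g x u v)" and J_smooth: "smooth_on S (\<lambda>x. J x u)"
    and hermitian: "x \<in> S \<Longrightarrow> hermitian_space (g x) (J x)"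
    and \<Gamma>_sym: "x \<in> S \<Longrightarrow> \<Gamma> x u v = \<Gamma> x v u" and \<Gamma>'_sym: "x \<in> S \<Longrightarrow> \<Gamma>' x u v = \<Gamma>' x v u"
    and \<Gamma>_flat: "x \<in> S \<Longrightarrow> differential (\<lambda>y. \<Gamma> y w v) x u + \<Gamma> x u (\<Gamma> x w v)
      = differential (\<lambda>y. \<Gamma> y u v) x w + \<Gamma> x w (\<Gamma> x u v)"
    and \<Gamma>'_flat: "x \<in> S \<Longrightarrow> differential (\<lambda>y. \<Gamma>' y w v) x u + \<Gamma>' x u (\<Gamma>' x w v)
      = differential (\<lambda>y. \<Gamma>' y u v) x w + \<Gamma>' x w (\<Gamma>' x u v)"
    and g_parallel: "x \<in> S \<Longrightarrow> differential (\<lambda>y. g y u v) x w = g x (\<Gamma> x w u) v + g x u (\<Gamma> x w v)"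
    and J_parallel: "x \<in> S \<Longrightarrow> differential (\<lambda>y. J y u) x w = J x (\<Gamma> x w u) - \<Gamma> x w (J x u)"
    and S_parallel: "x \<in> S \<Longrightarrow> differential (\<lambda>y. \<Gamma>' y u v - \<Gamma> y u v) x w =
      (\<Gamma>' x (\<Gamma> x w u) v - \<Gamma> x (\<Gamma> x w u) v) + (\<Gamma>' x u (\<Gamma> x w v) - \<Gamma> x u (\<Gamma> x w v))
      - \<Gamma> x w (\<Gamma>' x u v - \<Gamma> x u v)"
    and omega_parallel: "x \<in> S \<Longrightarrow> differential (\<lambda>y. g y (J y u) v) x w =
      g x (J x (\<Gamma>' x w u)) v + g x (J x u) (\<Gamma>' x w v)"
    and special: "x \<in> S \<Longrightarrow> differential (\<lambda>y. J y v) x u + \<Gamma>' x u (J x v) - J x (\<Gamma>' x u v) =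
      differential (\<lambda>y. J y u) x v + \<Gamma>' x v (J x u) - J x (\<Gamma>' x v u)"
begin

section \<open>The difference tensor of the two connections\<close>

definition T :: "complex ^ 'n \<Rightarrow> complex ^ 'n \<Rightarrow> complex ^ 'n \<Rightarrow> complex ^ 'n" where
  "T x u v = \<Gamma>' x u v - \<Gamma> x u v"

lemma linear_J: "x \<in> S \<Longrightarrow> linear (J x)"
  using hermitian by (simp add: hermitian_space_def)

lemma bilinear_g: "x \<in> S \<Longrightarrow> bilinear (g x)"
  using hermitian by (simp add: hermitian_space_def)

lemma bilinear_T: "x \<in> S \<Longrightarrow> bilinear (T x)"
  unfolding bilinear_def T_def using \<Gamma>_bilinear \<Gamma>'_bilinear
  by (auto simp: bilinear_def intro: linear_compose_sub)

lemma T_smooth: "smooth_on S (\<lambda>x. T x u v)"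
  unfolding T_def by (intro smooth_on_diff S \<Gamma>_smooth \<Gamma>'_smooth)

lemmas \<Gamma>_simps = bilinear_simps[OF \<Gamma>_bilinear]
lemmas T_simps = bilinear_simps[OF bilinear_T]
lemmas g_simps = bilinear_simps[OF bilinear_g]

lemma T_sym: "x \<in> S \<Longrightarrow> T x u v = T x v u"
  unfolding T_def using \<Gamma>_sym \<Gamma>'_sym by metis

lemma T_parallel: "x \<in> S \<Longrightarrow> differential (\<lambda>y. T y u v) x w =
    T x (\<Gamma> x w u) v + T x u (\<Gamma> x w v) - \<Gamma> x w (T x u v)"
  unfolding T_def by (rule S_parallel)

lemma g_has_derivative: "x \<in> S \<Longrightarrow>
    ((\<lambda>y. g y u v) has_derivative (\<lambda>w. g x (\<Gamma> x w u) v + g x u (\<Gamma> x w v))) (at x)"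
  by (rule has_derivative_eq_rhs, rule smooth_on_has_derivative[OF g_smooth], assumption, rule ext,
      erule g_parallel)

lemma J_has_derivative: "x \<in> S \<Longrightarrow>
    ((\<lambda>y. J y u) has_derivative (\<lambda>w. J x (\<Gamma> x w u) - \<Gamma> x w (J x u))) (at x)"
  by (rule has_derivative_eq_rhs, rule smooth_on_has_derivative[OF J_smooth], assumption, rule ext,
      erule J_parallel)

lemma T_has_derivative: "x \<in> S \<Longrightarrow> ((\<lambda>y. T y u v) has_derivative
    (\<lambda>w. T x (\<Gamma> x w u) v + T x u (\<Gamma> x w v) - \<Gamma> x w (T x u v))) (at x)"
  by (rule has_derivative_eq_rhs, rule smooth_on_has_derivative[OF T_smooth], assumption, rule ext,
      erule T_parallel)

text \<open>The Kaehler form is parallel for both connections, for the first one because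
  \<open>g\<close> and \<open>J\<close> are. Hence the difference acts by skew
  endomorphisms.\<close>

lemma T_omega:
  assumes x: "x \<in> S"
  shows "g x (J x (T x w u)) v = - g x (J x u) (T x w v)"
proof -
  have "((\<lambda>y. g y (J y u) v) has_derivative
     (\<lambda>w. (g x (\<Gamma> x w (J x u)) v + g x (J x u) (\<Gamma> x w v))
       + g x (J x (\<Gamma> x w u) - \<Gamma> x w (J x u)) v + g x (J x u) 0)) (at x)"
    by (rule has_derivative_bilinear_field[where B = g and Y = "\<lambda>y. J y u" and Z = "\<lambda>_. v"
          and B' = "\<lambda>w u v. g x (\<Gamma> x w u) v + g x u (\<Gamma> x w v)",
          OF S x bilinear_g g_has_derivative[OF x] J_has_derivative[OF x] has_derivative_const])
  from frechet_derivative_at[OF this, symmetric, THEN fun_cong, of w] omega_parallel[OF x, of u v w]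
  show ?thesis
    using x by (simp add: T_def linear_diff[OF linear_J[OF x]] g_simps)
qed

text \<open>Since \<open>J\<close> is parallel for \<open>\<Gamma>\<close>, its covariant derivative
  for \<open>\<Gamma>'\<close> is the commutator of \<open>T\<close> and \<open>J\<close>. In the
  special condition the terms \<open>J x (T x u v)\<close> cancel by symmetry of
  \<open>T\<close>.\<close>

lemma T_special:
  assumes x: "x \<in> S"
  shows "T x u (J x v) = T x (J x u) v"
proof -
  have "T x u (J x v) - J x (T x u v) = T x v (J x u) - J x (T x v u)"
    using special[OF x, of v u]
    unfolding J_parallel[OF x] by (simp add: T_def linear_diff[OF linear_J[OF x]] algebra_simps)
  then show ?thesis using T_sym[OF x] by simp
qed

text \<open>In the difference of the two curvatures the derivative of \<open>T\<close> is rewritten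
  by parallelism; all terms mixing \<open>\<Gamma>\<close> and \<open>T\<close> then cancel by
  symmetry of \<open>\<Gamma>\<close>.\<close>

lemma T_commute:
  assumes x: "x \<in> S"
  shows "T x u (T x w v) = T x w (T x u v)"
proof -
  have D: "differential (\<lambda>y. \<Gamma>' y w v) x u = differential (\<lambda>y. \<Gamma> y w v) x u +
      (T x (\<Gamma> x u w) v + T x w (\<Gamma> x u v) - \<Gamma> x u (T x w v))" for u v w
  proof -
    have "((\<lambda>y. \<Gamma> y w v + T y w v) has_derivative (\<lambda>u. differential (\<lambda>y. \<Gamma> y w v) x u +
      (T x (\<Gamma> x u w) v + T x w (\<Gamma> x u v) - \<Gamma> x u (T x w v)))) (at x)"
      by (rule has_derivative_add[OF smooth_on_has_derivative[OF \<Gamma>_smooth x] T_has_derivative[OF x]])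
    from frechet_derivative_at[OF this, symmetric, THEN fun_cong, of u] show ?thesis by (simp add: T_def)
  qed
  have \<Gamma>': "\<Gamma>' x u v = \<Gamma> x u v + T x u v" for u v by (simp add: T_def)
  have "(differential (\<lambda>y. \<Gamma> y w v) x u + \<Gamma> x u (\<Gamma> x w v)) + T x u (T x w v)
      = (differential (\<lambda>y. \<Gamma> y u v) x w + \<Gamma> x w (\<Gamma> x u v)) + T x w (T x u v)"
    using \<Gamma>'_flat[OF x, of w v u] x unfolding D \<Gamma>' \<Gamma>_sym[OF x, of w u]
    by (simp add: \<Gamma>_simps T_simps algebra_simps)
  then show ?thesis unfolding \<Gamma>_flat[OF x, of w v u] by simp
qed

text \<open>\<open>N\<close> is an isomorphism from the standard space with the product
  \<open>\<sigma>\<close> to the tangent space at \<open>x\<close>. An arbitrary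
  \<open>\<sigma>\<close> is allowed, so that all candidate models can be compared at once.\<close>

definition adapted ::
  "'n set \<Rightarrow> (complex ^ 'n \<Rightarrow> complex ^ 'n \<Rightarrow> complex ^ 'n) \<Rightarrow> complex ^ 'n \<Rightarrow> (complex ^ 'n \<Rightarrow> complex ^ 'n) \<Rightarrow> bool" where
  "adapted P \<sigma> x N \<longleftrightarrow> linear N \<and> bij N \<and> (\<forall>p q. g x (N p) (N q) = std_metric P p q) \<and>
     (\<forall>p. J x (N p) = N (\<i> *s p)) \<and> (\<forall>p q. T x (N p) (N q) = N (\<sigma> p q))"

text \<open>A unitary frame carries \<open>T x\<close> to the standard space, where the identities
  for \<open>T\<close> become the axioms of \<open>cubic_tensor\<close> and yield the
  polynomial.\<close>

lemma ex_adapted: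
  assumes x: "x \<in> S"
  shows "\<exists>P W f. complex_isotropic P W \<and> cubic_poly_in_S03 P W f \<and> (\<exists>N. adapted P (S_tensor P f 0) x N)"
proof -
  interpret hermitian_space "g x" "J x" by (rule hermitian[OF x])
  obtain P :: "'n set" and N where N: "linear N" "bij N" "\<And>a b. g x (N a) (N b) = std_metric P a b"
    "\<And>a. N (\<i> *s a) = J x (N a)"
    using ex_unitary_frame by blast
  define E where "E = inv N"
  have EN: "E (N a) = a" and NE: "N (E a) = a" for a
    using N(2) by (simp_all add: E_def bij_def surj_f_inv_f)
  have linE: "linear E"
    unfolding E_def by (rule inj_linear_imp_inv_linear) (use N in \<open>auto simp: bij_def\<close>)
  have Ei: "E (J x a) = \<i> *s E a" for a by (metis EN NE N(4))
  have om: "std_omega P a b = g x (J x (N a)) (N b)" for a b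
    by (simp add: std_omega_def N flip: N(3))
  have "cubic_tensor P (\<lambda>a b. E (T x (N a) (N b)))"
  proof
    show "bilinear (\<lambda>a b. E (T x (N a) (N b)))"
      unfolding bilinear_def
      by (auto intro!: linearI simp: linear_add[OF N(1)] linear_scale[OF N(1)] T_simps[OF x]
          linear_add[OF linE] linear_scale[OF linE])
    show "E (T x (N X) (N Y)) = E (T x (N Y) (N X))" for X Y using T_sym[OF x] by simp
    show "E (T x (N X) (N (E (T x (N Y) (N Z))))) = E (T x (N Y) (N (E (T x (N X) (N Z)))))" for X Y Z
      unfolding NE using T_commute[OF x] by simp
    show "E (T x (N X) (N (\<i> *s Y))) = E (T x (N (\<i> *s X)) (N Y))" for X Y
      by (simp add: N(4) T_special[OF x])
    show "std_omega P (E (T x (N X) (N Y))) Z = std_omega P (E (T x (N X) (N Z))) Y" for X Y Z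
      using T_omega[OF x, of "N X" "N Y" "N Z"] J_skew[of "T x (N X) (N Z)" "N Y"] sym[of "J x (N Y)"]
      by (simp add: om NE)
  qed
  from cubic_tensor.ex_cubic_polynomial[OF this] obtain W f where
    Wf: "complex_isotropic P W" "cubic_poly_in_S03 P W f" "\<And>X Y. S_tensor P f 0 X Y = E (T x (N X) (N Y))"
    by blast
  have "adapted P (S_tensor P f 0) x N"
    using N by (simp add: adapted_def Wf(3) NE)
  then show ?thesis using Wf by blast
qed

text \<open>The parallel frame carries \<open>g\<close>, \<open>J\<close> and \<open>T\<close> from
  \<open>a\<close> to each nearby point, so adapted frames exist at all of these points or at none.
  The flat chart followed by the inverse of an adapted frame at \<open>a\<close> maps to the model.
  \<open>U\<close> is chosen before \<open>P\<close> and \<open>\<sigma>\<close>.\<close>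

lemma flat_adapted_coordinates:
  assumes a: "a \<in> S"
  shows "\<exists>U. open U \<and> a \<in> U \<and> U \<subseteq> S \<and>
     (\<forall>P \<sigma>. \<forall>y\<in>U. (\<exists>N. adapted P \<sigma> y N) \<longleftrightarrow> (\<exists>N. adapted P \<sigma> a N)) \<and>
     (\<forall>P \<sigma>. (\<exists>N. adapted P \<sigma> a N) \<longrightarrow> (\<exists>H. diffeo_on U H \<and>
       preserves_metric U H g (\<lambda>_. std_metric P) \<and> preserves_endo U H J (\<lambda>_ u. \<i> *s u) \<and>
       preserves_connection U H \<Gamma>' (\<lambda>_. \<sigma>)))"
proof -
  obtain r h E N where r: "r > 0" "ball a r \<subseteq> S" and h: "diffeo_on (ball a r) h"
    "\<And>y. y \<in> ball a r \<Longrightarrow> (h has_derivative E y) (at y)"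
    and linN: "\<And>y. linear (N y)" and Na: "\<And>v. N a v = v"
    and EN: "\<And>y v. y \<in> ball a r \<Longrightarrow> E y (N y v) = v" and NE: "\<And>y v. y \<in> ball a r \<Longrightarrow> N y (E y v) = v"
    and dE: "\<And>y v. y \<in> ball a r \<Longrightarrow> ((\<lambda>y. E y v) has_derivative (\<lambda>u. E y (\<Gamma> y u v))) (at y)"
    and dN: "\<And>y v. y \<in> ball a r \<Longrightarrow> ((\<lambda>y. N y v) has_derivative (\<lambda>u. - \<Gamma> y u (N y v))) (at y)"
    by (rule flat_coordinates[OF S a \<Gamma>_bilinear \<Gamma>_smooth \<Gamma>_sym \<Gamma>_flat]) blast+
  let ?B = "ball a r"
  note inS = subsetD[OF r(2)]
  have linE: "linear (E y)" if "y \<in> ?B" for y using has_derivative_linear[OF h(2)[OF that]] .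
  have const: "f y = f a" if "\<And>y. y \<in> ?B \<Longrightarrow> (f has_derivative (\<lambda>_. 0)) (at y)" "y \<in> ?B"
    for f :: "complex ^ 'n \<Rightarrow> 'b::real_normed_vector" and y
  proof -
    have "(f has_derivative (\<lambda>_. 0)) (at y within ?B)" if "y \<in> ?B" for y
      using \<open>\<And>y. y \<in> ?B \<Longrightarrow> (f has_derivative (\<lambda>_. 0)) (at y)\<close>[OF that] by (rule has_derivative_at_withinI)
    from has_derivative_zero_constant[OF convex_ball this]
    show ?thesis using that(2) r(1) by (metis centre_in_ball)
  qed
  have gN: "g y (N y p) (N y q) = g a p q" if "y \<in> ?B" for y p q
  proof -
    have "g y (N y p) (N y q) = g a (N a p) (N a q)"
    proof (rule const[OF _ that])
      fix y assume y: "y \<in> ?B"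
      have "((\<lambda>y. g y (N y p) (N y q)) has_derivative
        (\<lambda>u. (g y (\<Gamma> y u (N y p)) (N y q) + g y (N y p) (\<Gamma> y u (N y q)))
          + g y (- \<Gamma> y u (N y p)) (N y q) + g y (N y p) (- \<Gamma> y u (N y q)))) (at y)"
        by (rule has_derivative_bilinear_field[where B = g and Y = "\<lambda>y. N y p" and Z = "\<lambda>y. N y q"
              and B' = "\<lambda>w u v. g y (\<Gamma> y w u) v + g y u (\<Gamma> y w v)",
              OF S inS[OF y] bilinear_g g_has_derivative[OF inS[OF y]] dN[OF y] dN[OF y]])
      then show "((\<lambda>y. g y (N y p) (N y q)) has_derivative (\<lambda>_. 0)) (at y)"
        by (simp add: g_simps[OF inS[OF y]])
    qed
    then show ?thesis by (simp add: Na)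
  qed
  have JN: "J y (N y p) = N y (J a p)" if y: "y \<in> ?B" for y p
  proof -
    \<comment> \<open>This is the matrix of \<open>J\<close> in the parallel frame; its derivative
      vanishes because \<open>J\<close> is parallel.\<close>
    have "E y (J y (N y p)) = E a (J a (N a p))"
    proof (rule const[OF _ that])
      fix y assume y: "y \<in> ?B"
      have 1: "((\<lambda>y. J y (N y p)) has_derivative
        (\<lambda>u. (J y (\<Gamma> y u (N y p)) - \<Gamma> y u (J y (N y p))) + J y (- \<Gamma> y u (N y p)))) (at y)"
        by (rule has_derivative_linear_field[where A = J and A' = "\<lambda>w u. J y (\<Gamma> y w u) - \<Gamma> y w (J y u)",
              OF S inS[OF y] linear_J J_has_derivative[OF inS[OF y]] dN[OF y]])
      have "((\<lambda>y. E y (J y (N y p))) has_derivative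
        (\<lambda>u. E y (\<Gamma> y u (J y (N y p)))
          + E y ((J y (\<Gamma> y u (N y p)) - \<Gamma> y u (J y (N y p))) + J y (- \<Gamma> y u (N y p))))) (at y)"
        by (rule has_derivative_linear_field[where A = E and A' = "\<lambda>u v. E y (\<Gamma> y u v)",
              OF open_ball y linE dE[OF y] 1])
      then show "((\<lambda>y. E y (J y (N y p))) has_derivative (\<lambda>_. 0)) (at y)"
        by (simp add: linear_neg[OF linear_J[OF inS[OF y]]] linear_neg[OF linE[OF y]])
    qed
    then have "E y (J y (N y p)) = J a p" using EN[of a] r by (simp add: Na)
    then show ?thesis using NE[OF y] by metis
  qed
  have TN: "T y (N y p) (N y q) = N y (T a p q)" if y: "y \<in> ?B" for y p q
  proof -
    have "E y (T y (N y p) (N y q)) = E a (T a (N a p) (N a q))"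
    proof (rule const[OF _ that])
      fix y assume y: "y \<in> ?B"
      note T_simps = T_simps[OF inS[OF y]]
      have 1: "((\<lambda>y. T y (N y p) (N y q)) has_derivative
        (\<lambda>u. (T y (\<Gamma> y u (N y p)) (N y q) + T y (N y p) (\<Gamma> y u (N y q)) - \<Gamma> y u (T y (N y p) (N y q)))
          + T y (- \<Gamma> y u (N y p)) (N y q) + T y (N y p) (- \<Gamma> y u (N y q)))) (at y)"
        by (rule has_derivative_bilinear_field[where B = T and Y = "\<lambda>y. N y p" and Z = "\<lambda>y. N y q"
              and B' = "\<lambda>w u v. T y (\<Gamma> y w u) v + T y u (\<Gamma> y w v) - \<Gamma> y w (T y u v)",
              OF S inS[OF y] bilinear_T T_has_derivative[OF inS[OF y]] dN[OF y] dN[OF y]])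
      have "((\<lambda>y. E y (T y (N y p) (N y q))) has_derivative
        (\<lambda>u. E y (\<Gamma> y u (T y (N y p) (N y q))) + E y (
          (T y (\<Gamma> y u (N y p)) (N y q) + T y (N y p) (\<Gamma> y u (N y q)) - \<Gamma> y u (T y (N y p) (N y q)))
          + T y (- \<Gamma> y u (N y p)) (N y q) + T y (N y p) (- \<Gamma> y u (N y q))))) (at y)"
        by (rule has_derivative_linear_field[where A = E and A' = "\<lambda>u v. E y (\<Gamma> y u v)",
              OF open_ball y linE dE[OF y] 1])
      then show "((\<lambda>y. E y (T y (N y p) (N y q))) has_derivative (\<lambda>_. 0)) (at y)"
        by (simp add: T_simps linear_neg[OF linE[OF y]])
    qed
    then have "E y (T y (N y p) (N y q)) = T a p q" using EN[of a] r by (simp add: Na)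
    then show ?thesis using NE[OF y] by metis
  qed
  have bijN: "bij (N y)" and bijE: "bij (E y)" if "y \<in> ?B" for y
    using EN[OF that] NE[OF that] by (auto intro: bij_betw_byWitness[where f' = "E y"] bij_betw_byWitness[where f' = "N y"])
  have gE: "g a (E y p) (E y q) = g y p q" and JE: "J a (E y p) = E y (J y p)"
    and TE: "T a (E y p) (E y q) = E y (T y p q)" if y: "y \<in> ?B" for y p q
    using gN[OF y, of "E y p" "E y q"] JN[OF y, of "E y p"] TN[OF y, of "E y p" "E y q"]
    by (auto simp: NE[OF y] EN[OF y])
  have A: "(\<exists>L. adapted P \<sigma> y L) \<longleftrightarrow> (\<exists>L. adapted P \<sigma> a L)" if y: "y \<in> ?B" for P \<sigma> y
  proof
    assume "\<exists>L. adapted P \<sigma> y L"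
    then obtain L where "adapted P \<sigma> y L" by blast
    then have "adapted P \<sigma> a (E y \<circ> L)"
      by (auto simp: adapted_def gE[OF y] JE[OF y] TE[OF y] intro: linear_compose linE[OF y] bij_comp bijE[OF y])
    then show "\<exists>L. adapted P \<sigma> a L" by blast
  next
    assume "\<exists>L. adapted P \<sigma> a L"
    then obtain L where "adapted P \<sigma> a L" by blast
    then have "adapted P \<sigma> y (N y \<circ> L)"
      by (auto simp: adapted_def gN[OF y] JN[OF y] TN[OF y] intro: linear_compose linN bij_comp bijN[OF y])
    then show "\<exists>L. adapted P \<sigma> y L" by blast
  qed
  have B: "\<exists>H. diffeo_on ?B H \<and>
       preserves_metric ?B H g (\<lambda>_. std_metric P) \<and> preserves_endo ?B H J (\<lambda>_ u. \<i> *s u) \<and>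
       preserves_connection ?B H \<Gamma>' (\<lambda>_. \<sigma>)" if L: "\<exists>L. adapted P \<sigma> a L" for P \<sigma>
  proof -
    obtain L where L: "linear L" "bij L" "\<And>p q. g a (L p) (L q) = std_metric P p q"
      "\<And>p. J a (L p) = L (\<i> *s p)" "\<And>p q. T a (L p) (L q) = L (\<sigma> p q)"
      using L by (auto simp: adapted_def)
    define K where "K = inv L"
    have KL: "K (L p) = p" and LK: "L (K p) = p" for p
      using L(2) by (simp_all add: K_def bij_def surj_f_inv_f)
    have linK: "linear K"
      unfolding K_def by (rule inj_linear_imp_inv_linear) (use L in \<open>auto simp: bij_def\<close>)
    have bijK: "bij K" using L(2) by (simp add: K_def bij_imp_bij_inv)
    have gK: "std_metric P (K p) (K q) = g a p q" for p q using L(3)[of "K p" "K q"] by (simp add: LK)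
    have JK: "\<i> *s K p = K (J a p)" for p using L(4)[of "K p"] by (metis KL LK)
    have TK: "\<sigma> (K p) (K q) = K (T a p q)" for p q using L(5)[of "K p" "K q"] by (metis KL LK)
    define H where "H y = K (h y)" for y
    have dH: "(H has_derivative (\<lambda>u. K (E y u))) (at y)" if "y \<in> ?B" for y
      unfolding H_def by (rule has_derivative_compose[OF h(2)[OF that] linear_imp_has_derivative[OF linK]])
    have D: "differential H y u = K (E y u)" if "y \<in> ?B" for y u
      using frechet_derivative_at[OF dH[OF that]] by metis
    have "diffeo_on ?B H"
      unfolding H_def by (rule diffeo_on_compose[OF open_ball h(1) diffeo_on_linear[OF linK bijK]]) auto
    moreover have "preserves_metric ?B H g (\<lambda>_. std_metric P)"
      by (simp add: preserves_metric_def D gK gE)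
    moreover have "preserves_endo ?B H J (\<lambda>_ u. \<i> *s u)"
      by (simp add: preserves_endo_def D JK JE)
    moreover have "preserves_connection ?B H \<Gamma>' (\<lambda>_. \<sigma>)"
      unfolding preserves_connection_def
    proof (intro ballI allI)
      fix x u v assume x: "x \<in> ?B"
      \<comment> \<open>The second derivative of \<open>H\<close> is the image of
        \<open>\<Gamma>\<close>, so in the new coordinates \<open>\<Gamma>\<close> disappears and
        only the tensor \<open>T\<close> is left of \<open>\<Gamma>'\<close>.\<close>
      have "((\<lambda>y. K (E y v)) has_derivative (\<lambda>u. K (E x (\<Gamma> x u v)))) (at x)"
        by (rule has_derivative_compose[OF dE[OF x] linear_imp_has_derivative[OF linK]])
      then have "((\<lambda>y. differential H y v) has_derivative (\<lambda>u. K (E x (\<Gamma> x u v)))) (at x)"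
        by (rule has_derivative_transform_within_open[OF _ open_ball x]) (simp add: D)
      from frechet_derivative_at[OF this, symmetric]
      have "differential (\<lambda>y. differential H y v) x u = K (E x (\<Gamma> x u v))" by simp
      moreover have "\<sigma> (differential H x u) (differential H x v) = K (E x (T x u v))"
        by (simp add: D[OF x] TK TE[OF x])
      moreover have "differential H x (\<Gamma>' x u v) = K (E x (\<Gamma> x u v + T x u v))"
        by (simp add: D[OF x] T_def)
      ultimately show "differential H x (\<Gamma>' x u v) = differential (\<lambda>y. differential H y v) x u
          + \<sigma> (differential H x u) (differential H x v)"
        by (simp add: linear_add[OF linE[OF x]] linear_add[OF linK])
    qed
    ultimately show ?thesis by blast
  qed
  show ?thesis
  proof (intro exI[of _ ?B] conjI allI ballI impI)
    show "open ?B" by (rule open_ball)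
    show "a \<in> ?B" using r(1) by simp
    show "?B \<subseteq> S" by (rule r(2))
    show "(\<exists>L. adapted P \<sigma> y L) \<longleftrightarrow> (\<exists>L. adapted P \<sigma> a L)" if "y \<in> ?B" for P \<sigma> y
      by (rule A[OF that])
    show "\<exists>H. diffeo_on ?B H \<and>
       preserves_metric ?B H g (\<lambda>_. std_metric P) \<and> preserves_endo ?B H J (\<lambda>_ u. \<i> *s u) \<and>
       preserves_connection ?B H \<Gamma>' (\<lambda>_. \<sigma>)" if "\<exists>L. adapted P \<sigma> a L" for P \<sigma>
      by (rule B[OF that])
  qed
qed

end

section \<open>Globalization\<close>

lemma constant_fields:
  "cov \<Gamma> (\<lambda>_. u) (\<lambda>_. v) = (\<lambda>x. \<Gamma> x u v)" "lie (\<lambda>_. u) (\<lambda>_. v) = (\<lambda>x. 0)"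
  by (simp_all add: fun_eq_iff cov_def lie_def)

lemma flat_special_chart_of_manifold:
  fixes M :: "('a, complex ^ 'n) geometry"
  assumes M: "flat_special_kaehler_manifold M D" "constant_cubic_form M D" and c: "c \<in> atlas M"
  shows "flat_special_chart (chart_image c) (metr M c) (cplx M c) (D c) (conn M c)"
proof -
  have sk: "special_kaehler_manifold M D" and flatD: "flat_connection M D"
    using M(1) by (auto simp: flat_special_kaehler_manifold_def)
  have k: "kaehler_manifold M D" and conn: "is_connection M (conn M)" and tfC: "torsion_free M (conn M)"
    and flatC: "flat_connection M (conn M)" and parC: "parallel_form M (conn M) (kaehler_form M)"
    and spec: "\<And>X Y x. smooth_on (chart_image c) X \<Longrightarrow> smooth_on (chart_image c) Y \<Longrightarrow> x \<in> chart_image c \<Longrightarrow>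
      cov_endo (conn M c) X (cplx M c) Y x = cov_endo (conn M c) Y (cplx M c) X x"
    using sk c by (auto simp: special_kaehler_manifold_def)
  have sm: "smooth_manifold M" and pm: "pseudo_metric M" and cs: "complex_structure M"
    and lc: "levi_civita M D" and pe: "parallel_endo M D (cplx M)"
    and herm: "\<And>x u v. x \<in> chart_image c \<Longrightarrow> metr M c x (cplx M c x u) (cplx M c x v) = metr M c x u v"
    using k c by (auto simp: kaehler_manifold_def)
  have connD: "is_connection M D" and tfD: "torsion_free M D" and parD: "parallel_form M D (metr M)"
    using lc by (auto simp: levi_civita_def)
  let ?S = "chart_image c"
  have bil: "bilinear (D c x)" "bilinear (conn M c x)" "bilinear (metr M c x)" if "x \<in> ?S" for x
    using connD conn pm c that by (auto simp: is_connection_def pseudo_metric_def)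
  \<comment> \<open>The bracket of constant fields is zero, so the last term of
    \<open>curvature\<close> contains the symbols with first argument 0.\<close>
  have zero: "D c x 0 v = 0" "conn M c x 0 v = 0" if "x \<in> ?S" for x v
    using bil[OF that] by (simp_all add: bilinear_lzero)
  have flat: "differential (\<lambda>y. \<Gamma> c y w v) x u + \<Gamma> c x u (\<Gamma> c x w v)
      = differential (\<lambda>y. \<Gamma> c y u v) x w + \<Gamma> c x w (\<Gamma> c x u v)"
    if "flat_connection M \<Gamma>" "x \<in> ?S" "\<And>v. \<Gamma> c x 0 v = 0" for \<Gamma> x u v w
  proof -
    have "curvature (\<Gamma> c) (\<lambda>_. u) (\<lambda>_. w) (\<lambda>_. v) x = 0"
      using that(1,2) c by (simp add: flat_connection_def)
    then show ?thesis
      using that(3) by (simp add: curvature_def constant_fields) (simp add: cov_def)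
  qed
  have tf: "\<Gamma> c x u v = \<Gamma> c x v u" if "torsion_free M \<Gamma>" "x \<in> ?S" for \<Gamma> x u v
  proof -
    have "cov (\<Gamma> c) (\<lambda>_. u) (\<lambda>_. v) x - cov (\<Gamma> c) (\<lambda>_. v) (\<lambda>_. u) x = lie (\<lambda>_. u) (\<lambda>_. v) x"
      using that c by (simp add: torsion_free_def)
    then show ?thesis by (simp add: constant_fields)
  qed
  show ?thesis
  proof (rule flat_special_chart.intro)
    show "open ?S" using sm c by (simp add: smooth_manifold_def)
    show "smooth_on ?S (\<lambda>x. D c x u v)" "smooth_on ?S (\<lambda>x. conn M c x u v)"
      "smooth_on ?S (\<lambda>x. metr M c x u v)" "smooth_on ?S (\<lambda>x. cplx M c x u)" for u v
      using connD conn pm cs c by (auto simp: is_connection_def pseudo_metric_def complex_structure_def)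
    fix x assume x: "x \<in> ?S"
    show "bilinear (D c x)" "bilinear (conn M c x)" using bil[OF x] by auto
    show "hermitian_space (metr M c x) (cplx M c x)"
    proof (rule hermitian_space.intro)
      show "bilinear (metr M c x)" using bil[OF x] by simp
      show "linear (cplx M c x)" using cs c x by (auto simp: complex_structure_def)
      show "cplx M c x (cplx M c x u) = - u" for u using cs c x by (auto simp: complex_structure_def)
      show "metr M c x (cplx M c x u) (cplx M c x v) = metr M c x u v" for u v by (rule herm[OF x])
      show "metr M c x u v = metr M c x v u" for u v using pm c x by (auto simp: pseudo_metric_def)
      show "u = 0" if "\<And>v. metr M c x u v = 0" for u
        using pm c x that unfolding pseudo_metric_def by blast
    qed
    show "D c x u v = D c x v u" for u v
      by (rule tf[OF tfD x])
    show "conn M c x u v = conn M c x v u" for u v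
      by (rule tf[OF tfC x])
    fix u v w
    show "differential (\<lambda>y. D c y w v) x u + D c x u (D c x w v)
      = differential (\<lambda>y. D c y u v) x w + D c x w (D c x u v)"
      by (rule flat[OF flatD x zero(1)[OF x]])
    show "differential (\<lambda>y. conn M c y w v) x u + conn M c x u (conn M c x w v)
      = differential (\<lambda>y. conn M c y u v) x w + conn M c x w (conn M c x u v)"
      by (rule flat[OF flatC x zero(2)[OF x]])
    have "cov_form (D c) (\<lambda>_. w) (metr M c) (\<lambda>_. u) (\<lambda>_. v) x = 0"
      using parD c x by (simp add: parallel_form_def)
    then show "differential (\<lambda>y. metr M c y u v) x w = metr M c x (D c x w u) v + metr M c x u (D c x w v)"
      by (simp add: cov_form_def constant_fields)
    have "cov_form (conn M c) (\<lambda>_. w) (kaehler_form M c) (\<lambda>_. u) (\<lambda>_. v) x = 0"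
      using parC c x by (simp add: parallel_form_def)
    then show "differential (\<lambda>y. metr M c y (cplx M c y u) v) x w =
      metr M c x (cplx M c x (conn M c x w u)) v + metr M c x (cplx M c x u) (conn M c x w v)"
      by (simp add: cov_form_def constant_fields kaehler_form_def[abs_def])
    have "cov_endo (D c) (\<lambda>_. w) (cplx M c) (\<lambda>_. u) x = 0"
      using pe c x by (simp add: parallel_endo_def)
    then show "differential (\<lambda>y. cplx M c y u) x w = cplx M c x (D c x w u) - D c x w (cplx M c x u)"
      by (simp add: cov_endo_def constant_fields cov_def algebra_simps)
    have "cov_tensor12 (D c) (\<lambda>_. w) (\<lambda>x u v. conn M c x u v - D c x u v) (\<lambda>_. u) (\<lambda>_. v) x = 0"
      using M(2) c x by (simp add: constant_cubic_form_def parallel_tensor12_def)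
    then show "differential (\<lambda>y. conn M c y u v - D c y u v) x w =
      (conn M c x (D c x w u) v - D c x (D c x w u) v) + (conn M c x u (D c x w v) - D c x u (D c x w v))
      - D c x w (conn M c x u v - D c x u v)"
      by (simp add: cov_tensor12_def constant_fields) (simp add: cov_def algebra_simps)
    have "cov_endo (conn M c) (\<lambda>_. u) (cplx M c) (\<lambda>_. v) x = cov_endo (conn M c) (\<lambda>_. v) (cplx M c) (\<lambda>_. u) x"
      by (rule spec) (simp_all add: x)
    then show "differential (\<lambda>y. cplx M c y v) x u + conn M c x u (cplx M c x v) - cplx M c x (conn M c x u v) =
      differential (\<lambda>y. cplx M c y u) x v + conn M c x v (cplx M c x u) - cplx M c x (conn M c x v u)"
      by (simp add: cov_endo_def constant_fields cov_def)
  qed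
qed

locale flat_special_manifold =
  fixes M :: "('a, complex ^ 'n::finite) geometry" and D
  assumes special: "flat_special_kaehler_manifold M D" and const: "constant_cubic_form M D"
begin

lemma chart: "c \<in> atlas M \<Longrightarrow> flat_special_chart (chart_image c) (metr M c) (cplx M c) (D c) (conn M c)"
  by (rule flat_special_chart_of_manifold[OF special const])

lemma smooth: "smooth_manifold M"
  using special by (simp add: flat_special_kaehler_manifold_def special_kaehler_manifold_def kaehler_manifold_def)

abbreviation adapted :: "_ \<Rightarrow> 'n set \<Rightarrow> _" where
  "adapted c \<equiv> flat_special_chart.adapted (metr M c) (cplx M c) (D c) (conn M c)"

lemma chart_homeomorphic:
  assumes "c \<in> atlas M"
  shows "openin (mtop M) (fst c)"
    "homeomorphic_map (subtopology (mtop M) (fst c)) (top_of_set (chart_image c)) (snd c)"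
    "inj_on (snd c) (fst c)" "fst c \<subseteq> topspace (mtop M)" "open (chart_image c)"
proof -
  show 1: "openin (mtop M) (fst c)"
    and 2: "homeomorphic_map (subtopology (mtop M) (fst c)) (top_of_set (chart_image c)) (snd c)"
    and "open (chart_image c)"
    using smooth assms by (auto simp: smooth_manifold_def)
  show 3: "fst c \<subseteq> topspace (mtop M)" using 1 by (rule openin_subset)
  show "inj_on (snd c) (fst c)"
    using homeomorphic_imp_injective_map[OF 2] 3 by (simp add: inf.absorb2)
qed

lemma openin_chart_preimage:
  assumes c: "c \<in> atlas M" and U: "open U"
  shows "openin (mtop M) {p \<in> fst c. snd c p \<in> U}"
proof -
  note h = chart_homeomorphic[OF c]
  have "openin (top_of_set (chart_image c)) (chart_image c \<inter> U)" using U by (rule openin_open_Int)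
  from openin_continuous_map_preimage[OF homeomorphic_imp_continuous_map[OF h(2)] this]
  have "openin (subtopology (mtop M) (fst c)) {p \<in> fst c. snd c p \<in> U}"
    using h(4) by (simp add: inf.absorb2 chart_image_def cong: conj_cong)
  then show ?thesis using h(1) by (rule openin_trans_full)
qed

lemma open_chart_image:
  assumes c: "c \<in> atlas M" and U: "openin (mtop M) U"
  shows "open (snd c ` (U \<inter> fst c))"
proof -
  note h = chart_homeomorphic[OF c]
  have "openin (subtopology (mtop M) (fst c)) (U \<inter> fst c)" using U by (auto simp: openin_subtopology)
  then have "openin (top_of_set (chart_image c)) (snd c ` (U \<inter> fst c))"
    using homeomorphic_imp_open_map[OF h(2)] by (simp add: open_map_def)
  then show ?thesis using h(5) by (simp add: openin_open_eq)
qed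

lemma transition:
  assumes c: "c \<in> atlas M" and c': "c' \<in> atlas M"
  defines "S \<equiv> coord_dom c c' (topspace (mtop M)) id"
  shows "open S" "diffeo_on S (coord_rep c c' id)"
    "preserves_metric S (coord_rep c c' id) (metr M c) (metr M c')"
    "preserves_endo S (coord_rep c c' id) (cplx M c) (cplx M c')"
    "preserves_connection S (coord_rep c c' id) (conn M c) (conn M c')"
    "preserves_connection S (coord_rep c c' id) (D c) (D c')"
    "\<And>p. p \<in> fst c \<Longrightarrow> p \<in> fst c' \<Longrightarrow> snd c p \<in> S \<and> coord_rep c c' id (snd c p) = snd c' p"
proof -
  note h = chart_homeomorphic[OF c]
  have "S = snd c ` (fst c' \<inter> fst c)" using h(4) by (auto simp: S_def coord_dom_def)
  then show "open S" using open_chart_image[OF c chart_homeomorphic(1)[OF c']] by simp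
  show "diffeo_on S (coord_rep c c' id)" using smooth c c' unfolding smooth_manifold_def S_def by blast
  show "preserves_metric S (coord_rep c c' id) (metr M c) (metr M c')"
    "preserves_endo S (coord_rep c c' id) (cplx M c) (cplx M c')"
    "preserves_connection S (coord_rep c c' id) (conn M c) (conn M c')"
    "preserves_connection S (coord_rep c c' id) (D c) (D c')"
    using special c c'
    by (simp_all add: flat_special_kaehler_manifold_def special_kaehler_manifold_def kaehler_manifold_def
        pseudo_metric_def complex_structure_def is_connection_def levi_civita_def S_def)
  show "snd c p \<in> S \<and> coord_rep c c' id (snd c p) = snd c' p" if "p \<in> fst c" "p \<in> fst c'" for p
    using that h(3,4) by (auto simp: S_def coord_dom_def coord_rep_def)
qed

text \<open>The differential of the transition map transports adapted frames: the two connections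
  have the same inhomogeneous term in their transformation laws, so their difference transforms as a
  tensor.\<close>

lemma adapted_change_chart:
  assumes c: "c \<in> atlas M" "p \<in> fst c" and c': "c' \<in> atlas M" "p \<in> fst c'"
    and N: "adapted c P \<sigma> (snd c p) N"
  shows "\<exists>N. adapted c' P \<sigma> (snd c' p) N"
proof -
  interpret A: flat_special_chart "chart_image c" "metr M c" "cplx M c" "D c" "conn M c" by (rule chart[OF c(1)])
  interpret B: flat_special_chart "chart_image c'" "metr M c'" "cplx M c'" "D c'" "conn M c'" by (rule chart[OF c'(1)])
  note t = transition[OF c(1) c'(1)]
  let ?\<tau> = "coord_rep c c' id" and ?x = "snd c p"
  let ?d = "differential ?\<tau> ?x"
  have x: "?x \<in> coord_dom c c' (topspace (mtop M)) id" and \<tau>x: "?\<tau> ?x = snd c' p"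
    using t(7)[OF c(2) c'(2)] by auto
  have d: "linear ?d" "bij ?d" using diffeo_on_differential_bij[OF t(1) x t(2)] by auto
  have g: "metr M c' (snd c' p) (?d u) (?d v) = metr M c ?x u v" for u v
    using t(3)[unfolded preserves_metric_def, rule_format, OF x, of u v] unfolding \<tau>x .
  have J: "cplx M c' (snd c' p) (?d u) = ?d (cplx M c ?x u)" for u
    using t(4)[unfolded preserves_endo_def, rule_format, OF x, of u] unfolding \<tau>x .
  have T: "B.T (snd c' p) (?d u) (?d v) = ?d (A.T ?x u v)" for u v
  proof -
    note pc = t(5,6)[unfolded preserves_connection_def, rule_format, OF x, of u v, unfolded \<tau>x]
    have "?d (conn M c ?x u v) = differential (\<lambda>y. differential ?\<tau> y v) ?x u + conn M c' (snd c' p) (?d u) (?d v)"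
      "?d (D c ?x u v) = differential (\<lambda>y. differential ?\<tau> y v) ?x u + D c' (snd c' p) (?d u) (?d v)"
      by (rule pc)+
    then show ?thesis by (simp add: A.T_def B.T_def linear_diff[OF d(1)])
  qed
  have "adapted c' P \<sigma> (snd c' p) (?d \<circ> N)"
    using N by (auto simp: A.adapted_def B.adapted_def g J T intro: linear_compose d bij_comp)
  then show ?thesis by blast
qed

text \<open>One suitable chart is enough here; \<open>modelled_iff\<close> passes to any chart
  around \<open>p\<close>, so this is a property of the point alone.\<close>

definition modelled :: "'n set \<Rightarrow> (complex ^ 'n \<Rightarrow> complex ^ 'n \<Rightarrow> complex ^ 'n) \<Rightarrow> 'a \<Rightarrow> bool" where
  "modelled P \<sigma> p \<longleftrightarrow> (\<exists>c\<in>atlas M. p \<in> fst c \<and> (\<exists>N. adapted c P \<sigma> (snd c p) N))"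

lemma modelled_iff: "c \<in> atlas M \<Longrightarrow> p \<in> fst c \<Longrightarrow> modelled P \<sigma> p \<longleftrightarrow> (\<exists>N. adapted c P \<sigma> (snd c p) N)"
  unfolding modelled_def using adapted_change_chart by blast

lemma ex_chart: "p \<in> topspace (mtop M) \<Longrightarrow> \<exists>c\<in>atlas M. p \<in> fst c"
  using smooth by (auto simp: smooth_manifold_def)

lemma modelled_locally_constant:
  assumes p: "p \<in> topspace (mtop M)"
  shows "\<exists>V. openin (mtop M) V \<and> p \<in> V \<and> (\<forall>q\<in>V. \<forall>P \<sigma>. modelled P \<sigma> q \<longleftrightarrow> modelled P \<sigma> p)"
proof -
  obtain c where c: "c \<in> atlas M" "p \<in> fst c" using ex_chart[OF p] by blast
  interpret A: flat_special_chart "chart_image c" "metr M c" "cplx M c" "D c" "conn M c" by (rule chart[OF c(1)])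
  have "snd c p \<in> chart_image c" using c(2) by (simp add: chart_image_def)
  from A.flat_adapted_coordinates[OF this] obtain U where U: "open U" "snd c p \<in> U"
    "\<forall>P \<sigma>. \<forall>y\<in>U. (\<exists>N. A.adapted P \<sigma> y N) \<longleftrightarrow> (\<exists>N. A.adapted P \<sigma> (snd c p) N)"
    by (elim exE conjE)
  show ?thesis
  proof (intro exI[of _ "{q \<in> fst c. snd c q \<in> U}"] conjI ballI allI)
    show "openin (mtop M) {q \<in> fst c. snd c q \<in> U}" by (rule openin_chart_preimage[OF c(1) U(1)])
    show "p \<in> {q \<in> fst c. snd c q \<in> U}" using c(2) U(2) by simp
    show "modelled P \<sigma> q \<longleftrightarrow> modelled P \<sigma> p" if "q \<in> {q \<in> fst c. snd c q \<in> U}" for q P \<sigma>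
      using that U(3) by (simp add: modelled_iff[OF c(1)] c(2))
  qed
qed

text \<open>Local constancy makes both the set where the model fits and its complement open, and a
  connected set cannot meet both.\<close>

lemma modelled_on_component:
  assumes p: "modelled P \<sigma> p" and q: "q \<in> connected_component_of_set (mtop M) p"
  shows "modelled P \<sigma> q"
proof (rule ccontr)
  assume nq: "\<not> modelled P \<sigma> q"
  obtain C where C: "connectedin (mtop M) C" "p \<in> C" "q \<in> C"
    using q by (auto simp: connected_component_of_def)
  define A where "A b = {x \<in> topspace (mtop M). modelled P \<sigma> x = b}" for b
  have op: "openin (mtop M) (A b)" for b
  proof (subst openin_subopen, intro ballI)
    fix x assume x: "x \<in> A b"
    then have "x \<in> topspace (mtop M)" by (simp add: A_def)
    from modelled_locally_constant[OF this] obtain V where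
      V: "openin (mtop M) V" "x \<in> V" "\<forall>q\<in>V. \<forall>P \<sigma>. modelled P \<sigma> q \<longleftrightarrow> modelled P \<sigma> x"
      by (elim exE conjE)
    have "V \<subseteq> A b"
    proof
      fix y assume y: "y \<in> V"
      have "modelled P \<sigma> y = modelled P \<sigma> x" using V(3) y by blast
      then show "y \<in> A b" using x y openin_subset[OF V(1)] unfolding A_def by blast
    qed
    then show "\<exists>V. openin (mtop M) V \<and> x \<in> V \<and> V \<subseteq> A b" using V(1,2) by blast
  qed
  have sub: "C \<subseteq> topspace (mtop M)" using C(1) by (rule connectedin_subset_topspace)
  have "C \<subseteq> A True \<union> A False" using sub by (auto simp: A_def)
  moreover have "A True \<inter> A False \<inter> C = {}" by (auto simp: A_def)
  moreover have "A True \<inter> C \<noteq> {}" "A False \<inter> C \<noteq> {}"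
    using p nq C(2,3) sub by (auto simp: A_def)
  ultimately show False using C(1) op unfolding connectedin by blast
qed

lemma ex_modelled:
  assumes "p \<in> topspace (mtop M)"
  shows "\<exists>P W f. complex_isotropic P W \<and> cubic_poly_in_S03 P W f \<and> modelled P (S_tensor P f 0) p"
proof -
  obtain c where c: "c \<in> atlas M" "p \<in> fst c" using ex_chart[OF assms] by blast
  interpret A: flat_special_chart "chart_image c" "metr M c" "cplx M c" "D c" "conn M c" by (rule chart[OF c(1)])
  have "snd c p \<in> chart_image c" using c(2) by (simp add: chart_image_def)
  from A.ex_adapted[OF this] show ?thesis unfolding modelled_iff[OF c] .
qed

lemma locally_equivalent_of_modelled:
  assumes W: "complex_isotropic P W" and f: "cubic_poly_in_S03 P W f"
    and p: "modelled P (S_tensor P f 0) p"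
  shows "locally_equivalent_at M p (V_space P f)"
proof -
  obtain c where c: "c \<in> atlas M" "p \<in> fst c" and N: "\<exists>N. adapted c P (S_tensor P f 0) (snd c p) N"
    using p by (auto simp: modelled_def)
  interpret A: flat_special_chart "chart_image c" "metr M c" "cplx M c" "D c" "conn M c" by (rule chart[OF c(1)])
  note hc = chart_homeomorphic[OF c(1)]
  have "snd c p \<in> chart_image c" using c(2) by (simp add: chart_image_def)
  from A.flat_adapted_coordinates[OF this] obtain U where
    U: "open U" "snd c p \<in> U" "U \<subseteq> chart_image c" and
    "\<forall>P \<sigma>. (\<exists>N. A.adapted P \<sigma> (snd c p) N) \<longrightarrow> (\<exists>H. diffeo_on U H \<and>
       preserves_metric U H (metr M c) (\<lambda>_. std_metric P) \<and> preserves_endo U H (cplx M c) (\<lambda>_ u. \<i> *s u) \<and>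
       preserves_connection U H (conn M c) (\<lambda>_. \<sigma>))"
    by (elim exE conjE)
  from this(4)[rule_format, OF N] obtain H where H: "diffeo_on U H" "preserves_metric U H (metr M c) (\<lambda>_. std_metric P)"
    "preserves_endo U H (cplx M c) (\<lambda>_ u. \<i> *s u)" "preserves_connection U H (conn M c) (\<lambda>_. S_tensor P f 0)"
    by blast
  have H': "smooth_on U H" "inj_on H U" "open (H ` U)" "smooth_on (H ` U) (inv_into U H)"
    using H(1) by (auto simp: diffeo_on_def)
  define V where "V = {q \<in> fst c. snd c q \<in> U}"
  have V: "openin (mtop M) V" unfolding V_def by (rule openin_chart_preimage[OF c(1) U(1)])
  have Vimg: "snd c ` V = U" using U(3) by (auto simp: V_def chart_image_def)
  define F where "F = H \<circ> snd c"
  have "homeomorphic_map (subtopology (subtopology (mtop M) (fst c)) V)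
      (subtopology (top_of_set (chart_image c)) U) (snd c)"
  proof (rule homeomorphic_map_subtopologies[OF hc(2)])
    have "topspace (mtop M) \<inter> fst c \<inter> V = V" using hc(4) by (auto simp: V_def)
    then show "snd c ` (topspace (subtopology (mtop M) (fst c)) \<inter> V)
        = topspace (top_of_set (chart_image c)) \<inter> U"
      using Vimg U(3) by (simp add: inf.absorb2)
  qed
  moreover have "fst c \<inter> V = V" "chart_image c \<inter> U = U" using U(3) by (auto simp: V_def)
  ultimately have "homeomorphic_map (subtopology (mtop M) V) (top_of_set U) (snd c)"
    by (simp add: subtopology_subtopology)
  moreover have "homeomorphic_map (top_of_set U) (top_of_set (H ` U)) H"
  proof -
    have "homeomorphic_maps (top_of_set U) (top_of_set (H ` U)) H (inv_into U H)"
      unfolding homeomorphic_maps_def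
      using smooth_on_continuous[OF H'(1)] smooth_on_continuous[OF H'(4)] H'(2)
      by (auto simp: inv_into_into)
    then show ?thesis using homeomorphic_map_maps by blast
  qed
  ultimately have homeo: "homeomorphic_map (subtopology (mtop M) V) (top_of_set (H ` U)) F"
    unfolding F_def by (rule homeomorphic_map_compose)
  have "equivalence M V (V_space P f) (H ` U) F"
    unfolding equivalence_def V_space_simps[OF W f] Let_def
  proof (intro conjI ballI)
    show "homeomorphic_map (subtopology (mtop M) V) (top_of_set (H ` U)) F" by (rule homeo)
    fix c1 :: "('a, complex ^ 'n) chart" and c' :: "(complex ^ 'n, complex ^ 'n) chart"
    assume c1: "c1 \<in> atlas M" and c': "c' \<in> {(UNIV, id)}"
    note t = transition[OF c1 c(1)] and h1 = chart_homeomorphic[OF c1]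
    let ?\<tau> = "coord_rep c1 c id" and ?S = "coord_dom c1 c' V F"
    have S: "?S = snd c1 ` (V \<inter> fst c1)" using c' by (auto simp: coord_dom_def)
    have oS: "open ?S" unfolding S by (rule open_chart_image[OF c1 V])
    \<comment> \<open>In another chart \<open>c1\<close> the map \<open>F\<close> reads as the
      transition map to \<open>c\<close> followed by \<open>H\<close>, and both factors preserve the
      structures.\<close>
    have rep: "coord_rep c1 c' F = (\<lambda>x. H (?\<tau> x))"
      using c' by (simp add: coord_rep_def F_def fun_eq_iff)
    have sub: "?S \<subseteq> coord_dom c1 c (topspace (mtop M)) id" and \<tau>U: "?\<tau> ` ?S \<subseteq> U"
      using t(7) unfolding S by (auto simp: V_def)
    have d\<tau>: "diffeo_on ?S ?\<tau>" by (rule diffeo_on_subset[OF t(2) sub oS])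
    then have sm: "smooth_on ?S ?\<tau>" by (simp add: diffeo_on_def)
    show "diffeo_on ?S (coord_rep c1 c' F)"
      unfolding rep by (rule diffeo_on_compose[OF oS d\<tau> H(1) \<tau>U U(1)])
    show "preserves_metric ?S (coord_rep c1 c' F) (metr M c1) (\<lambda>_. std_metric P)"
      unfolding rep by (rule preserves_metric_compose[OF sm H'(1) \<tau>U _ H(2)])
        (use t(3) sub in \<open>auto simp: preserves_metric_def\<close>)
    show "preserves_endo ?S (coord_rep c1 c' F) (cplx M c1) (\<lambda>_ u. \<i> *s u)"
      unfolding rep by (rule preserves_endo_compose[OF sm H'(1) \<tau>U _ H(3)])
        (use t(4) sub in \<open>auto simp: preserves_endo_def\<close>)
    show "preserves_connection ?S (coord_rep c1 c' F) (conn M c1) (\<lambda>_. S_tensor P f 0)"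
      unfolding rep by (rule preserves_connection_compose[OF oS sm H'(1) \<tau>U U(1) _ H(4)])
        (use t(5) sub in \<open>auto simp: preserves_connection_def\<close>)
  qed
  moreover have "p \<in> V" using c(2) U(2) by (simp add: V_def)
  ultimately show ?thesis
    unfolding locally_equivalent_at_def V_space_simps[OF W f] using V H'(3) by auto
qed

end

theorem theorem5:
  shows
    "(\<forall>(P :: 'n::finite set) W f.
        complex_isotropic P W \<longrightarrow> cubic_poly_in_S03 P W f \<longrightarrow>
          flat_special_kaehler_manifold (V_space P f) D_std \<and>
          constant_cubic_form (V_space P f) D_std \<and>
          complete_connection (V_space P f) D_std \<and>
          complete_connection (V_space P f) (conn (V_space P f))) \<and>
     (\<forall>(M :: ('a, complex ^ 'n) geometry) D.
        flat_special_kaehler_manifold M D \<longrightarrow> constant_cubic_form M D \<longrightarrow>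
          (\<forall>p\<in>topspace (mtop M).
             \<exists>P W f. complex_isotropic P W \<and> cubic_poly_in_S03 P W f \<and>
               (\<forall>q\<in>connected_component_of_set (mtop M) p.
                  locally_equivalent_at M q (V_space P f))))"
proof (intro conjI allI impI ballI)
  fix P :: "'n set" and W f
  assume "complex_isotropic P W" "cubic_poly_in_S03 P W f"
  note V = V_space_flat_special_kaehler[OF this]
  show "flat_special_kaehler_manifold (V_space P f) D_std" by (rule V(1))
  show "constant_cubic_form (V_space P f) D_std" by (rule V(2))
  show "complete_connection (V_space P f) D_std" by (rule V(3))
  show "complete_connection (V_space P f) (conn (V_space P f))" by (rule V(4))
next
  fix M :: "('a, complex ^ 'n) geometry" and D p
  assume "flat_special_kaehler_manifold M D" "constant_cubic_form M D" and p: "p \<in> topspace (mtop M)"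
  then interpret flat_special_manifold M D by unfold_locales
  \<comment> \<open>The model is fixed at \<open>p\<close> before \<open>q\<close> is chosen, and
    then propagated through the component.\<close>
  obtain P W f where *: "complex_isotropic P W" "cubic_poly_in_S03 P W f" "modelled P (S_tensor P f 0) p"
    using ex_modelled[OF p] by blast
  have "locally_equivalent_at M q (V_space P f)" if "q \<in> connected_component_of_set (mtop M) p" for q
    by (rule locally_equivalent_of_modelled[OF *(1,2) modelled_on_component[OF *(3) that]])
  with * show "\<exists>P W f. complex_isotropic P W \<and> cubic_poly_in_S03 P W f \<and>
      (\<forall>q\<in>connected_component_of_set (mtop M) p. locally_equivalent_at M q (V_space P f))" by blast
qed

end
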